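(* Let $\chi$ be a real primitive self-dual Dirichlet character modulo $N>1$, let $\nu=0$ if $\chi$ is even and $\nu=1$ if $\chi$ is odd, and let $\theta_\chi(z)=\chi(0)+2\sum_{n\ge1}\chi(n)n^{\nu}e^{\pi i n^2 z}$. For integers $n\ge0$ let $$F(n)=\frac{1}{2^{2n+1}}\int_{1/N}^{\infty}\theta_\chi(iy)\,(Ny)^{\frac14+\frac{\nu}{2}}\left(1+(-1)^n\right)\left(\log(N^2)+2\log y\right)^{n}\,\frac{dy}{y},$$ which is the paper's expression for $\Lambda^{(n)}(\chi,\tfrac12)$, where $\Lambda(\chi,s)=\left(\frac{N}{\pi}\right)^{\frac{s+\nu}{2}}\Gamma\left(\frac{s+\nu}{2}\right)L(\chi,s)$ and $L(\chi,s)=\sum_{n\ge1}\chi(n)n^{-s}$. Then $F(n)$ is given to all orders by the asymptotic expansion $$F(n)\sim\frac{\sqrt{2\pi}\,N^{\frac14+\frac{\nu}{2}}(1+(-1)^n)}{2^{2n}}\cdot\frac{L^{n+1}}{\sqrt{4n\left(1+\frac{L}{2}\right)-\left(\frac34-\frac{\nu}{2}\right)L^2}}\cdot e^{\left(\frac18+\frac{\nu}{4}\right)(L-\log(N^2))-\frac{2n}{L}+\frac34-\frac{\nu}{2}}\left(1+\frac{b_1}{n}+\frac{b_2}{n^2}+\cdots\right)\qquad(n\to\infty),$$ where $L=L(n)$ is the unique positive solution of $n=\frac12\left(\pi e^{\frac{L-\log(N^2)}{2}}+\frac34-\frac{\nu}{2}\right)L$ (so that $L\approx 2\log\left(\frac{nN}{\log(nN)}\right)$),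 and each coefficient $b_j$ belongs to $\mathbb{Q}(L)$, the first being $b_1=\frac{L^4+9L^3+32L^2+24L+16}{24(L+2)^3}$.
   Context: The asymptotic expansion is meant in the asymptotic sense: truncating the series $1+b_1/n+b_2/n^2+\cdots$ after finitely many terms gives an approximation whose relative error is of smaller order than the last retained term as $n\to\infty$. Since $\chi$ is nonprincipal, $\Xi(\chi,z)=\Lambda(\chi,\frac12-iz)$ and $\Xi^{(n)}(\chi,0)=(-i)^nF(n)$. *)

theory Defs
  imports
    "HOL-Analysis.Analysis"
    "HOL-Computational_Algebra.Polynomial"
    "HOL-Library.Landau_Symbols"
begin

definition dirichlet_character :: "nat \<Rightarrow> (int \<Rightarrow> complex) \<Rightarrow> bool" where
  "dirichlet_character N chi \<longleftrightarrow> N > 0 \<and>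
     (\<forall>m n. chi (m * n) = chi m * chi n) \<and>
     (\<forall>n. chi (n + int N) = chi n) \<and>
     (\<forall>n. chi n \<noteq> 0 \<longleftrightarrow> coprime n (int N))"

text \<open>Primitive means: not induced by a character of a proper divisor of the modulus.\<close>

definition primitive_dirichlet_character :: "nat \<Rightarrow> (int \<Rightarrow> complex) \<Rightarrow> bool" where
  "primitive_dirichlet_character N chi \<longleftrightarrow> dirichlet_character N chi \<and>
     \<not> (\<exists>d \<psi>. d dvd N \<and> d < N \<and> dirichlet_character d \<psi> \<and>
            (\<forall>n. coprime n (int N) \<longrightarrow> chi n = \<psi> n))"

definition real_character :: "(int \<Rightarrow> complex) \<Rightarrow> bool" where
  "real_character chi \<longleftrightarrow> (\<forall>n. chi n \<in> \<real>)"

definition self_dual_character :: "(int \<Rightarrow> complex) \<Rightarrow> bool" where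
  "self_dual_character chi \<longleftrightarrow> (\<forall>n. cnj (chi n) = chi n)"

text \<open>A Dirichlet character takes the value 1 (even) or -1 (odd) at -1.\<close>

definition parity_exponent :: "(int \<Rightarrow> complex) \<Rightarrow> nat" where
  "parity_exponent chi = (if chi (- 1) = 1 then 0 else 1)"

definition theta_char :: "(int \<Rightarrow> complex) \<Rightarrow> complex \<Rightarrow> complex" where
  "theta_char chi z = chi 0 + 2 * (\<Sum>k. let n = Suc k in
     chi (int n) * of_nat n ^ parity_exponent chi *
     exp (complex_of_real pi * \<i> * of_nat n ^ 2 * z))"

definition F_char :: "nat \<Rightarrow> (int \<Rightarrow> complex) \<Rightarrow> nat \<Rightarrow> complex" where
  "F_char N chi n = (let \<nu> = real (parity_exponent chi) in
     1 / 2 ^ (2 * n + 1) *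
     (LINT y:{1 / real N..}|lborel.
        theta_char chi (\<i> * complex_of_real y) *
        complex_of_real ((real N * y) powr (1 / 4 + \<nu> / 2) * (1 + (- 1) ^ n) *
          (ln (real N ^ 2) + 2 * ln y) ^ n / y)))"

definition is_saddle :: "nat \<Rightarrow> real \<Rightarrow> nat \<Rightarrow> real \<Rightarrow> bool" where
  "is_saddle N \<nu> n L \<longleftrightarrow> L > 0 \<and>
     real n = 1 / 2 * (pi * exp ((L - ln (real N ^ 2)) / 2) + 3 / 4 - \<nu> / 2) * L"

text \<open>Meaningful for \<open>n \<ge> 1\<close> only: for \<open>n = 0\<close> the equation has no positive solution.\<close>

definition saddle :: "nat \<Rightarrow> real \<Rightarrow> nat \<Rightarrow> real" where
  "saddle N \<nu> n = (THE L. is_saddle N \<nu> n L)"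

definition main_term :: "nat \<Rightarrow> real \<Rightarrow> nat \<Rightarrow> real" where
  "main_term N \<nu> n = (let L = saddle N \<nu> n in
     sqrt (2 * pi) * real N powr (1 / 4 + \<nu> / 2) * (1 + (- 1) ^ n) / 2 ^ (2 * n) *
     (L ^ (n + 1) / sqrt (4 * real n * (1 + L / 2) - (3 / 4 - \<nu> / 2) * L ^ 2)) *
     exp ((1 / 8 + \<nu> / 4) * (L - ln (real N ^ 2)) - 2 * real n / L + 3 / 4 - \<nu> / 2))"

text \<open>
  Rational functions in one variable with rational coefficients, as functions on the reals.
  Values at the finitely many zeros of the denominator are junk.
\<close>

definition rational_functions_over_Q :: "(real \<Rightarrow> real) set" where
  "rational_functions_over_Q =
     {\<lambda>x. poly (map_poly of_rat p) x / poly (map_poly of_rat q) x |p q :: rat poly. q \<noteq> 0}"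

text \<open>
  \<open>f n \<sim> M n * (c\<^sub>0 n + c\<^sub>1 n + \<dots>)\<close>: after every truncation, the error relative to
  \<open>M\<close> is of smaller order than the last retained term. The factor \<open>M\<close> is kept on both
  sides because it may vanish for some \<open>n\<close>; there the condition forces \<open>f n = 0\<close> for
  all large \<open>n\<close>.
\<close>

definition asymptotic_expansion ::
    "(nat \<Rightarrow> complex) \<Rightarrow> (nat \<Rightarrow> complex) \<Rightarrow> (nat \<Rightarrow> nat \<Rightarrow> complex) \<Rightarrow> bool" where
  "asymptotic_expansion f M c \<longleftrightarrow>
     (\<forall>K. (\<lambda>n. f n - M n * (\<Sum>j\<le>K. c j n)) \<in> o[at_top](\<lambda>n. M n * c K n))"

end

theory Submission
  imports Defs "HOL-Probability.Distributions" "HOL-Real_Asymp.Real_Asymp"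
begin

text \<open>
  Put \<open>\<beta> = 3/4 - \<nu>/2\<close>, \<open>h = 1/sqrt n\<close> and substitute \<open>log (N\<^sup>2) + 2 log y = L (1 + h t)\<close>. The
  saddle point equation turns the integral into the main term times a Laplace integral whose
  integrand is \<open>exp (- (1 + L/2) t\<^sup>2 / 2)\<close> times the exponential of a power series in \<open>h\<close>, with
  coefficients polynomial in \<open>t\<close> and \<open>L\<close>; only \<open>exp (- \<pi> y)\<close> contributes from the theta series, up
  to an exponentially small error. Integrating the expanded exponential termwise against the
  Gaussian gives powers of \<open>h\<^sup>2 = 1/n\<close>, and the square root in the main term contributes a binomial
  series. All error bounds may lose powers of \<open>L\<close>, because \<open>L\<close> grows like \<open>2 log n\<close>. Finally \<open>b\<^sub>j\<close>
  is not the zero function, since it has a pole of exact order \<open>3 j\<close> at \<open>L = - 2\<close>; hence \<open>b\<^sub>j (L)\<close> is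
  bounded below by a negative power of \<open>L\<close>, and the error is of smaller order than the last term.
\<close>

section \<open>Taylor remainders\<close>

text \<open>The main term is Laplace's method in \<open>y\<close> itself. With the theta series
  replaced by its leading exponential, the saddle equation says that the integrand against
  \<open>dy\<close> is stationary at \<open>log (N^2) + 2 log y = L\<close>, and the quantity under
  the square root is \<open>- L^2 y^2\<close> times the second derivative of its logarithm there. In
  \<open>t\<close> only what is multiplied by \<open>n\<close> enters the Gaussian, so its variance
  is simply \<open>1 / (1 + L/2)\<close>; the price is an additional drift
  \<open>L \<tau> / 2\<close> from \<open>dy/dt\<close>, and the binomial series that reconciles the
  two square roots. The obstacle is that \<open>L\<close> moves with \<open>n\<close>, so every
  estimate has to be uniform in \<open>L\<close>. This dictates the cutoff
  \<open>|t| h \<le> 1 / (64 L^2)\<close>. Inside it the truncated exponent beyond the Gaussian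
  stays below \<open>t^2/16 + 1\<close>, which the Gaussian absorbs; outside it
  \<open>1 \<le> (64 L^2 |t| h)^(R+1)\<close> turns a crude bound into the required power of
  \<open>h\<close>. Nonvanishing of \<open>b_j\<close> is tested at \<open>L = - 2\<close> because
  cancellations such as that of \<beta> in \<open>b_1\<close> obscure the behaviour at
  infinity.\<close>

lemma power_series_tail_bound:
  fixes c :: "nat \<Rightarrow> real" and x :: real
  assumes "(\<lambda>k. c k * x ^ k) sums s" "\<And>k. \<bar>c k\<bar> \<le> 1" "\<bar>x\<bar> \<le> 1 / 2"
  shows "\<bar>s - (\<Sum>k<m. c k * x ^ k)\<bar> \<le> 2 * \<bar>x\<bar> ^ m"
proof -
  have 1: "(\<lambda>k. c (k + m) * x ^ (k + m)) sums (s - (\<Sum>k<m. c k * x ^ k))"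
    using sums_split_initial_segment[OF assms(1)] .
  have 2: "(\<lambda>k. \<bar>x\<bar> ^ m * (1 / 2) ^ k) sums (\<bar>x\<bar> ^ m * (1 / (1 - 1 / 2)))"
    by (intro sums_mult geometric_sums) auto
  have 3: "norm (c (k + m) * x ^ (k + m)) \<le> \<bar>x\<bar> ^ m * (1 / 2) ^ k" for k
  proof -
    have "norm (c (k + m) * x ^ (k + m)) = \<bar>c (k + m)\<bar> * (\<bar>x\<bar> ^ m * \<bar>x\<bar> ^ k)"
      by (simp add: abs_mult power_abs power_add)
    also have "\<dots> \<le> 1 * (\<bar>x\<bar> ^ m * (1 / 2) ^ k)"
      using assms by (intro mult_mono power_mono) auto
    finally show ?thesis by simp
  qed
  have "norm (\<Sum>k. c (k + m) * x ^ (k + m)) \<le> (\<Sum>k. \<bar>x\<bar> ^ m * (1 / 2) ^ k)"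
    using norm_suminf_le[OF 3 sums_summable[OF 2]] .
  then show ?thesis using sums_unique[OF 1] sums_unique[OF 2] by simp
qed

text \<open>At \<open>k = 0\<close> the coefficient is \<open>- 1 / 0 = 0\<close>, so the logarithm
  series can be summed from 0 and fits the general tail bound.\<close>

lemma ln_1_plus_tail_bound:
  fixes x :: real
  assumes "\<bar>x\<bar> \<le> 1 / 2"
  shows "\<bar>ln (1 + x) - (\<Sum>k<m. (- ((- 1) ^ k) / real k) * x ^ k)\<bar> \<le> 2 * \<bar>x\<bar> ^ m"
proof (rule power_series_tail_bound)
  have "(\<lambda>k. - ((- x) ^ k) / real k) sums ln (1 + x)"
    using assms by (intro ln_series') auto
  then show "(\<lambda>k. - ((- 1) ^ k) / real k * x ^ k) sums ln (1 + x)"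
    by (simp add: power_minus[of x])
  show "\<bar>- ((- 1) ^ k) / real k\<bar> \<le> 1" for k
    by (cases k) (auto simp: abs_divide)
qed fact

lemma exp_tail_bound:
  fixes x :: real
  assumes "\<bar>x\<bar> \<le> 1 / 2"
  shows "\<bar>exp x - (\<Sum>k<m. 1 / fact k * x ^ k)\<bar> \<le> 2 * \<bar>x\<bar> ^ m"
proof (rule power_series_tail_bound)
  show "(\<lambda>k. 1 / fact k * x ^ k) sums exp x"
    using exp_converges[of x] by (simp add: scaleR_conv_of_real field_simps)
  show "\<bar>1 / fact k :: real\<bar> \<le> 1" for k
    by (simp add: fact_ge_1)
qed fact

text \<open>Consecutive coefficients have ratio \<open>(1/2 - k) / (k + 1)\<close>, of absolute
  value at most 1.\<close>

lemma abs_gbinomial_half_le: "\<bar>(1 / 2 :: real) gchoose k\<bar> \<le> 1"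
proof (induction k)
  case (Suc k)
  have "(1 / 2 :: real) gchoose Suc k = ((1 / 2) gchoose k) * ((1 / 2 - real k) / real (Suc k))"
    using gbinomial_mult_1[of "1/2 :: real" k] by (simp add: field_simps)
  moreover have "\<bar>(1 / 2 - real k) / real (Suc k)\<bar> \<le> 1"
    by (simp add: divide_simps abs_if)
  ultimately show ?case using Suc by (simp only: abs_mult mult_le_one abs_ge_zero)
qed simp

lemma sqrt_1_minus_tail_bound:
  fixes x :: real
  assumes "\<bar>x\<bar> \<le> 1 / 2"
  shows "\<bar>sqrt (1 - x) - (\<Sum>k<m. ((1 / 2) gchoose k) * (- x) ^ k)\<bar> \<le> 2 * \<bar>x\<bar> ^ m"
proof -
  have "\<bar>sqrt (1 - x) - (\<Sum>k<m. ((1 / 2) gchoose k) * (- x) ^ k)\<bar> \<le> 2 * \<bar>- x\<bar> ^ m"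
  proof (rule power_series_tail_bound[OF _ abs_gbinomial_half_le])
    have "(\<lambda>k. ((1 / 2) gchoose k) * (- x) ^ k) sums (1 + - x) powr (1 / 2)"
      using assms by (intro gen_binomial_real) auto
    then show "(\<lambda>k. ((1 / 2) gchoose k) * (- x) ^ k) sums sqrt (1 - x)"
      using assms by (simp add: powr_half_sqrt)
  qed (use assms in auto)
  then show ?thesis by simp
qed

text \<open>
  If \<open>e\<close> is the coefficient sequence of \<open>exp (\<Sum>k\<ge>1. z k * x ^ k)\<close>, then the derivative of
  \<open>x \<mapsto> (\<Sum>k\<le>R. e k * x ^ k) * exp (- (\<Sum>k=1..R. z k * x ^ k))\<close> has a zero of order \<open>R\<close> at 0.
\<close>
lemma exp_series_remainder:
  fixes z e :: "nat \<Rightarrow> real" and h B :: real and R :: nat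
  defines "Z \<equiv> \<lambda>x. \<Sum>k=1..R. z k * x ^ k"
  assumes e0: "e 0 = 1"
    and rec: "\<And>k. real (Suc k) * e (Suc k) = (\<Sum>i\<le>k. real (Suc i) * z (Suc i) * e (k - i))"
    and h: "0 \<le> h" "h \<le> 1"
    and B: "\<And>x. 0 \<le> x \<Longrightarrow> x \<le> h \<Longrightarrow> \<bar>Z x\<bar> \<le> B"
  shows "\<bar>(\<Sum>k\<le>R. e k * h ^ k) - exp (Z h)\<bar> \<le>
    h ^ Suc R * exp (2 * B) * (\<Sum>k\<le>R. \<Sum>i<R. \<bar>real (Suc i) * z (Suc i) * e k\<bar>)"
proof (cases "h = 0")
  case True
  have "(\<Sum>k\<le>R. e k * 0 ^ k) = e 0"
    by (subst sum.remove[of _ 0]) (auto intro!: sum.neutral)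
  moreover have "Z 0 = 0" by (auto simp: Z_def intro!: sum.neutral)
  ultimately show ?thesis using True e0 by simp
next
  case False
  define S where "S = (\<lambda>x. \<Sum>k\<le>R. e k * x ^ k)"
  define S' where "S' = (\<lambda>x. \<Sum>k<R. real (Suc k) * e (Suc k) * x ^ k)"
  define Z' where "Z' = (\<lambda>x. \<Sum>i<R. real (Suc i) * z (Suc i) * x ^ i)"
  define Q where "Q = (\<Sum>k\<le>R. \<Sum>i<R. \<bar>real (Suc i) * z (Suc i) * e k\<bar>)"
  have S_eq: "S x = e 0 + (\<Sum>k<R. e (Suc k) * x ^ Suc k)" for x
    unfolding S_def lessThan_Suc_atMost[symmetric] by (subst sum.lessThan_Suc_shift) simp
  have Z_eq: "Z x = (\<Sum>k<R. z (Suc k) * x ^ Suc k)" for x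
    unfolding Z_def by (rule sum.reindex_bij_witness[of _ Suc "\<lambda>k. k - 1"]) auto
  have dS: "(S has_real_derivative S' x) (at x)" for x
    unfolding S_eq[abs_def] S'_def
    by (auto intro!: derivative_eq_intros sum.cong simp del: power_Suc simp: algebra_simps)
  have dZ: "(Z has_real_derivative Z' x) (at x)" for x
    unfolding Z_eq[abs_def] Z'_def
    by (auto intro!: derivative_eq_intros sum.cong simp del: power_Suc simp: algebra_simps)
  \<comment> \<open>The recurrence says, coefficient by coefficient, that \<open>S'\<close> is the
    part of the product \<open>S * Z'\<close> of degree below \<open>R\<close>. What is left has
    degree at least \<open>R\<close>, so \<open>x ^ R\<close> can be pulled out because
    \<open>x \<le> 1\<close>.\<close>
  have D: "\<bar>S' x - S x * Z' x\<bar> \<le> x ^ R * Q" if x: "0 \<le> x" "x \<le> 1" for x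
  proof -
    let ?g = "\<lambda>(k, i). real (Suc i) * z (Suc i) * e k * x ^ (i + k)"
    let ?A = "{..R} \<times> {..<R}" and ?T = "{(k, i). k + i < R}"
    have sub: "?T \<subseteq> ?A" by auto
    have "S x * Z' x = sum ?g ?A"
      by (simp add: S_def Z'_def sum_product sum.cartesian_product power_add algebra_simps)
    also have "\<dots> = sum ?g (?A - ?T) + sum ?g ?T"
      by (rule sum.subset_diff[OF sub]) auto
    also have "sum ?g ?T = (\<Sum>(i, k)\<in>{(i, k). i + k < R}. real (Suc i) * z (Suc i) * e k * x ^ (i + k))"
      by (rule sum.reindex_bij_witness[of _ prod.swap prod.swap]) auto
    also have "\<dots> = (\<Sum>k<R. \<Sum>i\<le>k. real (Suc i) * z (Suc i) * e (k - i) * x ^ (i + (k - i)))"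
      by (rule sum.triangle_reindex)
    also have "\<dots> = S' x"
      unfolding S'_def rec sum_distrib_right by (intro sum.cong) auto
    finally have "\<bar>S' x - S x * Z' x\<bar> = \<bar>sum ?g (?A - ?T)\<bar>" by simp
    also have "\<dots> \<le> (\<Sum>(k, i)\<in>?A - ?T. \<bar>real (Suc i) * z (Suc i) * e k\<bar> * x ^ R)"
    proof (rule order_trans[OF sum_abs sum_mono], clarsimp)
      fix k i assume "i < R" "\<not> k + i < R"
      then have "x ^ (i + k) \<le> x ^ R" using x by (intro power_decreasing) auto
      then show "\<bar>(1 + real i) * z (Suc i) * e k * x ^ (i + k)\<bar>
          \<le> \<bar>(1 + real i) * z (Suc i) * e k\<bar> * x ^ R"
        using x by (simp add: abs_mult mult_left_mono)
    qed
    also have "\<dots> \<le> (\<Sum>(k, i)\<in>?A. \<bar>real (Suc i) * z (Suc i) * e k\<bar> * x ^ R)"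
      using x by (intro sum_mono2) auto
    also have "\<dots> = x ^ R * Q"
      unfolding Q_def sum.cartesian_product sum_distrib_left
      by (intro sum.cong) (auto simp: algebra_simps)
    finally show ?thesis .
  qed
  define g where "g = (\<lambda>x. S x * exp (- Z x))"
  have dg: "(g has_real_derivative (S' x - S x * Z' x) * exp (- Z x)) (at x)" for x
    unfolding g_def by (rule derivative_eq_intros dS dZ refl)+ (simp add: algebra_simps)
  have "0 < h" using h False by simp
  from MVT2[OF this dg] obtain \<xi> where xi: "0 < \<xi>" "\<xi> < h"
    and mvt: "g h - g 0 = (h - 0) * ((S' \<xi> - S \<xi> * Z' \<xi>) * exp (- Z \<xi>))" by blast
  have g0: "g 0 = 1" using e0 by (simp add: g_def S_eq Z_eq)
  have "Q \<ge> 0" unfolding Q_def by (intro sum_nonneg) auto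
  \<comment> \<open>Multiplying back by \<open>exp (Z h)\<close> leaves
    \<open>exp (Z h - Z \<xi>)\<close>; this is where the factor \<open>exp (2 * B)\<close> comes
    from.\<close>
  have "\<bar>S h - exp (Z h)\<bar> = \<bar>g h - g 0\<bar> * exp (Z h)"
  proof -
    have "S h - exp (Z h) = (g h - g 0) * exp (Z h)"
      unfolding g0 by (simp add: g_def left_diff_distrib mult.assoc flip: exp_add)
    then show ?thesis by (simp add: abs_mult)
  qed
  also have "\<dots> = h * \<bar>S' \<xi> - S \<xi> * Z' \<xi>\<bar> * exp (Z h - Z \<xi>)"
    unfolding mvt using \<open>0 < h\<close> by (simp add: abs_mult exp_diff exp_minus divide_inverse)
  also have "\<dots> \<le> h * (\<xi> ^ R * Q) * exp (2 * B)"
    using D[of \<xi>] xi h B[of h] B[of \<xi>] \<open>Q \<ge> 0\<close> by (intro mult_mono) auto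
  also have "\<dots> \<le> h * (h ^ R * Q) * exp (2 * B)"
    using xi h \<open>Q \<ge> 0\<close> by (intro mult_mono power_mono) auto
  finally show ?thesis by (simp add: S_def Q_def algebra_simps)
qed

section \<open>The coefficients of the expansion\<close>

text \<open>One predicate serves two ends: it places the coefficients in Q(L), and through
  \<open>rat_poly_fun_bound\<close> it yields the power bounds in \<open>L\<close>. As a property of
  functions it is closed under the arithmetic in which the coefficients are written, with no
  polynomial made explicit.\<close>

definition rat_poly_fun :: "(real \<Rightarrow> real) \<Rightarrow> bool" where
  "rat_poly_fun f \<longleftrightarrow> (\<exists>p :: rat poly. \<forall>x. f x = poly (map_poly of_rat p) x)"

lemma map_poly_of_rat_add: "map_poly of_rat (p + q) = map_poly of_rat p + (map_poly of_rat q :: real poly)"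
  by (rule poly_eqI) (simp add: coeff_map_poly of_rat_add)

lemma map_poly_of_rat_mult: "map_poly of_rat (p * q) = map_poly of_rat p * (map_poly of_rat q :: real poly)"
  by (rule poly_eqI) (simp add: coeff_map_poly coeff_mult of_rat_sum of_rat_mult)

lemma rat_poly_fun_of_rat: "rat_poly_fun (\<lambda>x. of_rat c)"
  unfolding rat_poly_fun_def by (rule exI[of _ "[:c:]"]) (simp add: map_poly_pCons)

lemma rat_poly_fun_ident: "rat_poly_fun (\<lambda>x. x)"
  unfolding rat_poly_fun_def by (rule exI[of _ "[:0, 1:]"]) (simp add: map_poly_pCons)

lemma rat_poly_fun_add:
  "rat_poly_fun f \<Longrightarrow> rat_poly_fun g \<Longrightarrow> rat_poly_fun (\<lambda>x. f x + g x)"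
  unfolding rat_poly_fun_def by (metis map_poly_of_rat_add poly_add)

lemma rat_poly_fun_mult:
  "rat_poly_fun f \<Longrightarrow> rat_poly_fun g \<Longrightarrow> rat_poly_fun (\<lambda>x. f x * g x)"
  unfolding rat_poly_fun_def by (metis map_poly_of_rat_mult poly_mult)

lemma rat_poly_fun_const: "c \<in> \<rat> \<Longrightarrow> rat_poly_fun (\<lambda>x. c)"
  using rat_poly_fun_of_rat by (auto elim: Rats_cases)

lemma rat_poly_fun_minus: "rat_poly_fun f \<Longrightarrow> rat_poly_fun (\<lambda>x. - f x)"
  using rat_poly_fun_mult[OF rat_poly_fun_const[of "- 1"]] by simp

lemma rat_poly_fun_power: "rat_poly_fun f \<Longrightarrow> rat_poly_fun (\<lambda>x. f x ^ k)"
  by (induction k) (auto intro: rat_poly_fun_mult rat_poly_fun_const)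

lemma rat_poly_fun_sum:
  "(\<And>i. i \<in> A \<Longrightarrow> rat_poly_fun (f i)) \<Longrightarrow> rat_poly_fun (\<lambda>x. \<Sum>i\<in>A. f i x)"
  by (induction A rule: infinite_finite_induct) (auto intro: rat_poly_fun_add rat_poly_fun_const)

lemmas rat_poly_fun_intros =
  rat_poly_fun_ident rat_poly_fun_add rat_poly_fun_mult rat_poly_fun_const
  rat_poly_fun_minus rat_poly_fun_power rat_poly_fun_sum

lemma rat_poly_fun_bound:
  assumes "rat_poly_fun f"
  shows "\<exists>C A. C \<ge> 0 \<and> (\<forall>x\<ge>1. \<bar>f x\<bar> \<le> C * x ^ A)"
proof -
  from assms obtain p :: "rat poly" where p: "\<And>x. f x = poly (map_poly of_rat p) x"
    by (auto simp: rat_poly_fun_def)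
  let ?q = "map_poly of_rat p :: real poly"
  have "\<bar>f x\<bar> \<le> (\<Sum>i\<le>degree ?q. \<bar>coeff ?q i\<bar>) * x ^ degree ?q" if "x \<ge> 1" for x
    unfolding p poly_altdef sum_distrib_right
  proof (rule order_trans[OF sum_abs sum_mono])
    fix i assume "i \<in> {..degree ?q}"
    then show "\<bar>coeff ?q i * x ^ i\<bar> \<le> \<bar>coeff ?q i\<bar> * x ^ degree ?q"
      using that by (simp add: abs_mult mult_left_mono power_increasing)
  qed
  moreover have "(\<Sum>i\<le>degree ?q. \<bar>coeff ?q i\<bar>) \<ge> 0" by (intro sum_nonneg) auto
  ultimately show ?thesis by blast
qed

text \<open>
  With \<open>\<tau> = h t\<close> the logarithm of the integrand is \<open>n (ln (1 + \<tau>) - (2/L) (exp (L \<tau>/2) - 1))\<close> plus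
  \<open>\<beta> (exp (L \<tau>/2) - 1) + (1 - \<beta>) L \<tau>/2\<close>. The Taylor coefficients in \<open>\<tau>\<close> of the factor of \<open>n\<close> and
  of the second summand are \<open>phase_coeff\<close> and \<open>drift_coeff\<close>. As \<open>n = 1/h\<^sup>2\<close>, the phase is shifted by
  two powers of \<open>h\<close>, and its quadratic term is the Gaussian that is left out of \<open>exponent_poly\<close>.
\<close>

definition phase_coeff :: "real \<Rightarrow> nat \<Rightarrow> real" where
  "phase_coeff L k = - ((- 1) ^ k) / real k - (L / 2) ^ (k - 1) / fact k"

text \<open>At \<open>k = 1\<close> the contributions \<open>\<beta> * L / 2\<close> and
  \<open>(1 - \<beta>) * L / 2\<close> add up to \<open>L / 2\<close>, which removes \<beta> from
  the linear term.\<close>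

definition drift_coeff :: "real \<Rightarrow> real \<Rightarrow> nat \<Rightarrow> real" where
  "drift_coeff \<beta> L k = (if k = 1 then L / 2 else \<beta> * (L / 2) ^ k / fact k)"

definition exponent_poly :: "real \<Rightarrow> real \<Rightarrow> nat \<Rightarrow> real poly" where
  "exponent_poly \<beta> L k = monom (phase_coeff L (k + 2)) (k + 2) + monom (drift_coeff \<beta> L k) k"

text \<open>Coefficients in \<open>h\<close> of the exponential of the power series with
  coefficients \<open>exponent_poly\<close>, read off from \<open>E' = Z' * E\<close>. Up to
  factorials these are complete Bell polynomials.\<close>

fun exp_poly :: "real \<Rightarrow> real \<Rightarrow> nat \<Rightarrow> real poly" where
  "exp_poly \<beta> L 0 = 1"
| "exp_poly \<beta> L (Suc k) = smult (1 / real (Suc k))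
     (\<Sum>i\<le>k. smult (real (Suc i)) (exponent_poly \<beta> L (Suc i) * exp_poly \<beta> L (k - i)))"

lemma poly_exp_poly_Suc:
  "real (Suc k) * poly (exp_poly \<beta> L (Suc k)) t =
     (\<Sum>i\<le>k. real (Suc i) * poly (exponent_poly \<beta> L (Suc i)) t * poly (exp_poly \<beta> L (k - i)) t)"
  by (simp add: poly_sum mult.assoc del: of_nat_Suc)

text \<open>A step of \<open>i + 1\<close> in the order \<open>k\<close> is accompanied by
  \<open>i + 3\<close> or \<open>i + 1\<close> powers of \<open>t\<close>. Degree, parity, top
  coefficient and rationality all follow from this bookkeeping by induction.\<close>

lemma coeff_exp_poly_Suc:
  "coeff (exp_poly \<beta> L (Suc k)) m = 1 / real (Suc k) * (\<Sum>i\<le>k. real (Suc i) *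
     ((if i + 3 \<le> m then phase_coeff L (i + 3) * coeff (exp_poly \<beta> L (k - i)) (m - (i + 3)) else 0) +
      (if Suc i \<le> m then drift_coeff \<beta> L (Suc i) * coeff (exp_poly \<beta> L (k - i)) (m - Suc i) else 0)))"
proof -
  have "coeff (exponent_poly \<beta> L (Suc i) * p) m =
     (if i + 3 \<le> m then phase_coeff L (i + 3) * coeff p (m - (i + 3)) else 0) +
     (if Suc i \<le> m then drift_coeff \<beta> L (Suc i) * coeff p (m - Suc i) else 0)" for i p
    by (simp add: exponent_poly_def distrib_right coeff_monom_mult numeral_3_eq_3)
  then show ?thesis by (simp add: coeff_sum del: of_nat_Suc)
qed

text \<open>Because \<open>i + 3 \<le> 3 * (i + 1)\<close>, each unit of \<open>k\<close> brings at
  most three powers of \<open>t\<close>.\<close>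

lemma coeff_exp_poly_eq_0: "m > 3 * k \<Longrightarrow> coeff (exp_poly \<beta> L k) m = 0"
proof (induction k arbitrary: m rule: less_induct)
  case (less k)
  show ?case
  proof (cases k)
    case (Suc j)
    show ?thesis unfolding Suc coeff_exp_poly_Suc
      using less Suc by (auto intro!: sum.neutral)
  qed (use less in auto)
qed

text \<open>Both \<open>i + 3\<close> and \<open>i + 1\<close> have the parity of the step
  \<open>i + 1\<close>. This is what makes the odd powers of \<open>h\<close> disappear after
  integration.\<close>

lemma coeff_exp_poly_parity: "odd (k + m) \<Longrightarrow> coeff (exp_poly \<beta> L k) m = 0"
proof (induction k arbitrary: m rule: less_induct)
  case (less k)
  show ?case
  proof (cases k)
    case 0
    then show ?thesis using less by (cases m) auto
  next
    case (Suc j)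
    have "coeff (exp_poly \<beta> L (j - i)) (m - (i + 3)) = 0" if "i \<le> j" "i + 3 \<le> m" for i
      using that less(2) Suc by (intro less(1)) auto
    moreover have "coeff (exp_poly \<beta> L (j - i)) (m - Suc i) = 0" if "i \<le> j" "Suc i \<le> m" for i
      using that less(2) Suc by (intro less(1)) auto
    ultimately show ?thesis unfolding Suc coeff_exp_poly_Suc
      by (auto intro!: sum.neutral)
  qed
qed

text \<open>Equality in \<open>i + 3 \<le> 3 * (i + 1)\<close> holds only for \<open>i = 0\<close>,
  so at the top degree the recurrence involves nothing but the cubic coefficient of the phase and
  becomes that of \<open>exp (phase_coeff L 3 * x)\<close>.\<close>

lemma coeff_exp_poly_top: "coeff (exp_poly \<beta> L k) (3 * k) = phase_coeff L 3 ^ k / fact k"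
proof (induction k)
  case (Suc k)
  have z: "coeff (exp_poly \<beta> L (k - i)) (3 * Suc k - (i + 3)) = 0"
    "coeff (exp_poly \<beta> L (k - i)) (3 * Suc k - Suc i) = 0" if "i \<le> k" "i \<noteq> 0" for i
    using that by (intro coeff_exp_poly_eq_0; simp)+
  have z0: "coeff (exp_poly \<beta> L k) (3 * Suc k - Suc 0) = 0"
    by (intro coeff_exp_poly_eq_0) simp
  have "coeff (exp_poly \<beta> L (Suc k)) (3 * Suc k) = 1 / real (Suc k) *
      (\<Sum>i\<le>k. if i = 0 then phase_coeff L 3 * coeff (exp_poly \<beta> L k) (3 * k) else 0)"
    unfolding coeff_exp_poly_Suc
    by (intro arg_cong2[of _ _ _ _ "(*)"] refl sum.cong) (use z z0 in auto)
  then show ?case by (simp add: Suc del: exp_poly.simps)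
qed simp

lemma fact_in_Rats: "fact k \<in> \<rat>"
  by (metis Rats_of_nat of_nat_fact)

lemma rat_poly_fun_phase_coeff: "rat_poly_fun (\<lambda>L. phase_coeff L k)"
proof -
  have "rat_poly_fun (\<lambda>L. - ((- 1) ^ k) / real k + - ((1 / fact k) * (1 / 2 * L) ^ (k - 1)))"
    by (intro rat_poly_fun_intros) (auto simp: fact_in_Rats)
  then show ?thesis by (simp add: phase_coeff_def)
qed

lemma rat_poly_fun_drift_coeff: "\<beta> \<in> \<rat> \<Longrightarrow> rat_poly_fun (\<lambda>L. drift_coeff \<beta> L k)"
proof -
  assume "\<beta> \<in> \<rat>"
  then have "rat_poly_fun (\<lambda>L. 1 / 2 * L)" "rat_poly_fun (\<lambda>L. \<beta> / fact k * (1 / 2 * L) ^ k)"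
    by (intro rat_poly_fun_intros; simp add: fact_in_Rats)+
  then show ?thesis by (cases "k = 1") (simp_all add: drift_coeff_def)
qed

lemma rat_poly_fun_coeff_exp_poly:
  assumes "\<beta> \<in> \<rat>"
  shows "rat_poly_fun (\<lambda>L. coeff (exp_poly \<beta> L k) m)"
proof (induction k arbitrary: m rule: less_induct)
  case (less k)
  show ?case
  proof (cases k)
    case (Suc j)
    have "rat_poly_fun (\<lambda>L. if i + 3 \<le> m then phase_coeff L (i + 3) *
        coeff (exp_poly \<beta> L (j - i)) (m - (i + 3)) else 0)" for i
      using less[of "j - i"] Suc
      by (cases "i + 3 \<le> m") (auto intro!: rat_poly_fun_intros rat_poly_fun_phase_coeff)
    moreover have "rat_poly_fun (\<lambda>L. if Suc i \<le> m then drift_coeff \<beta> L (Suc i) *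
        coeff (exp_poly \<beta> L (j - i)) (m - Suc i) else 0)" for i
      using less[of "j - i"] Suc assms
      by (cases "Suc i \<le> m") (auto intro!: rat_poly_fun_intros rat_poly_fun_drift_coeff)
    ultimately show ?thesis unfolding Suc coeff_exp_poly_Suc
      by (intro rat_poly_fun_intros) auto
  qed (auto intro: rat_poly_fun_const)
qed

text \<open>The factorials over \<open>(1 + L / 2) ^ m\<close> are the moment of order
  \<open>2 * m\<close> of a centred Gaussian of variance \<open>1 / (1 + L / 2)\<close>. As
  \<open>exp_poly \<beta> L (2 * j)\<close> has degree at most \<open>6 * j\<close>, the sum stops
  at \<open>m = 3 * j\<close>.\<close>

definition laplace_coeff :: "real \<Rightarrow> nat \<Rightarrow> real \<Rightarrow> real" where
  "laplace_coeff \<beta> j L = (\<Sum>m\<le>3 * j. coeff (exp_poly \<beta> L (2 * j)) (2 * m) *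
     (fact (2 * m) / (2 ^ m * fact m)) / (1 + L / 2) ^ m)"

text \<open>
  The square root in the main term is that of \<open>4 n (1 + L/2)\<close> times
  \<open>1 - \<beta> L\<^sup>2 / (4 (1 + L/2) n)\<close>; the binomial series of the second factor gives \<open>sqrt_coeff\<close>.
\<close>

definition sqrt_coeff :: "real \<Rightarrow> nat \<Rightarrow> real \<Rightarrow> real" where
  "sqrt_coeff \<beta> j L = ((1 / 2) gchoose j) * (- (\<beta> * L\<^sup>2 / (4 * (1 + L / 2)))) ^ j"

definition expansion_coeff :: "real \<Rightarrow> nat \<Rightarrow> real \<Rightarrow> real" where
  "expansion_coeff \<beta> j L = (\<Sum>i\<le>j. sqrt_coeff \<beta> i L * laplace_coeff \<beta> (j - i) L)"

text \<open>The numerator over the common denominator \<open>(1 + L / 2) ^ (3 * j)\<close>: a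
  summand of the coefficient has a pole of order at most \<open>m + i \<le> 3 * j\<close> at
  \<open>L = - 2\<close>, so the subtraction in the exponent is never truncated.\<close>

definition expansion_num :: "real \<Rightarrow> nat \<Rightarrow> real \<Rightarrow> real" where
  "expansion_num \<beta> j L = (\<Sum>i\<le>j. \<Sum>m\<le>3 * (j - i). ((1 / 2) gchoose i) * (- (\<beta> * L\<^sup>2 / 4)) ^ i *
     (coeff (exp_poly \<beta> L (2 * (j - i))) (2 * m) * (fact (2 * m) / (2 ^ m * fact m))) *
     (1 + L / 2) ^ (3 * j - (m + i)))"

lemma expansion_coeff_eq:
  assumes "L \<noteq> - 2"
  shows "expansion_coeff \<beta> j L = expansion_num \<beta> j L / (1 + L / 2) ^ (3 * j)"
proof -
  define a where "a = 1 + L / 2"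
  have a: "a \<noteq> 0" using assms by (auto simp: a_def)
  have pw: "a ^ (3 * j - (m + i)) / a ^ (3 * j) = 1 / (a ^ m * a ^ i)" if "i \<le> j" "m \<le> 3 * (j - i)" for i m
  proof -
    have "a ^ (3 * j) = a ^ (3 * j - (m + i)) * a ^ (m + i)"
      unfolding power_add[symmetric] using that by simp
    then show ?thesis using a by (simp add: power_add)
  qed
  show ?thesis
    unfolding expansion_coeff_def expansion_num_def sum_divide_distrib a_def[symmetric]
      sqrt_coeff_def laplace_coeff_def sum_distrib_left
  proof (intro sum.cong refl)
    fix i m assume "i \<in> {..j}" "m \<in> {..3 * (j - i)}"
    then have im: "i \<le> j" "m \<le> 3 * (j - i)" by auto
    let ?u = "(1 / 2) gchoose i :: real" and ?v = "coeff (exp_poly \<beta> L (2 * (j - i))) (2 * m)"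
      and ?w = "fact (2 * m) / (2 ^ m * fact m) :: real"
    have "(- (\<beta> * L\<^sup>2 / (4 * a))) ^ i = (- (\<beta> * L\<^sup>2 / 4)) ^ i / a ^ i"
      by (simp flip: power_divide)
    then have "?u * (- (\<beta> * L\<^sup>2 / (4 * a))) ^ i * (?v * ?w / a ^ m) =
        ?u * (- (\<beta> * L\<^sup>2 / 4)) ^ i * (?v * ?w) * (1 / (a ^ m * a ^ i))"
      by (simp add: ac_simps)
    then show "?u * (- (\<beta> * L\<^sup>2 / (4 * a))) ^ i * (?v * ?w / a ^ m) =
        ?u * (- (\<beta> * L\<^sup>2 / 4)) ^ i * (?v * ?w) * a ^ (3 * j - (m + i)) / a ^ (3 * j)"
      by (simp add: pw[OF im, symmetric])
  qed
qed

lemma gbinomial_in_Rats: "(a :: real) \<in> \<rat> \<Longrightarrow> a gchoose k \<in> \<rat>"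
proof (induction k)
  case (Suc k)
  have "a gchoose Suc k = (a gchoose k) * (a - real k) / real (Suc k)"
    using gbinomial_mult_1[of a k] by (simp add: field_simps)
  with Suc show ?case by simp
qed simp

lemma rat_poly_fun_expansion_num:
  assumes "\<beta> \<in> \<rat>"
  shows "rat_poly_fun (expansion_num \<beta> j)"
proof -
  have 1: "rat_poly_fun (\<lambda>L. - (\<beta> * L\<^sup>2 / 4))" "rat_poly_fun (\<lambda>L. 1 + L / 2)"
    using rat_poly_fun_minus[OF rat_poly_fun_mult[OF rat_poly_fun_const[of "\<beta> / 4"]
        rat_poly_fun_power[OF rat_poly_fun_ident, of 2]]]
      rat_poly_fun_add[OF rat_poly_fun_const[of 1] rat_poly_fun_mult[OF rat_poly_fun_const[of "1 / 2"]
        rat_poly_fun_ident]] assms by simp_all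
  show ?thesis unfolding expansion_num_def[abs_def]
    using assms
    by (intro rat_poly_fun_sum rat_poly_fun_mult rat_poly_fun_power 1 rat_poly_fun_coeff_exp_poly
        rat_poly_fun_const gbinomial_in_Rats Rats_mult Rats_divide Rats_power fact_in_Rats) auto
qed

text \<open>The pole of order \<open>3 j\<close> at \<open>L = - 2\<close> comes from the cubic term of the phase alone.\<close>
lemma expansion_num_nonzero: "expansion_num \<beta> j (- 2) \<noteq> 0"
proof -
  let ?c = "\<lambda>i m. coeff (exp_poly \<beta> (- 2) (2 * (j - i))) (2 * m) * (fact (2 * m) / (2 ^ m * fact m))"
  \<comment> \<open>Here \<open>1 + L / 2\<close> is 0, so a summand survives only if its exponent
    \<open>3 * j - (m + i)\<close> is 0, which forces \<open>i = 0\<close> and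
    \<open>m = 3 * j\<close>.\<close>
  have "expansion_num \<beta> j (- 2) = (\<Sum>i\<le>j. \<Sum>m\<le>3 * (j - i).
      if i = 0 \<and> m = 3 * j then ?c 0 (3 * j) else 0)"
    unfolding expansion_num_def by (intro sum.cong refl) (auto simp: power_0_left)
  also have "\<dots> = (\<Sum>i\<le>j. if i = 0 then ?c 0 (3 * j) else 0)"
    by (intro sum.cong refl) (auto simp: sum.delta)
  also have "\<dots> = ?c 0 (3 * j)" by simp
  also have "\<dots> = phase_coeff (- 2) 3 ^ (2 * j) / fact (2 * j) * (fact (6 * j) / (2 ^ (3 * j) * fact (3 * j)))"
    using coeff_exp_poly_top[of \<beta> "- 2" "2 * j"] by simp
  \<comment> \<open>The value of \<open>phase_coeff (- 2) 3\<close> is \<open>1 / 6\<close>.\<close>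
  also have "\<dots> \<noteq> 0" by (simp add: phase_coeff_def fact_numeral)
  finally show ?thesis .
qed

lemma expansion_coeff_0: "expansion_coeff \<beta> 0 L = 1"
  by (simp add: expansion_coeff_def sqrt_coeff_def laplace_coeff_def)

text \<open>The term \<open>\<beta> * L ^ 2 / 8\<close> in the second-order exponential coefficient
  is cancelled by \<open>sqrt_coeff \<beta> 1\<close>, so the first coefficient is the same for even
  and odd characters.\<close>

lemma expansion_coeff_1:
  assumes "L > 0"
  shows "expansion_coeff \<beta> 1 L =
    (L ^ 4 + 9 * L ^ 3 + 32 * L ^ 2 + 24 * L + 16) / (24 * (L + 2) ^ 3)"
proof -
  have E1: "exp_poly \<beta> L 1 = exponent_poly \<beta> L 1" by simp
  have E2: "exp_poly \<beta> L 2 =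
      smult (1 / 2) (exponent_poly \<beta> L 1 * exponent_poly \<beta> L 1) + exponent_poly \<beta> L 2"
    by (simp add: numeral_2_eq_2 smult_add_right)
  have x: "exponent_poly \<beta> L 1 = monom (phase_coeff L 3) 3 + monom (L / 2) 1"
      "exponent_poly \<beta> L 2 = monom (phase_coeff L 4) 4 + monom (\<beta> * L ^ 2 / 8) 2"
    by (simp_all add: exponent_poly_def drift_coeff_def power_divide fact_numeral eval_nat_numeral)
  have "exp_poly \<beta> L 2 = monom (phase_coeff L 3 ^ 2 / 2) 6 +
      monom (phase_coeff L 4 + phase_coeff L 3 * L / 2) 4 + monom (L ^ 2 / 8 + \<beta> * L ^ 2 / 8) 2"
    unfolding E2 x
    by (rule poly_eqI) (auto simp: distrib_left distrib_right mult_monom power2_eq_square)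
  then have c: "coeff (exp_poly \<beta> L 2) 2 = L ^ 2 / 8 + \<beta> * L ^ 2 / 8"
      "coeff (exp_poly \<beta> L 2) 4 = phase_coeff L 4 + phase_coeff L 3 * L / 2"
      "coeff (exp_poly \<beta> L 2) 6 = phase_coeff L 3 ^ 2 / 2" "coeff (exp_poly \<beta> L 2) 0 = 0"
    by simp_all
  have lc0: "laplace_coeff \<beta> 0 L = 1" by (simp add: laplace_coeff_def)
  have "laplace_coeff \<beta> 1 L = (\<Sum>m\<in>{0, 1, 2, 3}. coeff (exp_poly \<beta> L 2) (2 * m) *
     (fact (2 * m) / (2 ^ m * fact m)) / (1 + L / 2) ^ m)"
    unfolding laplace_coeff_def by (rule sum.cong) auto
  also have "\<dots> = (L ^ 2 / 8 + \<beta> * L ^ 2 / 8) / (1 + L / 2)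
     + (phase_coeff L 4 + phase_coeff L 3 * L / 2) * 3 / (1 + L / 2) ^ 2
     + phase_coeff L 3 ^ 2 / 2 * 15 / (1 + L / 2) ^ 3"
  proof -
    define a where "a = 1 + L / 2"
    show ?thesis unfolding a_def[symmetric]
      by (simp add: c fact_numeral) (simp add: add_divide_distrib mult_ac)
  qed
  finally have lc1: "laplace_coeff \<beta> 1 L = \<dots>" .
  have sc: "sqrt_coeff \<beta> 0 L = 1" "sqrt_coeff \<beta> 1 L = - \<beta> * L ^ 2 / (8 * (1 + L / 2))"
    by (simp_all add: sqrt_coeff_def)
  have e: "expansion_coeff \<beta> 1 L = (L ^ 2 / 8 + \<beta> * L ^ 2 / 8) / (1 + L / 2)
     + (phase_coeff L 4 + phase_coeff L 3 * L / 2) * 3 / (1 + L / 2) ^ 2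
     + phase_coeff L 3 ^ 2 / 2 * 15 / (1 + L / 2) ^ 3 - \<beta> * L ^ 2 / (8 * (1 + L / 2))"
    using lc0 lc1 sc by (simp add: expansion_coeff_def)
  have p: "phase_coeff L 3 = 1 / 3 - L ^ 2 / 24" "phase_coeff L 4 = - 1 / 4 - L ^ 3 / 192"
    by (simp_all add: phase_coeff_def fact_numeral power_divide)
  have "1 + L / 2 = (L + 2) / 2" by simp
  then show ?thesis unfolding e p using assms
    by (simp add: divide_simps) algebra
qed

section \<open>Uniform approximation of the integrand\<close>

text \<open>A single exponent for both variables loses nothing, since \<open>L\<close> and
  \<open>1 + |t|\<close> are at least 1. As the constants depend on neither \<open>L\<close> nor
  \<open>t\<close>, such a bound stays usable when \<open>L\<close> moves with \<open>n\<close> and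
  after integration in \<open>t\<close>.\<close>

definition poly_bounded :: "(real \<Rightarrow> real \<Rightarrow> real) \<Rightarrow> bool" where
  "poly_bounded f \<longleftrightarrow> (\<exists>C A. C \<ge> 0 \<and> (\<forall>L\<ge>1. \<forall>t. \<bar>f L t\<bar> \<le> C * L ^ A * (1 + \<bar>t\<bar>) ^ A))"

lemma poly_boundedI:
  "C \<ge> 0 \<Longrightarrow> (\<And>L t. L \<ge> 1 \<Longrightarrow> \<bar>f L t\<bar> \<le> C * L ^ A * (1 + \<bar>t\<bar>) ^ A) \<Longrightarrow> poly_bounded f"
  unfolding poly_bounded_def by blast

lemma poly_bounded_add:
  assumes "poly_bounded f" "poly_bounded g"
  shows "poly_bounded (\<lambda>L t. f L t + g L t)"
proof -
  from assms obtain C A D B where *: "C \<ge> 0" "D \<ge> 0"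
    "\<And>L t. L \<ge> 1 \<Longrightarrow> \<bar>f L t\<bar> \<le> C * L ^ A * (1 + \<bar>t\<bar>) ^ A"
    "\<And>L t. L \<ge> 1 \<Longrightarrow> \<bar>g L t\<bar> \<le> D * L ^ B * (1 + \<bar>t\<bar>) ^ B"
    unfolding poly_bounded_def by metis
  show ?thesis
  proof (rule poly_boundedI[of "C + D" _ "max A B"])
    fix L t :: real assume L: "L \<ge> 1"
    have "\<bar>f L t + g L t\<bar> \<le> C * L ^ A * (1 + \<bar>t\<bar>) ^ A + D * L ^ B * (1 + \<bar>t\<bar>) ^ B"
      using *(3)[OF L, of t] *(4)[OF L, of t] by linarith
    also have "\<dots> \<le> C * L ^ max A B * (1 + \<bar>t\<bar>) ^ max A B + D * L ^ max A B * (1 + \<bar>t\<bar>) ^ max A B"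
      using L *(1,2) by (intro add_mono mult_mono power_increasing) auto
    finally show "\<bar>f L t + g L t\<bar> \<le> (C + D) * L ^ max A B * (1 + \<bar>t\<bar>) ^ max A B"
      by (simp add: algebra_simps)
  qed (use * in auto)
qed

lemma poly_bounded_mult:
  assumes "poly_bounded f" "poly_bounded g"
  shows "poly_bounded (\<lambda>L t. f L t * g L t)"
proof -
  from assms obtain C A D B where *: "C \<ge> 0" "D \<ge> 0"
    "\<And>L t. L \<ge> 1 \<Longrightarrow> \<bar>f L t\<bar> \<le> C * L ^ A * (1 + \<bar>t\<bar>) ^ A"
    "\<And>L t. L \<ge> 1 \<Longrightarrow> \<bar>g L t\<bar> \<le> D * L ^ B * (1 + \<bar>t\<bar>) ^ B"
    unfolding poly_bounded_def by metis
  show ?thesis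
  proof (rule poly_boundedI[of "C * D" _ "A + B"])
    fix L t :: real assume L: "L \<ge> 1"
    have "\<bar>f L t * g L t\<bar> \<le> (C * L ^ A * (1 + \<bar>t\<bar>) ^ A) * (D * L ^ B * (1 + \<bar>t\<bar>) ^ B)"
      unfolding abs_mult using *(3)[OF L, of t] *(4)[OF L, of t] by (intro mult_mono) auto
    then show "\<bar>f L t * g L t\<bar> \<le> C * D * L ^ (A + B) * (1 + \<bar>t\<bar>) ^ (A + B)"
      by (simp add: power_add mult_ac)
  qed (use * in auto)
qed

lemma poly_bounded_const: "poly_bounded (\<lambda>L t. c)"
  by (rule poly_boundedI[of "\<bar>c\<bar>" _ 0]) auto

lemma poly_bounded_rat_poly_fun: "rat_poly_fun f \<Longrightarrow> poly_bounded (\<lambda>L t. f L)"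
proof -
  assume "rat_poly_fun f"
  then obtain C A where *: "C \<ge> 0" "\<And>x. x \<ge> 1 \<Longrightarrow> \<bar>f x\<bar> \<le> C * x ^ A"
    using rat_poly_fun_bound by blast
  show ?thesis
  proof (rule poly_boundedI[of C _ A])
    fix L t :: real assume L: "L \<ge> 1"
    have "C * L ^ A * 1 \<le> C * L ^ A * (1 + \<bar>t\<bar>) ^ A"
      using * L by (intro mult_left_mono) auto
    then show "\<bar>f L\<bar> \<le> C * L ^ A * (1 + \<bar>t\<bar>) ^ A" using *(2)[OF L] by linarith
  qed fact
qed

lemma poly_bounded_fst: "poly_bounded (\<lambda>L t. L)"
  by (rule poly_bounded_rat_poly_fun[OF rat_poly_fun_ident])

lemma poly_bounded_snd: "poly_bounded (\<lambda>L t. t)"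
proof (rule poly_boundedI[of 1 _ 1])
  fix L t :: real assume L: "L \<ge> 1"
  have "1 * (1 + \<bar>t\<bar>) \<le> L * (1 + \<bar>t\<bar>)" using L by (intro mult_right_mono) auto
  then show "\<bar>t\<bar> \<le> 1 * L ^ 1 * (1 + \<bar>t\<bar>) ^ 1" by simp
qed simp

lemma poly_bounded_abs: "poly_bounded f \<Longrightarrow> poly_bounded (\<lambda>L t. \<bar>f L t\<bar>)"
  by (simp add: poly_bounded_def)

lemma poly_bounded_power: "poly_bounded f \<Longrightarrow> poly_bounded (\<lambda>L t. f L t ^ k)"
  by (induction k) (auto intro: poly_bounded_mult poly_bounded_const)

lemma poly_bounded_sum:
  "(\<And>i. i \<in> A \<Longrightarrow> poly_bounded (f i)) \<Longrightarrow> poly_bounded (\<lambda>L t. \<Sum>i\<in>A. f i L t)"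
  by (induction A rule: infinite_finite_induct) (auto intro: poly_bounded_add poly_bounded_const)

lemmas poly_bounded_intros =
  poly_bounded_fst poly_bounded_snd poly_bounded_add poly_bounded_mult poly_bounded_const
  poly_bounded_abs poly_bounded_power poly_bounded_sum

lemma poly_bounded_exponent_poly:
  "\<beta> \<in> \<rat> \<Longrightarrow> poly_bounded (\<lambda>L t. poly (exponent_poly \<beta> L k) t)"
  unfolding exponent_poly_def poly_add poly_monom
  by (intro poly_bounded_intros poly_bounded_rat_poly_fun[OF rat_poly_fun_phase_coeff]
      poly_bounded_rat_poly_fun[OF rat_poly_fun_drift_coeff])

text \<open>The degree of \<open>exp_poly \<beta> L k\<close> can depend on \<open>L\<close> (the
  cubic phase coefficient vanishes at \<open>L ^ 2 = 8\<close>), whereas the range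
  \<open>3 * k\<close> is fixed, as uniform bounds require.\<close>

lemma poly_exp_poly_eq:
  "poly (exp_poly \<beta> L k) t = (\<Sum>m\<le>3 * k. coeff (exp_poly \<beta> L k) m * t ^ m)"
  unfolding poly_altdef
  by (rule sum.mono_neutral_left) (auto intro: degree_le simp: coeff_exp_poly_eq_0 coeff_eq_0)

lemma poly_bounded_exp_poly:
  "\<beta> \<in> \<rat> \<Longrightarrow> poly_bounded (\<lambda>L t. poly (exp_poly \<beta> L k) t)"
  unfolding poly_exp_poly_eq
  by (intro poly_bounded_intros poly_bounded_rat_poly_fun[OF rat_poly_fun_coeff_exp_poly])

text \<open>Normalised to the value 1 at the saddle point \<open>t = 0\<close>; \<open>\<tau> < - 1\<close> corresponds to \<open>y < 1/N\<close>.\<close>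

definition saddle_kernel :: "real \<Rightarrow> real \<Rightarrow> nat \<Rightarrow> real \<Rightarrow> real" where
  "saddle_kernel \<beta> L n t = (let \<tau> = t / sqrt (real n) in if \<tau> < - 1 then 0 else
     (1 + \<tau>) ^ n * exp (- (2 * real n / L - \<beta>) * (exp (L * \<tau> / 2) - 1) + (1 - \<beta>) * L * \<tau> / 2))"

text \<open>The difference of the two sides has derivative \<open>x^2 / (1 + x)\<close>. This
  supplies the quadratic decay left of the saddle point, where the exponential factor is estimated
  by its tangent line only.\<close>

lemma ln_1_plus_le_neg:
  fixes x :: real
  assumes "- 1 < x" "x \<le> 0"
  shows "ln (1 + x) \<le> x - x\<^sup>2 / 2"
proof -
  define f where "f = (\<lambda>x :: real. ln (1 + x) - x + x\<^sup>2 / 2)"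
  have "f x \<le> f 0"
  proof (rule DERIV_nonneg_imp_nondecreasing[OF assms(2)])
    fix y assume y: "x \<le> y" "y \<le> 0"
    have "(f has_real_derivative (1 / (1 + y) - 1 + y)) (at y)"
      unfolding f_def using y assms by (auto intro!: derivative_eq_intros)
    moreover have "1 / (1 + y) - 1 + y = y\<^sup>2 / (1 + y)"
      using y assms by (simp add: field_simps power2_eq_square)
    ultimately show "\<exists>d. (f has_real_derivative d) (at y) \<and> 0 \<le> d"
      using y assms by auto
  qed
  then show ?thesis by (simp add: f_def)
qed

lemma exp_ge_quadratic: "x \<ge> 0 \<Longrightarrow> exp x \<ge> 1 + x + x\<^sup>2 / (2 :: real)"
  using exp_lower_Taylor_quadratic[of x] by simp

text \<open>Right of the saddle the decay comes from the quadratic term of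
  \<open>exp (L * \<tau> / 2)\<close>, left of it from that of the logarithm; the linear terms
  cancel up to the drift \<open>L * \<tau> / 2\<close>. For \<open>\<tau> > 0\<close> the drift is
  at most \<open>1 + n * \<tau>^2 / 16\<close>, by \<open>n \<ge> 8 * L^2\<close>, which uses up
  half of the available \<open>n * \<tau>^2 / 8\<close>.\<close>

lemma saddle_kernel_bounds:
  assumes L: "L \<ge> 2" and n: "real n \<ge> 8 * L\<^sup>2" and \<beta>: "0 \<le> \<beta>" "\<beta> \<le> 1"
  shows "0 \<le> saddle_kernel \<beta> L n t" "saddle_kernel \<beta> L n t \<le> exp (1 - t\<^sup>2 / 16)"
proof -
  define \<tau> where "\<tau> = t / sqrt (real n)"
  have "8 * L\<^sup>2 \<ge> 8 * (L * 2)" unfolding power2_eq_square using L by (intro mult_left_mono) auto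
  then have nL: "real n \<ge> 16 * L" using n by simp
  then have n0: "real n > 0" using L by simp
  define E where "E = - (2 * real n / L - \<beta>) * (exp (L * \<tau> / 2) - 1) + (1 - \<beta>) * L * \<tau> / 2"
  have k: "saddle_kernel \<beta> L n t = (if \<tau> < - 1 then 0 else (1 + \<tau>) ^ n * exp E)"
    by (simp add: saddle_kernel_def \<tau>_def E_def Let_def)
  show "0 \<le> saddle_kernel \<beta> L n t" unfolding k by auto
  have t2: "t\<^sup>2 = real n * \<tau>\<^sup>2" using n0 by (simp add: \<tau>_def power_divide)
  have c: "2 * real n / L - \<beta> \<ge> real n / L"
  proof -
    have "real n / L \<ge> 16" using nL L by (simp add: field_simps)
    then show ?thesis using \<beta> by simp
  qed
  have nL0: "real n / L > 0" using n0 L by simp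
  show "saddle_kernel \<beta> L n t \<le> exp (1 - t\<^sup>2 / 16)"
  proof (cases "\<tau> \<le> - 1")
    case True
    then show ?thesis using n0 by (auto simp: k power_0_left)
  next
    case False
    then have "saddle_kernel \<beta> L n t = exp (real n * ln (1 + \<tau>) + E)"
      by (simp add: k exp_add exp_of_nat_mult)
    moreover have "real n * ln (1 + \<tau>) + E \<le> 1 - real n * \<tau>\<^sup>2 / 16"
    proof (cases "\<tau> \<ge> 0")
      case True
      have "real n * ln (1 + \<tau>) \<le> real n * \<tau>"
        using True by (intro mult_left_mono ln_add_one_self_le_self) auto
      moreover have "E \<le> - (2 * real n / L - \<beta>) * (L * \<tau> / 2) - real n / L * (L\<^sup>2 * \<tau>\<^sup>2 / 8) + (1 - \<beta>) * L * \<tau> / 2"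
      proof -
        have "exp (L * \<tau> / 2) - 1 \<ge> L * \<tau> / 2 + L\<^sup>2 * \<tau>\<^sup>2 / 8"
          using exp_ge_quadratic[of "L * \<tau> / 2"] True L by (simp add: power_divide power_mult_distrib)
        then have "(2 * real n / L - \<beta>) * (exp (L * \<tau> / 2) - 1) \<ge>
            (2 * real n / L - \<beta>) * (L * \<tau> / 2 + L\<^sup>2 * \<tau>\<^sup>2 / 8)"
          using c nL0 by (intro mult_left_mono) auto
        moreover have "(2 * real n / L - \<beta>) * (L\<^sup>2 * \<tau>\<^sup>2 / 8) \<ge> real n / L * (L\<^sup>2 * \<tau>\<^sup>2 / 8)"
          using c by (intro mult_right_mono) auto
        ultimately show ?thesis unfolding E_def mult_minus_left by (simp only: distrib_left)
      qed
      moreover have "- (2 * real n / L - \<beta>) * (L * \<tau> / 2) + (1 - \<beta>) * L * \<tau> / 2 = L * \<tau> / 2 - real n * \<tau>"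
        using L by (simp add: field_simps)
      moreover have "real n / L * (L\<^sup>2 * \<tau>\<^sup>2 / 8) \<ge> real n * \<tau>\<^sup>2 / 8"
      proof -
        have "1 * (real n * \<tau>\<^sup>2 / 8) \<le> L * (real n * \<tau>\<^sup>2 / 8)" using L by (intro mult_right_mono) auto
        moreover have "real n / L * (L\<^sup>2 * \<tau>\<^sup>2 / 8) = L * (real n * \<tau>\<^sup>2 / 8)"
          using L by (simp add: power2_eq_square)
        ultimately show ?thesis by simp
      qed
      moreover have "L * \<tau> / 2 \<le> 1 + real n * \<tau>\<^sup>2 / 16"
      proof (cases "L * \<tau> \<le> 1")
        case True
        have "real n * \<tau>\<^sup>2 / 16 \<ge> 0" by simp
        with True show ?thesis by linarith
      next
        case False
        have "L * \<tau> * 1 \<le> L * \<tau> * (L * \<tau>)" using False L \<open>\<tau> \<ge> 0\<close> by (intro mult_left_mono) auto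
        also have "\<dots> = (8 * L\<^sup>2) * \<tau>\<^sup>2 / 8" by (simp add: power2_eq_square)
        also have "\<dots> \<le> real n * \<tau>\<^sup>2 / 8" using n by (intro divide_right_mono mult_right_mono) auto
        finally show ?thesis by simp
      qed
      ultimately show ?thesis by simp
    next
      case neg: False
      have "real n * ln (1 + \<tau>) \<le> real n * (\<tau> - \<tau>\<^sup>2 / 2)"
        using neg False by (intro mult_left_mono ln_1_plus_le_neg) auto
      moreover have "E \<le> L * \<tau> / 2 - real n * \<tau>"
      proof -
        have "(2 * real n / L - \<beta>) * (L * \<tau> / 2) \<le> (2 * real n / L - \<beta>) * (exp (L * \<tau> / 2) - 1)"
        proof (intro mult_left_mono)
          show "L * \<tau> / 2 \<le> exp (L * \<tau> / 2) - 1"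
            using exp_ge_add_one_self[of "L * \<tau> / 2"] by linarith
        qed (use c nL0 in linarith)
        moreover have "(1 - \<beta>) * L * \<tau> / 2 - (2 * real n / L - \<beta>) * (L * \<tau> / 2) = L * \<tau> / 2 - real n * \<tau>"
          using L by (simp add: field_simps)
        ultimately show ?thesis unfolding E_def mult_minus_left by linarith
      qed
      moreover have "L * \<tau> \<le> 0" using neg L by (simp add: mult_nonneg_nonpos)
      moreover have "real n * \<tau>\<^sup>2 \<ge> 0" by simp
      ultimately show ?thesis unfolding right_diff_distrib by linarith
    qed
    ultimately show ?thesis by (simp add: t2)
  qed
qed

text \<open>Orders 0 to 2 are split off because they cancel or become the Gaussian; order
  \<open>k + 2\<close> of the phase then belongs to the power \<open>h ^ k\<close>.\<close>

lemma sum_Suc_Suc_Suc_shift: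
  fixes f :: "nat \<Rightarrow> real"
  shows "(\<Sum>k<R + 3. f k) = f 0 + f 1 + f 2 + (\<Sum>k=1..R. f (k + 2))"
proof -
  have "(\<Sum>k<R + 3. f k) = f 0 + (f 1 + (f 2 + (\<Sum>k<R. f (k + 3))))"
    by (simp only: numeral_3_eq_3 numeral_2_eq_2 One_nat_def add_Suc_right add_0_right
        sum.lessThan_Suc_shift)
  also have "(\<Sum>k<R. f (k + 3)) = (\<Sum>k=1..R. f (k + 2))"
    by (rule sum.reindex_bij_witness[of _ "\<lambda>k. k - 1" Suc]) (auto simp: eval_nat_numeral)
  finally show ?thesis by simp
qed

lemma sum_Suc_shift:
  fixes f :: "nat \<Rightarrow> real"
  shows "(\<Sum>k<R + 1. f k) = f 0 + (\<Sum>k=1..R. f k)"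
proof -
  have "(\<Sum>k<R. f (Suc k)) = (\<Sum>k=1..R. f k)"
    by (rule sum.reindex_bij_witness[of _ "\<lambda>k. k - 1" Suc]) auto
  then show ?thesis by (simp only: add_Suc_right add_0_right One_nat_def sum.lessThan_Suc_shift)
qed

text \<open>The phase is multiplied by \<open>n = h^(-2)\<close> and is therefore expanded to order
  \<open>R + 2\<close> in \<tau>, the drift only to order \<open>R\<close>; then both errors are of
  order \<open>h ^ (R + 1)\<close>. The 8 is made up of 2 for the logarithm, 4 for the exponential
  in the phase and 2 for the drift. The bound \<open>1 / L\<close> on \<tau> keeps the arguments of
  all series within \<open>1 / 2\<close>.\<close>

lemma saddle_kernel_exponent:
  fixes R :: nat
  assumes L: "L \<ge> 2" and n: "n > 0" and \<beta>: "0 \<le> \<beta>" "\<beta> \<le> 1" and R: "R \<ge> 1"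
    and t: "\<bar>t\<bar> / sqrt (real n) \<le> 1 / L"
  obtains Z where "saddle_kernel \<beta> L n t = exp (- (1 + L / 2) * t\<^sup>2 / 2) * exp Z"
    "\<bar>Z - (\<Sum>k=1..R. poly (exponent_poly \<beta> L k) t * (1 / sqrt (real n)) ^ k)\<bar>
       \<le> (1 / sqrt (real n)) ^ Suc R * (8 * L ^ (R + 2) * (1 + \<bar>t\<bar>) ^ (R + 3))"
proof -
  define h where "h = 1 / sqrt (real n)"
  define \<tau> where "\<tau> = t * h"
  define x where "x = L * \<tau> / 2"
  have h: "h > 0" "h\<^sup>2 * real n = 1" using n by (simp_all add: h_def power_divide)
  have \<tau>: "\<bar>\<tau>\<bar> \<le> 1 / L" using t h by (simp add: \<tau>_def h_def abs_mult)
  have "1 / L \<le> 1 / 2" using L by simp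
  then have \<tau>2: "\<bar>\<tau>\<bar> \<le> 1 / 2" using \<tau> by linarith
  have x: "\<bar>x\<bar> \<le> 1 / 2" using \<tau> L by (simp add: x_def abs_mult field_simps)
  define Z where "Z = real n * (ln (1 + \<tau>) - 2 / L * (exp x - 1)) + \<beta> * (exp x - 1) + (1 - \<beta>) * x
     + (1 + L / 2) * t\<^sup>2 / 2"
  have "saddle_kernel \<beta> L n t = exp (real n * ln (1 + \<tau>)) *
      exp (- (2 * real n / L - \<beta>) * (exp x - 1) + (1 - \<beta>) * x)"
  proof -
    have "saddle_kernel \<beta> L n t = (1 + \<tau>) ^ n *
        exp (- (2 * real n / L - \<beta>) * (exp x - 1) + (1 - \<beta>) * x)"
    proof -
      have "t / sqrt (real n) = \<tau>" by (simp add: \<tau>_def h_def)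
      moreover have "\<not> \<tau> < - 1" using \<tau>2 by linarith
      ultimately show ?thesis by (simp add: saddle_kernel_def Let_def x_def mult.assoc)
    qed
    then show ?thesis using \<tau>2 by (simp add: exp_of_nat_mult)
  qed
  also have "\<dots> = exp (- (1 + L / 2) * t\<^sup>2 / 2) * exp Z"
    by (simp add: Z_def algebra_simps add_divide_distrib diff_divide_distrib flip: exp_add)
  finally have 1: "saddle_kernel \<beta> L n t = \<dots>" .
  define A where "A = (\<Sum>k<R + 3. (- ((- 1) ^ k) / real k) * \<tau> ^ k)"
  define B where "B = (\<Sum>k<R + 3. 1 / fact k * x ^ k)"
  define D where "D = (\<Sum>k<R + 1. 1 / fact k * x ^ k)"
  define S where "S = (\<Sum>k=1..R. poly (exponent_poly \<beta> L k) t * h ^ k)"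
  have S: "S = real n * (A - 2 / L * (B - 1)) + \<beta> * (D - 1) + (1 - \<beta>) * x + (1 + L / 2) * t\<^sup>2 / 2"
  proof -
    define A' where "A' = (\<Sum>k=1..R. (- ((- 1) ^ (k + 2)) / real (k + 2)) * \<tau> ^ (k + 2))"
    define B' where "B' = (\<Sum>k=1..R. 1 / fact (k + 2) * x ^ (k + 2))"
    define D' where "D' = (\<Sum>k=1..R. 1 / fact k * x ^ k)"
    have A: "A = \<tau> - \<tau>\<^sup>2 / 2 + A'"
      unfolding A_def A'_def sum_Suc_Suc_Suc_shift by (simp add: power2_eq_square)
    have B: "B = 1 + x + x\<^sup>2 / 2 + B'"
      unfolding B_def B'_def sum_Suc_Suc_Suc_shift by (simp add: power2_eq_square)
    have D: "D = 1 + D'"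
      unfolding D_def D'_def sum_Suc_shift by simp
    have drift: "(\<Sum>k=1..R. drift_coeff \<beta> L k * \<tau> ^ k) =
        \<beta> * D' + (1 - \<beta>) * x"
    proof -
      have "(\<Sum>k=1..R. drift_coeff \<beta> L k * \<tau> ^ k) =
          (\<Sum>k=1..R. \<beta> * (1 / fact k * x ^ k) + (if k = 1 then (1 - \<beta>) * x else 0))"
        by (intro sum.cong refl)
          (auto simp: drift_coeff_def x_def power_mult_distrib power_divide field_simps)
      then show ?thesis using R by (simp add: D'_def sum.distrib sum_distrib_left)
    qed
    have phase: "real n * (A' - 2 / L * B') = (\<Sum>k=1..R. phase_coeff L (k + 2) * t ^ (k + 2) * h ^ k)"
      unfolding A'_def B'_def sum_distrib_left sum_subtractf[symmetric]
    proof (intro sum.cong refl)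
      fix k
      have "2 / L * (1 / fact (k + 2) * x ^ (k + 2)) = (L / 2) ^ (k + 1) / fact (k + 2) * \<tau> ^ (k + 2)"
      proof -
        have "x ^ (k + 2) = (L / 2 * \<tau>) ^ (k + 2)" by (simp add: x_def)
        also have "\<dots> = L / 2 * ((L / 2) ^ (k + 1) * \<tau> ^ (k + 2))"
          unfolding power_mult_distrib by simp
        finally have x: "x ^ (k + 2) = L / 2 * ((L / 2) ^ (k + 1) * \<tau> ^ (k + 2))" .
        have "2 / L * (1 / F * (L / 2 * y)) = y / F" if "F > 0" for F y
          using L that by simp
        then show ?thesis unfolding x by (simp del: fact_Suc power_Suc)
      qed
      then have "- ((- 1) ^ (k + 2)) / real (k + 2) * \<tau> ^ (k + 2) - 2 / L * (1 / fact (k + 2) * x ^ (k + 2))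
          = phase_coeff L (k + 2) * \<tau> ^ (k + 2)"
        by (simp add: phase_coeff_def algebra_simps)
      also have "real n * \<dots> = phase_coeff L (k + 2) * t ^ (k + 2) * h ^ k * (h\<^sup>2 * real n)"
        by (simp add: \<tau>_def power_mult_distrib power_add power2_eq_square)
      finally show "real n * (- ((- 1) ^ (k + 2)) / real (k + 2) * \<tau> ^ (k + 2) -
          2 / L * (1 / fact (k + 2) * x ^ (k + 2))) = phase_coeff L (k + 2) * t ^ (k + 2) * h ^ k"
        by (simp only: h(2) mult_1_right)
    qed
    have "S = (\<Sum>k=1..R. phase_coeff L (k + 2) * t ^ (k + 2) * h ^ k) +
        (\<Sum>k=1..R. drift_coeff \<beta> L k * \<tau> ^ k)"
      by (simp add: S_def exponent_poly_def poly_monom \<tau>_def power_mult_distrib sum.distrib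
          distrib_right mult.assoc)
    also have "\<dots> = real n * (A' - 2 / L * B') + (\<beta> * D' + (1 - \<beta>) * x)"
      unfolding phase drift ..
    finally have S: "S = \<dots>" .
    have "real n * (A - 2 / L * (B - 1)) =
        real n * (\<tau> - \<tau>\<^sup>2 / 2 - 2 / L * (x + x\<^sup>2 / 2)) + real n * (A' - 2 / L * B')"
      unfolding A B by (simp add: algebra_simps)
    \<comment> \<open>The linear terms cancel since \<open>2 / L * x = \<tau>\<close>, and the
      quadratic ones combine to the Gaussian exponent.\<close>
    also have "real n * (\<tau> - \<tau>\<^sup>2 / 2 - 2 / L * (x + x\<^sup>2 / 2)) =
        - (1 + L / 2) * t\<^sup>2 / 2 * (h\<^sup>2 * real n)"
      using L by (simp add: x_def \<tau>_def field_simps power2_eq_square)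
    finally show ?thesis unfolding S D h(2) by (simp add: field_simps)
  qed
  define eA where "eA = ln (1 + \<tau>) - A"
  define eB where "eB = exp x - B"
  define eD where "eD = exp x - D"
  have eA: "\<bar>eA\<bar> \<le> 2 * \<bar>\<tau>\<bar> ^ (R + 3)" unfolding eA_def A_def by (rule ln_1_plus_tail_bound[OF \<tau>2])
  have xx: "\<bar>x\<bar> \<le> L * \<bar>\<tau>\<bar>" using L by (simp add: x_def abs_mult)
  have "\<bar>eB\<bar> \<le> 2 * \<bar>x\<bar> ^ (R + 3)" unfolding eB_def B_def by (rule exp_tail_bound[OF x])
  also have "\<dots> \<le> 2 * (L * \<bar>\<tau>\<bar>) ^ (R + 3)" using xx by (intro mult_left_mono power_mono) auto
  finally have eB: "\<bar>eB\<bar> \<le> 2 * (L * \<bar>\<tau>\<bar>) ^ (R + 3)" .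
  have "\<bar>eD\<bar> \<le> 2 * \<bar>x\<bar> ^ (R + 1)" unfolding eD_def D_def by (rule exp_tail_bound[OF x])
  also have "\<dots> \<le> 2 * (L * \<bar>\<tau>\<bar>) ^ (R + 1)" using xx by (intro mult_left_mono power_mono) auto
  finally have eD: "\<bar>eD\<bar> \<le> 2 * (L * \<bar>\<tau>\<bar>) ^ (R + 1)" .
  have Zd: "Z - S = real n * eA - real n * (2 / L) * eB + \<beta> * eD"
    unfolding S Z_def eA_def eB_def eD_def by (simp add: algebra_simps add_divide_distrib diff_divide_distrib)
  define T where "T = h ^ Suc R * (L ^ (R + 2) * (1 + \<bar>t\<bar>) ^ (R + 3))"
  have nh: "real n * h ^ (R + 3) = h ^ Suc R"
  proof -
    have "real n * h ^ (R + 3) = h ^ Suc R * (h\<^sup>2 * real n)"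
      by (simp add: power_add power2_eq_square power3_eq_cube)
    then show ?thesis by (simp only: h(2) mult_1_right)
  qed
  have tt: "\<bar>t\<bar> ^ (R + 3) \<le> (1 + \<bar>t\<bar>) ^ (R + 3)" by (intro power_mono) auto
  have tt1: "\<bar>t\<bar> ^ (R + 1) \<le> (1 + \<bar>t\<bar>) ^ (R + 3)"
    by (rule order_trans[OF power_mono power_increasing]) auto
  have L1: "L ^ (R + 2) \<ge> 1" using L by (intro one_le_power) auto
  have L2: "L ^ (R + 1) \<le> L ^ (R + 2)" using L by (intro power_increasing) auto
  have "\<bar>real n * eA\<bar> \<le> real n * (2 * \<bar>\<tau>\<bar> ^ (R + 3))" using eA by (simp add: abs_mult mult_left_mono)
  also have "\<dots> = 2 * (real n * h ^ (R + 3)) * (1 * \<bar>t\<bar> ^ (R + 3))"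
    using h by (simp add: \<tau>_def abs_mult power_mult_distrib)
  also have "\<dots> \<le> 2 * T" unfolding nh T_def mult.assoc using h L1 tt by (intro mult_left_mono mult_mono) auto
  finally have a1: "\<bar>real n * eA\<bar> \<le> 2 * T" .
  have "\<bar>real n * (2 / L) * eB\<bar> \<le> real n * (2 / L) * (2 * (L * \<bar>\<tau>\<bar>) ^ (R + 3))"
  proof -
    have "\<bar>real n * (2 / L) * eB\<bar> = real n * (2 / L) * \<bar>eB\<bar>" using L by (simp add: abs_mult)
    also have "\<dots> \<le> real n * (2 / L) * (2 * (L * \<bar>\<tau>\<bar>) ^ (R + 3))"
      using eB L by (intro mult_left_mono) auto
    finally show ?thesis .
  qed
  also have "\<dots> = 4 * (real n * h ^ (R + 3)) * (L ^ (R + 2) * \<bar>t\<bar> ^ (R + 3))"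
    using h L by (simp add: \<tau>_def abs_mult power_mult_distrib power_add power2_eq_square power3_eq_cube)
  also have "\<dots> \<le> 4 * T" unfolding nh T_def mult.assoc using h L tt by (intro mult_left_mono) auto
  finally have a2: "\<bar>real n * (2 / L) * eB\<bar> \<le> 4 * T" .
  have "\<bar>\<beta> * eD\<bar> \<le> 1 * (2 * (L * \<bar>\<tau>\<bar>) ^ (R + 1))"
    unfolding abs_mult using eD \<beta> by (intro mult_mono) auto
  also have "\<dots> = 2 * (h ^ Suc R * (L ^ (R + 1) * \<bar>t\<bar> ^ (R + 1)))"
    using h by (simp add: \<tau>_def abs_mult power_mult_distrib)
  also have "\<dots> \<le> 2 * T" unfolding T_def using h L L2 tt1 by (intro mult_left_mono mult_mono) auto
  finally have a3: "\<bar>\<beta> * eD\<bar> \<le> 2 * T" .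
  have tri: "\<bar>p - q + r\<bar> \<le> 2 * T + 4 * T + 2 * T"
    if "\<bar>p\<bar> \<le> 2 * T" "\<bar>q\<bar> \<le> 4 * T" "\<bar>r\<bar> \<le> 2 * T" for p q r
    using that by linarith
  have "\<bar>Z - S\<bar> \<le> 8 * T" using tri[OF a1 a2 a3] unfolding Zd by simp
  then show ?thesis using that[of Z] 1 by (simp add: S_def T_def h_def mult_ac)
qed

text \<open>With \<open>s = |t| * x\<close>, the phase part of order \<open>k\<close> is at most
  \<open>2 * t^2 * L * (L * s)^k\<close>; the surplus factor \<open>L\<close> is the reason for
  \<open>L^2\<close> in the cutoff. The sum is then dominated by a geometric one of ratio
  \<open>1 / 64\<close> and stays below \<open>(2 * t^2 + 1) / 32\<close>, whence the coefficient
  \<open>1 / 16\<close> of \<open>t^2\<close>.\<close>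

lemma exponent_poly_sum_bound:
  assumes L: "L \<ge> 1" and \<beta>: "0 \<le> \<beta>" "\<beta> \<le> 1" and x: "0 \<le> x" "\<bar>t\<bar> * x \<le> 1 / (64 * L\<^sup>2)"
  shows "\<bar>\<Sum>k=1..R. poly (exponent_poly \<beta> L k) t * x ^ k\<bar> \<le> t\<^sup>2 / 16 + 1"
proof -
  define s where "s = \<bar>t\<bar> * x"
  have s: "0 \<le> s" "L * s \<le> 1 / (64 * L)"
    using x L by (auto simp: s_def field_simps power2_eq_square)
  have "1 / (64 * L) \<le> 1 / 64" using L by simp
  then have "L * s \<le> 1 / 64" using s(2) by linarith
  then have Ls: "0 \<le> L * s" "L * s \<le> 1 / 64" using s L by auto
  have *: "\<bar>poly (exponent_poly \<beta> L k) t * x ^ k\<bar> \<le> (2 * t\<^sup>2 + 1) * (1 / 64) ^ k" if "k \<ge> 1" for k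
  proof -
    have f1: "(1 :: real) \<le> fact m" for m by (rule fact_ge_1)
    have "\<bar>phase_coeff L (k + 2)\<bar> \<le> \<bar>- ((- 1) ^ (k + 2)) / real (k + 2)\<bar> + \<bar>(L / 2) ^ (k + 1) / fact (k + 2)\<bar>"
      using abs_triangle_ineq4[of "- ((- 1) ^ (k + 2)) / real (k + 2)" "(L / 2) ^ (k + 1) / fact (k + 2)"]
      by (simp only: phase_coeff_def diff_add_inverse2 add_2_eq_Suc' diff_Suc_1 Suc_eq_plus1)
    also have "\<dots> \<le> 1 + (L / 2) ^ (k + 1) / 1"
    proof (intro add_mono)
      have "\<bar>(L / 2) ^ (k + 1) / fact (k + 2)\<bar> = (L / 2) ^ (k + 1) / fact (k + 2)"
        using L by simp
      also have "\<dots> \<le> (L / 2) ^ (k + 1) / 1"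
        using L f1 by (intro frac_le) (auto simp del: power_Suc fact_Suc)
      finally show "\<bar>(L / 2) ^ (k + 1) / fact (k + 2)\<bar> \<le> (L / 2) ^ (k + 1) / 1" .
    qed (auto simp: abs_divide)
    also have "\<dots> \<le> L ^ (k + 1) + L ^ (k + 1)"
      using L by (intro add_mono) (auto intro!: power_mono one_le_power simp del: power_Suc)
    finally have p: "\<bar>phase_coeff L (k + 2)\<bar> \<le> 2 * L ^ (k + 1)" by simp
    have "\<bar>phase_coeff L (k + 2) * t ^ (k + 2) * x ^ k\<bar> = \<bar>phase_coeff L (k + 2)\<bar> * (t\<^sup>2 * s ^ k)"
      using x by (simp add: s_def abs_mult power_abs power_mult_distrib power_add power2_eq_square)
    also have "\<dots> \<le> 2 * L ^ (k + 1) * (t\<^sup>2 * s ^ k)" using p s by (intro mult_right_mono) auto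
    also have "\<dots> = 2 * t\<^sup>2 * (L * (L * s) * (L * s) ^ (k - 1))"
      using that by (cases k) (auto simp: power_mult_distrib)
    also have "\<dots> \<le> 2 * t\<^sup>2 * (1 / 64 * (1 / 64) ^ (k - 1))"
    proof (intro mult_left_mono mult_mono power_mono)
      have "L * (L * s) \<le> L * (1 / (64 * L))" using s L by (intro mult_left_mono) auto
      then show "L * (L * s) \<le> 1 / 64" using L by simp
    qed (use s Ls L in auto)
    also have "1 / 64 * (1 / 64) ^ (k - 1) = (1 / 64 :: real) ^ k" using that by (cases k) auto
    finally have 1: "\<bar>phase_coeff L (k + 2) * t ^ (k + 2) * x ^ k\<bar> \<le> 2 * t\<^sup>2 * (1 / 64) ^ k" .
    have "\<bar>drift_coeff \<beta> L k\<bar> \<le> L ^ k"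
    proof (cases "k = 1")
      case False
      have "\<bar>drift_coeff \<beta> L k\<bar> = \<beta> * (L / 2) ^ k / fact k"
        using False \<beta> L by (simp add: drift_coeff_def abs_mult)
      also have "\<dots> \<le> 1 * L ^ k / 1" using \<beta> L f1
        by (intro frac_le mult_mono power_mono) auto
      finally show ?thesis by simp
    qed (use L in \<open>simp add: drift_coeff_def\<close>)
    then have "\<bar>drift_coeff \<beta> L k\<bar> * s ^ k \<le> L ^ k * s ^ k"
      using s by (intro mult_right_mono) auto
    also have "\<dots> \<le> (1 / 64) ^ k" unfolding power_mult_distrib[symmetric] using Ls by (intro power_mono) auto
    finally have "\<bar>drift_coeff \<beta> L k\<bar> * s ^ k \<le> (1 / 64) ^ k" .
    moreover have "\<bar>drift_coeff \<beta> L k * t ^ k * x ^ k\<bar> = \<bar>drift_coeff \<beta> L k\<bar> * s ^ k"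
      using x by (simp add: s_def abs_mult power_abs power_mult_distrib)
    ultimately have 2: "\<bar>drift_coeff \<beta> L k * t ^ k * x ^ k\<bar> \<le> (1 / 64) ^ k" by linarith
    have "poly (exponent_poly \<beta> L k) t * x ^ k =
        phase_coeff L (k + 2) * t ^ (k + 2) * x ^ k + drift_coeff \<beta> L k * t ^ k * x ^ k"
      by (simp add: exponent_poly_def poly_monom distrib_right)
    then show ?thesis using 1 2 by (simp only: distrib_right mult_1_left)
  qed
  \<comment> \<open>The subtracted term strengthens the claim enough for the induction.\<close>
  have geo: "(\<Sum>k=1..R. (1 / 64 :: real) ^ k) \<le> 1 / 32 - (1 / 32) * (1 / 64) ^ R"
  proof (induction R)
    case (Suc R)
    have "(1 / 64 :: real) ^ R \<ge> 0" by simp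
    moreover have "(\<Sum>k=1..Suc R. (1 / 64 :: real) ^ k) = (\<Sum>k=1..R. (1 / 64) ^ k) + 1 / 64 * (1 / 64) ^ R"
      by simp
    moreover have "(1 / 64 :: real) ^ Suc R = 1 / 64 * (1 / 64) ^ R" by simp
    ultimately show ?case using Suc by linarith
  qed simp
  have "(1 / 32 :: real) * (1 / 64) ^ R \<ge> 0" by simp
  with geo have geo': "(\<Sum>k=1..R. (1 / 64 :: real) ^ k) \<le> 1 / 32" by linarith
  have "\<bar>\<Sum>k=1..R. poly (exponent_poly \<beta> L k) t * x ^ k\<bar> \<le> (\<Sum>k=1..R. (2 * t\<^sup>2 + 1) * (1 / 64) ^ k)"
    by (rule order_trans[OF sum_abs sum_mono]) (use * in auto)
  also have "\<dots> = (2 * t\<^sup>2 + 1) * (\<Sum>k=1..R. (1 / 64) ^ k)" by (simp add: sum_distrib_left)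
  also have "\<dots> \<le> (2 * t\<^sup>2 + 1) * (1 / 32)" using geo' by (intro mult_left_mono) auto
  finally show ?thesis by simp
qed

text \<open>With both exponentials on the right, each can be bounded separately after multiplication
  by the Gaussian.\<close>

lemma exp_diff_le: "\<bar>exp x - exp y\<bar> \<le> \<bar>x - y\<bar> * (exp x + exp (y :: real))"
proof -
  have *: "\<bar>exp x - exp y\<bar> \<le> \<bar>x - y\<bar> * (exp x + exp y)" if "y \<le> x" for x y :: real
  proof -
    have "1 - exp (y - x) \<le> x - y" using exp_ge_add_one_self[of "y - x"] by linarith
    then have "exp x * (1 - exp (y - x)) \<le> exp x * (x - y)" by (intro mult_left_mono) auto
    then have "exp x - exp y \<le> exp x * (x - y)" by (simp add: right_diff_distrib flip: exp_add)
    also have "\<dots> \<le> \<bar>x - y\<bar> * (exp x + exp y)" using that by (simp add: algebra_simps)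
    finally show ?thesis using that by simp
  qed
  show ?thesis using *[of y x] *[of x y] by (cases "y \<le> x") (auto simp: abs_minus_commute add.commute)
qed

text \<open>\<open>x ^ m / fact m\<close> is a single term of the exponential series. This trades
  the exponentially small theta correction for a power of \<open>1 / n\<close>.\<close>

lemma exp_minus_le_power: "x > 0 \<Longrightarrow> exp (- x) \<le> fact m / x ^ m" for x :: real
proof -
  assume x: "x > 0"
  have s: "(\<lambda>k. x ^ k / fact k) sums exp x"
    using exp_converges[of x] by (simp add: scaleR_conv_of_real field_simps)
  have "(\<Sum>k\<in>{m}. x ^ k / fact k) \<le> exp x"
    unfolding sums_unique[OF s] by (rule sum_le_suminf[OF sums_summable[OF s]]) (use x in auto)
  then show ?thesis using x by (simp add: exp_minus field_simps)
qed

lemma gauss_le: "L \<ge> 0 \<Longrightarrow> exp (- (1 + L / 2) * t\<^sup>2 / 2) \<le> exp (- t\<^sup>2 / 2)" for L t :: real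
  by (simp add: algebra_simps)

definition truncated_exp :: "real \<Rightarrow> real \<Rightarrow> nat \<Rightarrow> real \<Rightarrow> real \<Rightarrow> real" where
  "truncated_exp \<beta> L R h t = (\<Sum>k\<le>R. poly (exp_poly \<beta> L k) t * h ^ k)"

text \<open>The kernel is compared with \<open>g * exp S\<close>, and that with the truncated
  series. The second comparison loses \<open>exp (t^2 / 8 + 2)\<close>, the factor
  \<open>exp S\<close> in the first at most \<open>exp (t^2 / 16 + 1)\<close>; both are absorbed by
  \<open>exp (- t^2 / 2)\<close>, and \<open>exp (- t^2 / 16)\<close> is left over.\<close>

lemma saddle_kernel_near:
  fixes R :: nat
  assumes L: "L \<ge> 2" and n: "real n \<ge> 8 * L\<^sup>2" and \<beta>: "0 \<le> \<beta>" "\<beta> \<le> 1" and R: "R \<ge> 1"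
    and t: "\<bar>t\<bar> / sqrt (real n) \<le> 1 / (64 * L\<^sup>2)"
  shows "\<bar>saddle_kernel \<beta> L n t - exp (- (1 + L / 2) * t\<^sup>2 / 2) * truncated_exp \<beta> L R (1 / sqrt (real n)) t\<bar> \<le>
    (16 * exp 1 * L ^ (R + 2) * (1 + \<bar>t\<bar>) ^ (R + 3) + exp 2 * (\<Sum>k\<le>R. \<Sum>i<R.
        \<bar>real (Suc i) * poly (exponent_poly \<beta> L (Suc i)) t * poly (exp_poly \<beta> L k) t\<bar>)) *
      (1 / sqrt (real n)) ^ Suc R * exp (- t\<^sup>2 / 16)"
proof -
  define h where "h = 1 / sqrt (real n)"
  define S where "S = (\<Sum>k=1..R. poly (exponent_poly \<beta> L k) t * h ^ k)"
  define g where "g = exp (- (1 + L / 2) * t\<^sup>2 / 2)"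
  define Q where "Q = (\<Sum>k\<le>R. \<Sum>i<R.
        \<bar>real (Suc i) * poly (exponent_poly \<beta> L (Suc i)) t * poly (exp_poly \<beta> L k) t\<bar>)"
  define T where "T = 8 * L ^ (R + 2) * (1 + \<bar>t\<bar>) ^ (R + 3)"
  have "8 * L\<^sup>2 \<ge> 8 * (2 * 2)" unfolding power2_eq_square using L by (intro mult_left_mono mult_mono) auto
  then have n1: "real n \<ge> 1" using n by simp
  then have h: "0 < h" "h \<le> 1" by (simp_all add: h_def)
  have "1 / (64 * L\<^sup>2) \<le> 1 / L"
    using L by (simp add: field_simps power2_eq_square)
  then have t1: "\<bar>t\<bar> / sqrt (real n) \<le> 1 / L" using t by linarith
  have "n > 0" using n1 by (cases n) auto
  from saddle_kernel_exponent[OF L this \<beta> R t1] obtain Z where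
    Z: "saddle_kernel \<beta> L n t = g * exp Z" "\<bar>Z - S\<bar> \<le> h ^ Suc R * T"
    unfolding g_def S_def h_def T_def by blast
  have Sb: "\<bar>\<Sum>k=1..R. poly (exponent_poly \<beta> L k) t * x ^ k\<bar> \<le> t\<^sup>2 / 16 + 1" if "0 \<le> x" "x \<le> h" for x
  proof (rule exponent_poly_sum_bound)
    have "\<bar>t\<bar> * x \<le> \<bar>t\<bar> * h" using that by (intro mult_left_mono) auto
    then show "\<bar>t\<bar> * x \<le> 1 / (64 * L\<^sup>2)" using t by (simp add: h_def)
  qed (use L \<beta> that in auto)
  have g: "0 < g" "g \<le> exp (- t\<^sup>2 / 2)"
    unfolding g_def using L gauss_le[of L t] by auto
  have "\<bar>truncated_exp \<beta> L R h t - exp S\<bar> \<le> h ^ Suc R * exp (2 * (t\<^sup>2 / 16 + 1)) * Q"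
    unfolding truncated_exp_def S_def Q_def
    by (rule exp_series_remainder[OF _ poly_exp_poly_Suc]) (use h Sb in auto)
  then have 1: "\<bar>g * exp S - g * truncated_exp \<beta> L R h t\<bar> \<le> g * (h ^ Suc R * exp (2 * (t\<^sup>2 / 16 + 1)) * Q)"
    unfolding right_diff_distrib[symmetric] abs_mult abs_of_pos[OF g(1)]
    using g by (intro mult_left_mono) (auto simp: abs_minus_commute)
  have Q0: "Q \<ge> 0" unfolding Q_def by (intro sum_nonneg) auto
  have "g * exp (2 * (t\<^sup>2 / 16 + 1)) \<le> exp (- t\<^sup>2 / 2) * exp (2 * (t\<^sup>2 / 16 + 1))"
    using g by (intro mult_right_mono) auto
  also have "\<dots> = exp (2 - 3 * t\<^sup>2 / 8)" unfolding exp_add[symmetric] by (rule arg_cong[of _ _ exp]) (simp add: field_simps)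
  also have "\<dots> \<le> exp (2 + - t\<^sup>2 / 16)" unfolding exp_le_cancel_iff using zero_le_power2[of t] by linarith
  finally have "g * exp (2 * (t\<^sup>2 / 16 + 1)) \<le> exp 2 * exp (- t\<^sup>2 / 16)" unfolding exp_add .
  then have "(g * exp (2 * (t\<^sup>2 / 16 + 1))) * (h ^ Suc R * Q) \<le> (exp 2 * exp (- t\<^sup>2 / 16)) * (h ^ Suc R * Q)"
    using h Q0 by (intro mult_right_mono) auto
  with 1 have 1: "\<bar>g * exp S - g * truncated_exp \<beta> L R h t\<bar> \<le> exp 2 * Q * h ^ Suc R * exp (- t\<^sup>2 / 16)"
    by (simp add: mult_ac)
  have "g * exp S \<le> exp (- t\<^sup>2 / 2) * exp (t\<^sup>2 / 16 + 1)"
    using g Sb[of h] h unfolding S_def by (intro mult_mono) auto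
  also have "\<dots> \<le> exp (1 + - t\<^sup>2 / 16)" unfolding exp_add[symmetric] exp_le_cancel_iff
    using zero_le_power2[of t] by linarith
  finally have "g * exp S \<le> exp 1 * exp (- t\<^sup>2 / 16)" unfolding exp_add .
  \<comment> \<open>\<open>g * exp Z\<close> is the kernel itself, so its global Gaussian bound
    replaces an estimate of \<open>Z\<close>.\<close>
  moreover have "g * exp Z \<le> exp 1 * exp (- t\<^sup>2 / 16)"
    using saddle_kernel_bounds(2)[OF L n \<beta>, of t] unfolding Z(1) by (simp flip: exp_add)
  ultimately have gg: "g * (exp Z + exp S) \<le> 2 * exp 1 * exp (- t\<^sup>2 / 16)" by (simp add: distrib_left)
  have "\<bar>g * exp Z - g * exp S\<bar> = g * \<bar>exp Z - exp S\<bar>"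
    using g by (simp add: abs_mult flip: right_diff_distrib)
  also have "\<dots> \<le> g * (\<bar>Z - S\<bar> * (exp Z + exp S))"
    using g exp_diff_le by (intro mult_left_mono) auto
  also have "\<dots> = \<bar>Z - S\<bar> * (g * (exp Z + exp S))" by (simp add: mult_ac)
  also have "\<dots> \<le> (h ^ Suc R * T) * (2 * exp 1 * exp (- t\<^sup>2 / 16))"
  proof (rule mult_mono[OF Z(2) gg])
    show "0 \<le> h ^ Suc R * T" using Z(2) by linarith
    show "0 \<le> g * (exp Z + exp S)" using g by (intro mult_nonneg_nonneg add_nonneg_nonneg) auto
  qed
  finally have 2: "\<bar>g * exp Z - g * exp S\<bar> \<le> 2 * exp 1 * T * h ^ Suc R * exp (- t\<^sup>2 / 16)" by (simp add: mult_ac)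
  have "\<bar>saddle_kernel \<beta> L n t - g * truncated_exp \<beta> L R h t\<bar> \<le> \<bar>g * exp Z - g * exp S\<bar> + \<bar>g * exp S - g * truncated_exp \<beta> L R h t\<bar>"
    unfolding Z(1) by linarith
  also have "\<dots> \<le> (2 * exp 1 * T + exp 2 * Q) * h ^ Suc R * exp (- t\<^sup>2 / 16)"
    using 1 2 by (simp add: distrib_right)
  finally show ?thesis unfolding g_def h_def Q_def T_def by (simp add: mult_ac)
qed

text \<open>\<open>w\<close> stands for the theta series relative to its leading exponential. The
  constants are fixed before \<open>L\<close>, \<open>n\<close> and \<open>w\<close> appear, which
  permits inserting the \<open>L\<close> and \<open>w\<close> that belong to
  \<open>n\<close>.\<close>

lemma saddle_kernel_approx:
  fixes R :: nat
  assumes \<beta>: "0 \<le> \<beta>" "\<beta> \<le> 1" "\<beta> \<in> \<rat>" and R: "R \<ge> 1" and C0: "C0 \<ge> 0"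
  obtains C A where "C \<ge> 0" "\<And>L n w t. L \<ge> 2 \<Longrightarrow> real n \<ge> 8 * L\<^sup>2 \<Longrightarrow>
    (\<And>t. t \<ge> - sqrt (real n) \<Longrightarrow> \<bar>w t - 1\<bar> \<le>
       C0 * exp (- (2 * real n / L - \<beta>) * exp (L * (t / sqrt (real n)) / 2))) \<Longrightarrow>
    \<bar>saddle_kernel \<beta> L n t * w t -
       exp (- (1 + L / 2) * t\<^sup>2 / 2) * truncated_exp \<beta> L R (1 / sqrt (real n)) t\<bar> \<le>
    C * L ^ A * (1 + \<bar>t\<bar>) ^ A * (1 / sqrt (real n)) ^ Suc R * exp (- t\<^sup>2 / 16)"
proof -
  \<comment> \<open>\<open>D1\<close> is the error of the kernel inside the cutoff,
    \<open>D2\<close> the theta correction there, and \<open>D3\<close> covers everything beyond the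
    cutoff.\<close>
  define D1 where "D1 = (\<lambda>L t. 16 * exp 1 * L ^ (R + 2) * (1 + \<bar>t\<bar>) ^ (R + 3) + exp 2 * (\<Sum>k\<le>R. \<Sum>i<R.
        \<bar>real (Suc i) * poly (exponent_poly \<beta> L (Suc i)) t * poly (exp_poly \<beta> L k) t\<bar>))"
  define D2 where "D2 = (\<lambda>L t :: real. exp 1 * C0 * fact (Suc R) * 2 ^ Suc R * L ^ Suc R)"
  define D3 where "D3 = (\<lambda>L t. ((1 + C0) * exp 1 + (\<Sum>k\<le>R. \<bar>poly (exp_poly \<beta> L k) t\<bar>)) * (64 * L ^ 2 * \<bar>t\<bar>) ^ Suc R)"
  have "poly_bounded (\<lambda>L t. D1 L t + D2 L t + D3 L t)"
    unfolding D1_def D2_def D3_def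
    by (intro poly_bounded_intros poly_bounded_exponent_poly poly_bounded_exp_poly \<beta>)
  then obtain C A where CA: "C \<ge> 0" "\<And>L t. L \<ge> 1 \<Longrightarrow> \<bar>D1 L t + D2 L t + D3 L t\<bar> \<le> C * L ^ A * (1 + \<bar>t\<bar>) ^ A"
    unfolding poly_bounded_def by blast
  show thesis
  proof (rule that[OF CA(1)])
    fix L t :: real and n :: nat and w :: "real \<Rightarrow> real"
    assume L: "L \<ge> 2" and n: "real n \<ge> 8 * L\<^sup>2"
      and w: "\<And>t. t \<ge> - sqrt (real n) \<Longrightarrow> \<bar>w t - 1\<bar> \<le>
       C0 * exp (- (2 * real n / L - \<beta>) * exp (L * (t / sqrt (real n)) / 2))"
    define h where "h = 1 / sqrt (real n)"
    define g where "g = exp (- (1 + L / 2) * t\<^sup>2 / 2)"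
    define S where "S = truncated_exp \<beta> L R h t"
    define G where "G = exp (- t\<^sup>2 / 16)"
    define k where "k = saddle_kernel \<beta> L n t"
    have "8 * L\<^sup>2 \<ge> 8 * (L * 2)" unfolding power2_eq_square using L by (intro mult_left_mono) auto
    then have nL: "real n \<ge> 16 * L" using n by simp
    then have n1: "real n \<ge> 1" using L by simp
    have h: "0 < h" "h \<le> 1" "h\<^sup>2 * real n = 1" using n1 by (simp_all add: h_def power_divide)
    have G0: "G > 0" by (simp add: G_def)
    have k: "0 \<le> k" "k \<le> exp 1 * G"
      using saddle_kernel_bounds[OF L n \<beta>(1,2), of t] by (simp_all add: k_def G_def flip: exp_add)
    have c: "2 * real n / L - \<beta> \<ge> real n / L" "real n / L > 0"
    proof -
      have "real n / L \<ge> 16" using nL L by (simp add: field_simps)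
      then show "2 * real n / L - \<beta> \<ge> real n / L" "real n / L > 0" using \<beta> by simp_all
    qed
    have D1: "D1 L t \<ge> 0" unfolding D1_def using L by (intro add_nonneg_nonneg mult_nonneg_nonneg sum_nonneg) auto
    have D2: "D2 L t \<ge> 0" unfolding D2_def using L C0 by simp
    have D3: "D3 L t \<ge> 0" unfolding D3_def using L C0 by (intro mult_nonneg_nonneg add_nonneg_nonneg sum_nonneg) auto
    have "\<bar>k * w t - g * S\<bar> \<le> (D1 L t + D2 L t + D3 L t) * h ^ Suc R * G"
    proof (cases "\<bar>t\<bar> * h \<le> 1 / (64 * L\<^sup>2)")
      case True
      have "\<bar>k - g * S\<bar> \<le> D1 L t * h ^ Suc R * G"
        unfolding k_def g_def S_def h_def D1_def G_def
        by (rule saddle_kernel_near[OF L n \<beta>(1,2) R]) (use True in \<open>simp add: h_def\<close>)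
      moreover have "\<bar>k * w t - k\<bar> \<le> D2 L t * h ^ Suc R * G"
      proof -
        have "1 / (64 * L\<^sup>2) \<le> 1 / (64 * L)"
          using L by (simp add: field_simps power2_eq_square)
        then have "\<bar>t\<bar> * h * L \<le> 1 / (64 * L) * L" using True L by (intro mult_right_mono) auto
        then have Lt: "\<bar>L * (t * h)\<bar> \<le> 1 / 64" using L h by (simp add: abs_mult mult_ac)
        have "1 * 1 \<le> L * L" using L by (intro mult_mono) auto
        then have "1 / (64 * L\<^sup>2) \<le> 1" using L by (simp add: field_simps power2_eq_square)
        then have "\<bar>t\<bar> * h \<le> 1" using True by linarith
        then have "\<bar>t\<bar> \<le> sqrt (real n)" using n1 by (simp add: h_def divide_simps)
        then have "t \<ge> - sqrt (real n)" by linarith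
        from w[OF this] have "\<bar>w t - 1\<bar> \<le> C0 * exp (- (2 * real n / L - \<beta>) * exp (L * (t * h) / 2))"
          by (simp add: h_def)
        \<comment> \<open>Inside the cutoff \<open>exp (L * \<tau> / 2)\<close> is at least
          \<open>1 / 2\<close>, and the rate in front of it is at least
          \<open>n / L\<close>.\<close>
        also have "\<dots> \<le> C0 * exp (- (real n / (2 * L)))"
        proof (intro mult_left_mono C0)
          have "1 / 2 \<le> exp (L * (t * h) / 2)"
            using exp_ge_add_one_self[of "L * (t * h) / 2"] Lt by linarith
          then have "real n / L * (1 / 2) \<le> (2 * real n / L - \<beta>) * exp (L * (t * h) / 2)"
            using c by (intro mult_mono) auto
          then show "exp (- (2 * real n / L - \<beta>) * exp (L * (t * h) / 2)) \<le> exp (- (real n / (2 * L)))"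
            unfolding exp_le_cancel_iff mult_minus_left by (simp add: mult.commute)
        qed
        also have "\<dots> \<le> C0 * (fact (Suc R) / (real n / (2 * L)) ^ Suc R)"
          using c by (intro mult_left_mono C0 exp_minus_le_power) (auto simp: field_simps)
        also have "\<dots> = C0 * fact (Suc R) * 2 ^ Suc R * L ^ Suc R * (1 / real n) ^ Suc R"
          using L n1 by (simp add: power_divide power_mult_distrib field_simps del: fact_Suc power_Suc)
        also have "\<dots> \<le> C0 * fact (Suc R) * 2 ^ Suc R * L ^ Suc R * h ^ Suc R"
        proof (intro mult_left_mono power_mono)
          have "1 / real n = h * h" using n1 by (simp add: h_def)
          also have "\<dots> \<le> h * 1" using h by (intro mult_left_mono) auto
          finally show "1 / real n \<le> h" by simp
        qed (use C0 L n1 in auto)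
        finally have "\<bar>w t - 1\<bar> \<le> \<dots>" .
        then have "k * \<bar>w t - 1\<bar> \<le> (exp 1 * G) * (C0 * fact (Suc R) * 2 ^ Suc R * L ^ Suc R * h ^ Suc R)"
          using k by (intro mult_mono) auto
        moreover have "\<bar>k * w t - k\<bar> = k * \<bar>w t - 1\<bar>"
        proof -
          have "k * w t - k = k * (w t - 1)" by (simp add: algebra_simps)
          then show ?thesis using k by (simp add: abs_mult)
        qed
        ultimately show ?thesis by (simp add: D2_def mult_ac)
      qed
      moreover have "D3 L t * h ^ Suc R * G \<ge> 0" using D3 h G0 by simp
      moreover have "\<bar>k * w t - g * S\<bar> \<le> \<bar>k * w t - k\<bar> + \<bar>k - g * S\<bar>" by linarith
      ultimately show ?thesis unfolding distrib_right by linarith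
    next
      case False
      then have "1 \<le> 64 * L ^ 2 * \<bar>t\<bar> * h" using L by (simp add: field_simps)
      \<comment> \<open>Beyond the cutoff this factor is at least 1, so inserting it is free and
        produces the power of \<open>h\<close> demanded.\<close>
      then have far: "1 \<le> (64 * L ^ 2 * \<bar>t\<bar>) ^ Suc R * h ^ Suc R"
        unfolding power_mult_distrib[symmetric] by (rule one_le_power)
      have "\<bar>k * w t\<bar> \<le> exp 1 * G * (1 + C0)"
      proof (cases "t \<ge> - sqrt (real n)")
        case True
        have "exp (- (2 * real n / L - \<beta>) * exp (L * (t / sqrt (real n)) / 2)) \<le> 1"
          unfolding exp_le_one_iff using c by (intro mult_nonpos_nonneg) auto
        then have "C0 * exp (- (2 * real n / L - \<beta>) * exp (L * (t / sqrt (real n)) / 2)) \<le> C0 * 1"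
          using C0 by (intro mult_left_mono) auto
        then have "\<bar>w t\<bar> \<le> 1 + C0" using w[OF True] by linarith
        then show ?thesis unfolding abs_mult using k G0 by (intro mult_mono) auto
      next
        case False
        then have "t / sqrt (real n) < - 1" using n1 by (simp add: field_simps)
        then have "k = 0" by (simp add: k_def saddle_kernel_def)
        then show ?thesis using G0 C0 by simp
      qed
      moreover have "\<bar>g * S\<bar> \<le> G * (\<Sum>k\<le>R. \<bar>poly (exp_poly \<beta> L k) t\<bar>)"
        unfolding abs_mult
      proof (intro mult_mono)
        have "g \<le> exp (- t\<^sup>2 / 2)" unfolding g_def using L by (intro gauss_le) auto
        also have "\<dots> \<le> G" by (simp add: G_def)
        finally show "\<bar>g\<bar> \<le> G" by (simp add: g_def)
        show "\<bar>S\<bar> \<le> (\<Sum>k\<le>R. \<bar>poly (exp_poly \<beta> L k) t\<bar>)"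
          unfolding S_def truncated_exp_def
        proof (rule order_trans[OF sum_abs sum_mono])
          fix i
          have "\<bar>poly (exp_poly \<beta> L i) t\<bar> * h ^ i \<le> \<bar>poly (exp_poly \<beta> L i) t\<bar> * 1"
            using h by (intro mult_left_mono power_le_one) auto
          then show "\<bar>poly (exp_poly \<beta> L i) t * h ^ i\<bar> \<le> \<bar>poly (exp_poly \<beta> L i) t\<bar>"
            using h by (simp add: abs_mult)
        qed
      qed (use G0 in auto)
      ultimately have "\<bar>k * w t - g * S\<bar> \<le> ((1 + C0) * exp 1 + (\<Sum>k\<le>R. \<bar>poly (exp_poly \<beta> L k) t\<bar>)) * G * 1"
        by (simp add: algebra_simps)
      also have "\<dots> \<le> ((1 + C0) * exp 1 + (\<Sum>k\<le>R. \<bar>poly (exp_poly \<beta> L k) t\<bar>)) * G * ((64 * L ^ 2 * \<bar>t\<bar>) ^ Suc R * h ^ Suc R)"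
        using G0 C0 by (intro mult_left_mono far mult_nonneg_nonneg add_nonneg_nonneg sum_nonneg) auto
      also have "\<dots> = D3 L t * h ^ Suc R * G" by (simp add: D3_def mult_ac)
      also have "\<dots> \<le> (D1 L t + D2 L t + D3 L t) * h ^ Suc R * G"
        using D1 D2 h G0 by (intro mult_right_mono) auto
      finally show ?thesis .
    qed
    also have "\<dots> \<le> C * L ^ A * (1 + \<bar>t\<bar>) ^ A * h ^ Suc R * G"
      using CA(2)[of L t] L h G0 by (intro mult_right_mono) auto
    finally show "\<bar>saddle_kernel \<beta> L n t * w t -
       exp (- (1 + L / 2) * t\<^sup>2 / 2) * truncated_exp \<beta> L R (1 / sqrt (real n)) t\<bar> \<le>
      C * L ^ A * (1 + \<bar>t\<bar>) ^ A * (1 / sqrt (real n)) ^ Suc R * exp (- t\<^sup>2 / 16)"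
      by (simp only: k_def g_def S_def h_def G_def)
  qed
qed

section \<open>Termwise integration\<close>

lemma integrable_poly_gauss:
  "integrable lborel (\<lambda>t :: real. (1 + \<bar>t\<bar>) ^ A * exp (- t\<^sup>2 / 16))"
proof -
  \<comment> \<open>\<open>exp (- t^2 / 16)\<close> is \<open>sqrt (16 * \<pi>)\<close> times the
    normal density of variance 8.\<close>
  have "integrable lborel (\<lambda>t. sqrt (16 * pi) * (\<Sum>k\<le>A. real (A choose k) *
      (normal_density 0 (sqrt 8) t * \<bar>t - 0\<bar> ^ k)))"
    by (intro integrable_mult_right Bochner_Integration.integrable_sum integrable_normal_moment_abs) simp_all
  also have "(\<lambda>t. sqrt (16 * pi) * (\<Sum>k\<le>A. real (A choose k) *
      (normal_density 0 (sqrt 8) t * \<bar>t - 0\<bar> ^ k))) = (\<lambda>t. (1 + \<bar>t\<bar>) ^ A * exp (- t\<^sup>2 / 16))"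
  proof
    fix t :: real
    have "(1 + \<bar>t\<bar>) ^ A = (\<Sum>k\<le>A. real (A choose k) * \<bar>t\<bar> ^ k)"
      using binomial_ring[of "\<bar>t\<bar>" 1 A] by (simp add: add.commute)
    moreover have "sqrt (16 * pi) * normal_density 0 (sqrt 8) t = exp (- t\<^sup>2 / 16)"
      by (simp add: normal_density_def)
    ultimately show "sqrt (16 * pi) * (\<Sum>k\<le>A. real (A choose k) *
        (normal_density 0 (sqrt 8) t * \<bar>t - 0\<bar> ^ k)) = (1 + \<bar>t\<bar>) ^ A * exp (- t\<^sup>2 / 16)"
      by (simp add: sum_distrib_left sum_distrib_right mult_ac)
  qed
  finally show ?thesis .
qed

lemma has_bochner_integral_gauss_moment:
  fixes a :: real
  assumes "a > 0"
  shows "has_bochner_integral lborel (\<lambda>t. exp (- a * t\<^sup>2 / 2) * t ^ m)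
    (sqrt (2 * pi / a) * (if even m then fact m / (2 ^ (m div 2) * fact (m div 2)) / a ^ (m div 2) else 0))"
proof -
  have e: "exp (- a * t\<^sup>2 / 2) = sqrt (2 * pi / a) * normal_density 0 (1 / sqrt a) t" for t
    using assms by (simp add: normal_density_def power_divide real_sqrt_divide mult.commute)
  have "has_bochner_integral lborel (\<lambda>t. normal_density 0 (1 / sqrt a) t * (t - 0) ^ m)
      (if even m then fact m / (2 ^ (m div 2) * fact (m div 2)) / a ^ (m div 2) else 0)"
  proof (cases "even m")
    case True
    then obtain k where "m = 2 * k" by (elim evenE)
    then show ?thesis using normal_moment_even[of "1 / sqrt a" 0 k] assms
      by (simp add: power_divide power_mult_distrib mult_ac)
  next
    case False
    then obtain k where "m = 2 * k + 1" by (elim oddE)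
    then show ?thesis using normal_moment_odd[of "1 / sqrt a" 0 k] assms by simp
  qed
  from has_bochner_integral_mult_right[OF this, of "sqrt (2 * pi / a)"]
  show ?thesis unfolding e by (simp add: mult.assoc)
qed

text \<open>For odd \<open>k\<close> only odd powers of \<open>t\<close> occur, and their moments
  vanish; for even \<open>k\<close> the even moments assemble to \<open>laplace_coeff\<close>. Hence
  the integrated series proceeds in \<open>h^2 = 1 / n\<close>.\<close>

lemma has_bochner_integral_gauss_exp_poly:
  assumes "L > - 2"
  shows "has_bochner_integral lborel (\<lambda>t. exp (- (1 + L / 2) * t\<^sup>2 / 2) * poly (exp_poly \<beta> L k) t)
    (sqrt (2 * pi / (1 + L / 2)) * (if even k then laplace_coeff \<beta> (k div 2) L else 0))"
proof -
  define a where "a = 1 + L / 2"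
  have a: "a > 0" using assms by (simp add: a_def)
  define \<mu> where "\<mu> = (\<lambda>m. if even m then fact m / (2 ^ (m div 2) * fact (m div 2)) / a ^ (m div 2) else 0)"
  have "has_bochner_integral lborel
      (\<lambda>t. \<Sum>m\<le>3 * k. coeff (exp_poly \<beta> L k) m * (exp (- a * t\<^sup>2 / 2) * t ^ m))
      (\<Sum>m\<le>3 * k. coeff (exp_poly \<beta> L k) m * (sqrt (2 * pi / a) * \<mu> m))"
    unfolding \<mu>_def
    by (intro has_bochner_integral_sum has_bochner_integral_mult_right has_bochner_integral_gauss_moment a)
  moreover have "(\<lambda>t. \<Sum>m\<le>3 * k. coeff (exp_poly \<beta> L k) m * (exp (- a * t\<^sup>2 / 2) * t ^ m)) =
      (\<lambda>t. exp (- a * t\<^sup>2 / 2) * poly (exp_poly \<beta> L k) t)"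
    unfolding poly_exp_poly_eq by (simp add: sum_distrib_left mult_ac)
  moreover have "(\<Sum>m\<le>3 * k. coeff (exp_poly \<beta> L k) m * (sqrt (2 * pi / a) * \<mu> m)) =
      sqrt (2 * pi / a) * (\<Sum>m\<le>3 * k. coeff (exp_poly \<beta> L k) m * \<mu> m)"
    by (simp add: sum_distrib_left mult_ac)
  moreover have "(\<Sum>m\<le>3 * k. coeff (exp_poly \<beta> L k) m * \<mu> m) =
      (if even k then laplace_coeff \<beta> (k div 2) L else 0)"
  proof (cases "even k")
    case False
    then have "coeff (exp_poly \<beta> L k) m * \<mu> m = 0" for m
      using coeff_exp_poly_parity[of k m] by (cases "even m") (auto simp: \<mu>_def)
    then show ?thesis using False by (simp only: sum.neutral_const if_False)
  next
    case True
    then obtain j where k: "k = 2 * j" by (elim evenE)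
    have "(\<Sum>m\<le>3 * k. coeff (exp_poly \<beta> L k) m * \<mu> m) =
        (\<Sum>m\<in>(\<lambda>m. 2 * m) ` {..3 * j}. coeff (exp_poly \<beta> L k) m * \<mu> m)"
    proof (rule sum.mono_neutral_right)
      show "\<forall>m\<in>{..3 * k} - (\<lambda>m. 2 * m) ` {..3 * j}. coeff (exp_poly \<beta> L k) m * \<mu> m = 0"
      proof
        fix m assume m: "m \<in> {..3 * k} - (\<lambda>m. 2 * m) ` {..3 * j}"
        have "odd m"
        proof
          assume "even m"
          then obtain i where "m = 2 * i" by (elim evenE)
          then show False using m k by auto
        qed
        then show "coeff (exp_poly \<beta> L k) m * \<mu> m = 0" by (simp add: \<mu>_def)
      qed
    qed (auto simp: k)
    also have "\<dots> = laplace_coeff \<beta> j L"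
      by (subst sum.reindex) (auto simp: inj_on_def laplace_coeff_def k \<mu>_def a_def)
    finally show ?thesis using True k by simp
  qed
  ultimately show ?thesis by (simp add: a_def)
qed

lemma borel_measurable_saddle_kernel [measurable]: "saddle_kernel \<beta> L n \<in> borel_measurable borel"
  unfolding saddle_kernel_def[abs_def] Let_def by measurable

text \<open>Integrability is part of the conclusion because the substitution in the theta integral
  presupposes it. It comes from the comparison itself: the difference from an integrable Gaussian
  expression has an integrable majorant.\<close>

lemma laplace_expansion:
  assumes \<beta>: "0 \<le> \<beta>" "\<beta> \<le> 1" "\<beta> \<in> \<rat>" and C0: "C0 \<ge> 0"
  obtains C A where "C \<ge> 0" "\<And>L n w. L \<ge> 2 \<Longrightarrow> real n \<ge> 8 * L\<^sup>2 \<Longrightarrow> w \<in> borel_measurable borel \<Longrightarrow>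
    (\<And>t. t \<ge> - sqrt (real n) \<Longrightarrow> \<bar>w t - 1\<bar> \<le>
       C0 * exp (- (2 * real n / L - \<beta>) * exp (L * (t / sqrt (real n)) / 2))) \<Longrightarrow>
    integrable lborel (\<lambda>t. saddle_kernel \<beta> L n t * w t) \<and>
    \<bar>sqrt ((1 + L / 2) / (2 * pi)) * (\<integral>t. saddle_kernel \<beta> L n t * w t \<partial>lborel) -
       (\<Sum>j\<le>K. laplace_coeff \<beta> j L / real n ^ j)\<bar> \<le> C * L ^ A / real n ^ Suc K"
proof -
  \<comment> \<open>With this \<open>R\<close> the error \<open>h ^ (R + 1)\<close> is exactly
    \<open>1 / n ^ (K + 1)\<close>.\<close>
  define R where "R = 2 * K + 1"
  have "R \<ge> 1" by (simp add: R_def)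
  then obtain C A where C: "C \<ge> 0" and approx: "\<And>L n w t. L \<ge> 2 \<Longrightarrow> real n \<ge> 8 * L\<^sup>2 \<Longrightarrow>
    (\<And>t. t \<ge> - sqrt (real n) \<Longrightarrow> \<bar>w t - 1\<bar> \<le>
       C0 * exp (- (2 * real n / L - \<beta>) * exp (L * (t / sqrt (real n)) / 2))) \<Longrightarrow>
    \<bar>saddle_kernel \<beta> L n t * w t -
       exp (- (1 + L / 2) * t\<^sup>2 / 2) * truncated_exp \<beta> L R (1 / sqrt (real n)) t\<bar> \<le>
    C * L ^ A * (1 + \<bar>t\<bar>) ^ A * (1 / sqrt (real n)) ^ Suc R * exp (- t\<^sup>2 / 16)"
    using saddle_kernel_approx[OF \<beta> _ C0] by metis
  define I where "I = (LINT t|lborel. (1 + \<bar>t :: real\<bar>) ^ A * exp (- t\<^sup>2 / 16))"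
  have I: "I \<ge> 0" unfolding I_def by (intro integral_nonneg_AE) auto
  show thesis
  proof (rule that[of "C * I" "Suc A"])
    fix L :: real and n :: nat and w :: "real \<Rightarrow> real"
    assume L: "L \<ge> 2" and n: "real n \<ge> 8 * L\<^sup>2" and wm [measurable]: "w \<in> borel_measurable borel"
      and w: "\<And>t. t \<ge> - sqrt (real n) \<Longrightarrow> \<bar>w t - 1\<bar> \<le>
       C0 * exp (- (2 * real n / L - \<beta>) * exp (L * (t / sqrt (real n)) / 2))"
    define a where "a = 1 + L / 2"
    define h where "h = 1 / sqrt (real n)"
    define f where "f = (\<lambda>t. saddle_kernel \<beta> L n t * w t)"
    define g where "g = (\<lambda>t. exp (- (1 + L / 2) * t\<^sup>2 / 2) * truncated_exp \<beta> L R h t)"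
    define B where "B = (\<lambda>t. C * L ^ A * h ^ Suc R * ((1 + \<bar>t\<bar>) ^ A * exp (- t\<^sup>2 / 16)))"
    have "8 * L\<^sup>2 > 0" using L by simp
    then have n0: "real n > 0" using n by linarith
    have h2: "h\<^sup>2 = 1 / real n" by (simp add: h_def power_divide)
    have h: "h > 0" using n0 by (simp add: h_def)
    have a: "a > 0" using L by (simp add: a_def)
    have le: "\<bar>f t - g t\<bar> \<le> B t" for t
      using approx[OF L n w, of t] by (simp add: f_def g_def B_def h_def mult_ac)
    have g: "has_bochner_integral lborel g (\<Sum>k\<le>R. sqrt (2 * pi / a) *
        (if even k then laplace_coeff \<beta> (k div 2) L else 0) * h ^ k)"
    proof -
      have "has_bochner_integral lborel
          (\<lambda>t. \<Sum>k\<le>R. exp (- (1 + L / 2) * t\<^sup>2 / 2) * poly (exp_poly \<beta> L k) t * h ^ k)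
          (\<Sum>k\<le>R. sqrt (2 * pi / a) * (if even k then laplace_coeff \<beta> (k div 2) L else 0) * h ^ k)"
        unfolding a_def using L
        by (intro has_bochner_integral_sum has_bochner_integral_mult_left has_bochner_integral_gauss_exp_poly) auto
      then show ?thesis by (simp add: g_def truncated_exp_def sum_distrib_left mult.assoc)
    qed
    have gsum: "(\<Sum>k\<le>R. sqrt (2 * pi / a) * (if even k then laplace_coeff \<beta> (k div 2) L else 0) * h ^ k) =
        sqrt (2 * pi / a) * (\<Sum>j\<le>K. laplace_coeff \<beta> j L / real n ^ j)"
    proof -
      have "(\<Sum>k\<le>2 * K + 1. (if even k then laplace_coeff \<beta> (k div 2) L else 0) * h ^ k) =
          (\<Sum>j\<le>K. laplace_coeff \<beta> j L / real n ^ j)"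
      proof (induction K)
        case (Suc K)
        have "h ^ (2 * Suc K) = 1 / real n ^ Suc K" unfolding power_mult h2 by (simp add: power_divide)
        with Suc show ?case by simp
      qed simp
      then show ?thesis by (simp only: R_def mult.assoc sum_distrib_left[symmetric])
    qed
    have Bi: "integrable lborel B" unfolding B_def by (intro integrable_mult_right integrable_poly_gauss)
    have gi: "integrable lborel g" using g by (rule integrable.intros)
    have fm: "f \<in> borel_measurable lborel" unfolding f_def by measurable
    have dm: "(\<lambda>t. f t - g t) \<in> borel_measurable lborel" using fm gi by measurable
    have di: "integrable lborel (\<lambda>t. f t - g t)"
    proof (rule Bochner_Integration.integrable_bound[OF Bi dm], rule AE_I2)
      fix t show "norm (f t - g t) \<le> norm (B t)" using le[of t] by simp
    qed
    have fi: "integrable lborel f" using Bochner_Integration.integrable_add[OF di gi] by simp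
    have "\<bar>(\<integral>t. f t \<partial>lborel) - (\<integral>t. g t \<partial>lborel)\<bar> = \<bar>\<integral>t. f t - g t \<partial>lborel\<bar>"
      using fi gi by simp
    also have "\<dots> \<le> (\<integral>t. \<bar>f t - g t\<bar> \<partial>lborel)" using integral_norm_bound[of lborel "\<lambda>t. f t - g t"] by simp
    also have "\<dots> \<le> (\<integral>t. B t \<partial>lborel)" using di Bi le by (intro integral_mono) auto
    also have "\<dots> = C * L ^ A * h ^ Suc R * I" by (simp add: B_def I_def)
    finally have 1: "\<bar>(\<integral>t. f t \<partial>lborel) - (\<integral>t. g t \<partial>lborel)\<bar> \<le> C * L ^ A * h ^ Suc R * I" .
    define s where "s = sqrt (a / (2 * pi))"
    have s: "s > 0" using a by (simp add: s_def)
    have "s * sqrt (2 * pi / a) = 1" using a by (simp add: s_def flip: real_sqrt_mult)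
    then have 2: "s * (\<integral>t. g t \<partial>lborel) = (\<Sum>j\<le>K. laplace_coeff \<beta> j L / real n ^ j)"
      unfolding has_bochner_integral_integral_eq[OF g] gsum by (simp add: mult.assoc[symmetric])
    \<comment> \<open>The normalising factor costs one more power of \<open>L\<close>, hence the
      exponent \<open>Suc A\<close>.\<close>
    have sL: "s \<le> L"
    proof -
      have "a / (2 * pi) \<le> a / 1" using a pi_ge_two by (intro divide_left_mono) auto
      also have "\<dots> \<le> L * 1" using L by (simp add: a_def)
      also have "\<dots> \<le> L * L" using L by (intro mult_left_mono) auto
      finally show ?thesis unfolding s_def using L by (intro real_le_lsqrt) (auto simp: power2_eq_square)
    qed
    have "\<bar>s * (\<integral>t. f t \<partial>lborel) - (\<Sum>j\<le>K. laplace_coeff \<beta> j L / real n ^ j)\<bar> =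
        s * \<bar>(\<integral>t. f t \<partial>lborel) - (\<integral>t. g t \<partial>lborel)\<bar>"
      unfolding 2[symmetric] using s by (simp add: abs_mult flip: right_diff_distrib)
    also have "\<dots> \<le> L * (C * L ^ A * h ^ Suc R * I)" using 1 sL s by (intro mult_mono) auto
    also have "h ^ Suc R = 1 / real n ^ Suc K"
    proof -
      have "h ^ Suc R = (h\<^sup>2) ^ Suc K" unfolding R_def power_mult[symmetric] by simp
      then show ?thesis by (simp only: h2 power_divide power_one)
    qed
    also have "L * (C * L ^ A * (1 / real n ^ Suc K) * I) = C * I * L ^ Suc A / real n ^ Suc K" by simp
    finally show "integrable lborel (\<lambda>t. saddle_kernel \<beta> L n t * w t) \<and>
      \<bar>sqrt ((1 + L / 2) / (2 * pi)) * (\<integral>t. saddle_kernel \<beta> L n t * w t \<partial>lborel) -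
       (\<Sum>j\<le>K. laplace_coeff \<beta> j L / real n ^ j)\<bar> \<le> C * I * L ^ Suc A / real n ^ Suc K"
      using fi by (simp add: f_def s_def a_def)
  qed (use C I in auto)
qed

section \<open>Reduction of the theta integral\<close>

text \<open>Periodicity leaves only the values on one period. The bound enters the final estimate
  only through the constant \<open>C0\<close>.\<close>

lemma dirichlet_character_bounded:
  assumes "dirichlet_character N chi"
  obtains B where "B \<ge> 0" "\<And>n. norm (chi n) \<le> B"
proof -
  have N: "int N > 0" and per: "\<And>n. chi (n + int N) = chi n"
    using assms by (auto simp: dirichlet_character_def)
  have pern: "chi (n + int k * int N) = chi n" for n k
  proof (induction k)
    case (Suc k)
    have "n + int (Suc k) * int N = (n + int k * int N) + int N" by (simp add: algebra_simps)
    then show ?case using per Suc by metis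
  qed simp
  have perz: "chi n = chi (n mod int N)" for n
  proof (cases "n \<ge> 0")
    case True
    then have "n = n mod int N + int (nat (n div int N)) * int N"
      using N by (simp add: pos_imp_zdiv_nonneg_iff)
    then show ?thesis using pern by metis
  next
    case False
    then have "n div int N \<le> 0" using N by (simp add: div_nonpos_pos_le0)
    then have "n mod int N = n + int (nat (- (n div int N))) * int N"
      by (simp add: minus_mult_div_eq_mod[symmetric] mult.commute)
    then show ?thesis using pern by metis
  qed
  let ?S = "(\<lambda>n. norm (chi n)) ` {0..<int N}"
  have "norm (chi n) \<le> Max (insert 0 ?S)" for n
  proof (rule Max_ge)
    have "n mod int N \<in> {0..<int N}" using N by simp
    then show "norm (chi n) \<in> insert 0 ?S" by (subst perz) blast
  qed simp
  moreover have "Max (insert 0 ?S) \<ge> 0" by (rule Max_ge) auto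
  ultimately show thesis using that by blast
qed

text \<open>For \<open>k \<ge> 1\<close> one has \<open>(k + 1)^2 \<ge> k + 2\<close>. Two units
  give the decay \<open>exp (- 2 * \<pi> * y)\<close>, the remaining \<open>k\<close> a geometric
  factor of ratio \<open>q = exp (- \<pi> / N)\<close> because \<open>y \<ge> 1 / N\<close>, and the
  sum of \<open>(k + 1) * q^k\<close> is \<open>1 / (1 - q)^2\<close>.\<close>

lemma theta_char_leading_term:
  assumes N: "N > 1" and chi: "primitive_dirichlet_character N chi" "real_character chi"
  obtains \<Theta> :: "real \<Rightarrow> real" and C0 :: real where
    "\<Theta> \<in> borel_measurable borel" "C0 \<ge> 0"
    "\<And>y. y \<ge> 1 / real N \<Longrightarrow> theta_char chi (\<i> * complex_of_real y) = complex_of_real (2 * \<Theta> y)"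
    "\<And>y. y \<ge> 1 / real N \<Longrightarrow> \<bar>\<Theta> y * exp (pi * y) - 1\<bar> \<le> C0 * exp (- pi * y)"
proof -
  have dc: "dirichlet_character N chi" using chi(1) by (simp add: primitive_dirichlet_character_def)
  then obtain B where B: "B \<ge> 0" "\<And>n. norm (chi n) \<le> B" using dirichlet_character_bounded by blast
  have mult: "chi (m * n) = chi m * chi n" and nz: "chi n \<noteq> 0 \<longleftrightarrow> coprime n (int N)" for m n
    using dc by (simp_all add: dirichlet_character_def)
  \<comment> \<open>\<open>N > 1\<close> makes 0 a non-unit, which removes the constant term of the
    theta series.\<close>
  have "chi 0 = 0" "chi 1 \<noteq> 0" using nz[of 0] nz[of 1] N by auto
  moreover have "chi 1 * chi 1 = chi 1" using mult[of 1 1] by simp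
  ultimately have chi01: "chi 0 = 0" "chi 1 = 1" by auto
  define r where "r = (\<lambda>n. Re (chi n))"
  have chir: "chi n = complex_of_real (r n)" for n
    using chi(2) by (simp add: r_def real_character_def)
  have rB: "\<bar>r n\<bar> \<le> B" for n using B(2)[of n] unfolding chir by simp
  have r1: "r 1 = 1" using chi01 by (simp add: r_def)
  define p where "p = parity_exponent chi"
  have p: "p \<le> 1" by (simp add: p_def parity_exponent_def)
  define T where "T = (\<lambda>k y. r (int (Suc k)) * real (Suc k) ^ p * exp (- pi * real (Suc k) ^ 2 * y))"
  define \<Theta> where "\<Theta> = (\<lambda>y. \<Sum>k. T k y)"
  define q where "q = exp (- pi / real N)"
  have q: "0 < q" "q < 1" using N by (simp_all add: q_def)
  have gs: "(\<lambda>k. real (Suc k) * q ^ k) sums (1 / (1 - q)\<^sup>2)"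
    using geometric_deriv_sums[of q] q by simp
  define D where "D = 1 / (1 - q)\<^sup>2"
  have Tb: "\<bar>T k y\<bar> \<le> B * exp (- 2 * pi * y) * (real (Suc k) * q ^ k)"
    if y: "y \<ge> 1 / real N" and k: "k \<ge> 1" for k y
  proof -
    have y0: "y > 0" using y N by (meson less_le_trans of_nat_0_less_iff zero_less_divide_1_iff less_trans zero_less_one)
    have "1 \<le> real k" "0 \<le> real k * real k" using k by auto
    moreover have "real (Suc k) ^ 2 = 1 + 2 * real k + real k * real k"
      by (simp add: power2_eq_square algebra_simps)
    ultimately have "2 + real k \<le> real (Suc k) ^ 2" by linarith
    then have "pi * y * (2 + real k) \<le> pi * y * real (Suc k) ^ 2"
      using y0 by (intro mult_left_mono) auto
    moreover have "pi / real N * real k \<le> pi * y * real k"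
    proof (intro mult_right_mono)
      show "pi / real N \<le> pi * y" using mult_left_mono[OF y, of pi] by simp
    qed simp
    ultimately have "- pi * real (Suc k) ^ 2 * y \<le> - 2 * pi * y + real k * (- pi / real N)"
      by (simp add: algebra_simps)
    then have "exp (- pi * real (Suc k) ^ 2 * y) \<le> exp (- 2 * pi * y + real k * (- pi / real N))" by simp
    also have "\<dots> = exp (- 2 * pi * y) * q ^ k" by (simp only: exp_add exp_of_nat_mult q_def)
    finally have e: "exp (- pi * real (Suc k) ^ 2 * y) \<le> exp (- 2 * pi * y) * q ^ k" .
    have "real (Suc k) ^ p \<le> real (Suc k) ^ 1" using p by (intro power_increasing) auto
    then have "real (Suc k) ^ p \<le> real (Suc k)" by simp
    then have "\<bar>T k y\<bar> \<le> B * real (Suc k) * (exp (- 2 * pi * y) * q ^ k)"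
      unfolding T_def abs_mult using e B rB by (intro mult_mono) auto
    then show ?thesis by (simp add: mult_ac)
  qed
  have T0: "T 0 y = exp (- pi * y)" for y using r1 by (simp add: T_def)
  have sumT: "summable (\<lambda>k. T k y)" if "y \<ge> 1 / real N" for y
  proof (rule summable_comparison_test[OF _ sums_summable[OF sums_mult[OF gs]]])
    show "\<exists>N. \<forall>k\<ge>N. norm (T k y) \<le> B * exp (- 2 * pi * y) * (real (Suc k) * q ^ k)"
      using Tb[OF that] by auto
  qed
  show thesis
  proof (rule that[of \<Theta> "B * D"])
    show "\<Theta> \<in> borel_measurable borel" unfolding \<Theta>_def T_def by measurable
    show "B * D \<ge> 0" using B by (simp add: D_def)
  next
    fix y assume y: "y \<ge> 1 / real N"
    have ex: "complex_of_real pi * \<i> * (of_nat (Suc k))\<^sup>2 * (\<i> * complex_of_real y) =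
        complex_of_real (- pi * real (Suc k) ^ 2 * y)" for k
    proof -
      have "complex_of_real pi * \<i> * (of_nat (Suc k))\<^sup>2 * (\<i> * complex_of_real y) =
          (\<i> * \<i>) * (complex_of_real pi * (of_nat (Suc k))\<^sup>2 * complex_of_real y)"
        by (simp only: mult_ac)
      then show ?thesis by simp
    qed
    have "chi (int (Suc k)) * of_nat (Suc k) ^ p *
        exp (complex_of_real pi * \<i> * (of_nat (Suc k))\<^sup>2 * (\<i> * complex_of_real y)) =
        complex_of_real (T k y)" for k
      unfolding ex exp_of_real chir T_def by simp
    then have "theta_char chi (\<i> * complex_of_real y) = 2 * (\<Sum>k. complex_of_real (T k y))"
      unfolding theta_char_def Let_def chi01 add_0_left p_def by simp
    also have "(\<Sum>k. complex_of_real (T k y)) = complex_of_real (\<Theta> y)"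
      unfolding \<Theta>_def by (rule suminf_of_real[OF sumT[OF y], symmetric])
    finally show "theta_char chi (\<i> * complex_of_real y) = complex_of_real (2 * \<Theta> y)" by simp
    have split: "\<Theta> y = exp (- pi * y) + (\<Sum>k. T (Suc k) y)"
      unfolding \<Theta>_def using suminf_split_head[OF sumT[OF y]] T0 by simp
    define u where "u = (\<lambda>k. B * exp (- 2 * pi * y) * (real (Suc k) * q ^ k))"
    have su: "summable u" unfolding u_def by (rule sums_summable[OF sums_mult[OF gs]])
    then have su': "summable (\<lambda>k. u (Suc k))" by (subst summable_Suc_iff)
    have "norm (\<Sum>k. T (Suc k) y) \<le> (\<Sum>k. u (Suc k))"
      by (rule norm_suminf_le[OF _ su']) (unfold u_def real_norm_def, rule Tb[OF y], simp)
    also have "\<dots> \<le> (\<Sum>k. u k)"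
      using suminf_split_head[OF su] B(1) by (simp add: u_def)
    also have "\<dots> = B * exp (- 2 * pi * y) * D"
      unfolding D_def u_def by (rule sums_unique[symmetric, OF sums_mult[OF gs]])
    finally have "\<bar>\<Sum>k. T (Suc k) y\<bar> * exp (pi * y) \<le> B * exp (- 2 * pi * y) * D * exp (pi * y)"
      by (intro mult_right_mono) auto
    also have "\<dots> = B * D * (exp (- 2 * pi * y) * exp (pi * y))" by simp
    also have "exp (- 2 * pi * y) * exp (pi * y) = exp (- pi * y)" by (simp flip: exp_add)
    finally have *: "\<bar>\<Sum>k. T (Suc k) y\<bar> * exp (pi * y) \<le> B * D * exp (- pi * y)" .
    have "\<Theta> y * exp (pi * y) - 1 = (\<Sum>k. T (Suc k) y) * exp (pi * y)"
      unfolding split distrib_right by (simp flip: exp_add)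
    then show "\<bar>\<Theta> y * exp (pi * y) - 1\<bar> \<le> B * D * exp (- pi * y)"
      using * by (simp add: abs_mult)
  qed
qed

text \<open>The map \<open>g\<close> is \<open>log (N^2) + 2 log y = L * (1 + \<tau>)\<close> solved
  for \<open>y\<close>. In \<open>w\<close> the theta sum is divided by its leading exponential, so
  the kernel itself carries \<open>exp (- \<pi> * y)\<close>.\<close>

lemma F_char_eq:
  fixes \<Theta> :: "real \<Rightarrow> real" and L :: real
  assumes N: "N > 1" and n: "n \<ge> 1"
    and \<nu>: "\<nu> = real (parity_exponent chi)" and \<beta>: "\<beta> = 3 / 4 - \<nu> / 2"
    and saddle: "is_saddle N \<nu> n L"
    and meas [measurable]: "\<Theta> \<in> borel_measurable borel"
    and theta: "\<And>y. y \<ge> 1 / real N \<Longrightarrow> theta_char chi (\<i> * complex_of_real y) = complex_of_real (2 * \<Theta> y)"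
  defines "g \<equiv> \<lambda>t. exp (L * (1 + t / sqrt (real n)) / 2) / real N"
  defines "w \<equiv> \<lambda>t. \<Theta> (g t) * exp (pi * g t)"
  assumes int: "integrable lborel (\<lambda>t. saddle_kernel \<beta> L n t * w t)"
  shows "F_char N chi n = complex_of_real ((1 + (- 1) ^ n) / 2 ^ (2 * n + 1) * (L ^ (n + 1) / sqrt (real n)) *
    exp ((1 - \<beta>) * L / 2 - (2 * real n / L - \<beta>)) * (\<integral>t. saddle_kernel \<beta> L n t * w t \<partial>lborel))"
proof -
  define \<alpha> where "\<alpha> = 1 / 4 + \<nu> / 2"
  have \<alpha>: "1 - \<beta> = \<alpha>" by (simp add: \<alpha>_def \<beta>)
  have L: "L > 0" using saddle by (simp add: is_saddle_def)
  have N0: "real N > 0" using N by simp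
  define c where "c = (1 + (- 1) ^ n :: real)"
  define f where "f = (\<lambda>y. 2 * \<Theta> y * ((real N * y) powr \<alpha> * c * (ln (real N ^ 2) + 2 * ln y) ^ n / y))"
  define h where "h = 1 / sqrt (real n)"
  define S where "S = {- sqrt (real n)..}"
  define g' where "g' = (\<lambda>t. L * h / 2 * g t)"
  define y0 where "y0 = exp (L / 2) / real N"
  have h: "h > 0" using n by (simp add: h_def)
  have g_pos: "g t > 0" for t using N0 by (simp add: g_def)
  \<comment> \<open>\<open>y0\<close> is the position of the saddle in \<open>y\<close>; this is the
    saddle equation solved for \<open>\<pi> * y0\<close>.\<close>
  have y0: "2 * real n / L - \<beta> = pi * y0"
  proof -
    have "exp ((L - ln (real N ^ 2)) / 2) = y0"
      using N0 by (simp add: y0_def diff_divide_distrib exp_diff ln_realpow)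
    then show ?thesis using saddle L unfolding is_saddle_def \<beta> by (simp add: field_simps)
  qed
  have g_eq: "g t = y0 * exp (L * (t * h) / 2)" for t
    by (simp add: g_def y0_def h_def distrib_left add_divide_distrib exp_add)
  have dg: "(g has_real_derivative g' t) (at t within S)" for t
    unfolding g_eq[abs_def] g'_def by (auto intro!: derivative_eq_intros)
  have inj: "inj_on g S"
    using L h N0 by (auto simp: inj_on_def g_def h_def)
  have im: "g ` S = {1 / real N..}"
  proof (intro equalityI subsetI)
    fix y assume "y \<in> g ` S"
    then obtain t where t: "t \<ge> - sqrt (real n)" "y = g t" by (auto simp: S_def)
    have "t / sqrt (real n) \<ge> - 1" using t n by (simp add: field_simps)
    then have "L * (1 + t / sqrt (real n)) / 2 \<ge> 0" using L by simp
    then show "y \<in> {1 / real N..}" using N0 t by (simp add: g_def divide_right_mono)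
  next
    fix y assume "y \<in> {1 / real N..}"
    then have y: "real N * y \<ge> 1" using N0 by (simp add: field_simps)
    define t where "t = sqrt (real n) * (2 * ln (real N * y) / L - 1)"
    have "sqrt (real n) * (- 1) \<le> t" unfolding t_def using L y by (intro mult_left_mono) auto
    moreover have "t / sqrt (real n) = 2 * ln (real N * y) / L - 1" using n by (simp add: t_def)
    then have "g t = y" unfolding g_def using L y N0 by simp
    ultimately show "y \<in> g ` S" by (auto simp: S_def)
  qed
  \<comment> \<open>The Jacobian is \<open>L * h / 2 * y\<close>: its \<open>y\<close> cancels the
    \<open>1 / y\<close> of the integrand, and its \<open>1 / 2\<close> the factor 2 in front of the
    theta sum. The exponential on the right collects the values at \<open>t = 0\<close>.\<close>
  have key: "\<bar>g' t\<bar> * f (g t) = c * L ^ (n + 1) * h * exp (\<alpha> * L / 2 - pi * y0) * (saddle_kernel \<beta> L n t * w t)"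
    if t: "t \<in> S" for t
  proof -
    define \<tau> where "\<tau> = t * h"
    have \<tau>: "\<tau> \<ge> - 1" using t n by (simp add: \<tau>_def h_def S_def field_simps)
    have Ng: "real N * g t = exp (L * (1 + \<tau>) / 2)" using N0 by (simp add: g_def \<tau>_def h_def)
    have lg: "ln (real N ^ 2) + 2 * ln (g t) = L * (1 + \<tau>)"
    proof -
      have "ln (real N ^ 2) + 2 * ln (g t) = 2 * ln (real N * g t)"
        using N0 g_pos[of t] by (simp add: ln_mult ln_realpow)
      then show ?thesis unfolding Ng by simp
    qed
    have k: "saddle_kernel \<beta> L n t = (1 + \<tau>) ^ n * exp (- (pi * y0) * (exp (L * \<tau> / 2) - 1) + \<alpha> * L * \<tau> / 2)"
      using \<tau> unfolding saddle_kernel_def Let_def y0 \<alpha> by (simp add: \<tau>_def h_def)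
    have "\<bar>g' t\<bar> * f (g t) = L * h * \<Theta> (g t) * exp (\<alpha> * (L * (1 + \<tau>) / 2)) * c * (L ^ n * (1 + \<tau>) ^ n)"
      unfolding f_def g'_def lg Ng using L h g_pos[of t]
      by (simp add: abs_mult powr_def power_mult_distrib mult_ac)
    moreover have "exp (\<alpha> * L / 2 - pi * y0) * (saddle_kernel \<beta> L n t * w t) =
        (1 + \<tau>) ^ n * exp (\<alpha> * (L * (1 + \<tau>) / 2)) * \<Theta> (g t)"
    proof -
      have E: "exp (\<alpha> * L / 2 - pi * y0) * (exp (- (pi * y0) * (exp (L * \<tau> / 2) - 1) + \<alpha> * L * \<tau> / 2) * exp (pi * g t)) =
          exp (\<alpha> * (L * (1 + \<tau>) / 2))"
        unfolding g_eq exp_add[symmetric] by (rule arg_cong[of _ _ exp]) (simp add: \<tau>_def algebra_simps)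
      show ?thesis unfolding k w_def E[symmetric] by (simp only: mult_ac)
    qed
    ultimately show ?thesis by (simp add: mult_ac)
  qed
  define K where "K = c * L ^ (n + 1) * h * exp (\<alpha> * L / 2 - pi * y0)"
  have gm [measurable]: "g \<in> borel_measurable borel" unfolding g_def by measurable
  have S_meas [measurable]: "S \<in> sets borel" by (simp add: S_def)
  have wm [measurable]: "w \<in> borel_measurable borel" unfolding w_def by measurable
  have fm [measurable]: "f \<in> borel_measurable borel" unfolding f_def by measurable
  have supp: "indicator S t *\<^sub>R (\<bar>g' t\<bar> * f (g t)) = K * (saddle_kernel \<beta> L n t * w t)" for t
  proof (cases "t \<in> S")
    case True
    then show ?thesis using key[OF True] by (simp add: K_def)
  next
    case False
    then have "t / sqrt (real n) < - 1" using n by (simp add: S_def field_simps)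
    then show ?thesis using False by (simp add: saddle_kernel_def)
  qed
  have si: "set_integrable lborel S (\<lambda>t. \<bar>g' t\<bar> * f (g t))"
    unfolding set_integrable_def supp by (intro integrable_mult_right int)
  \<comment> \<open>Absolute integrability refers to Lebesgue measure; by Borel measurability it can
    be exchanged with integrability over \<open>lborel\<close>, here and again after the change of
    variables.\<close>
  have "(\<lambda>t. \<bar>g' t\<bar> * f (g t)) absolutely_integrable_on S"
    using si unfolding set_integrable_def g'_def
    by (subst integrable_completion) (measurable)
  moreover have "integral S (\<lambda>t. \<bar>g' t\<bar> * f (g t)) = K * (\<integral>t. saddle_kernel \<beta> L n t * w t \<partial>lborel)"
    using set_borel_integral_eq_integral(2)[OF si] unfolding set_lebesgue_integral_def supp by simp
  moreover have "S \<in> sets lebesgue" by (simp add: S_def)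
  ultimately have cv: "f absolutely_integrable_on {1 / real N..}"
      "integral {1 / real N..} f = K * (\<integral>t. saddle_kernel \<beta> L n t * w t \<partial>lborel)"
    using has_absolute_integral_change_of_variables_1'[of S g g' f] dg inj im by metis+
  have si2: "set_integrable lborel {1 / real N..} f"
    using cv(1) unfolding set_integrable_def by (subst (asm) integrable_completion) measurable
  have F: "F_char N chi n = 1 / 2 ^ (2 * n + 1) * complex_of_real (LINT y:{1 / real N..}|lborel. f y)"
  proof -
    have "(LINT y:{1 / real N..}|lborel. theta_char chi (\<i> * complex_of_real y) *
        complex_of_real ((real N * y) powr \<alpha> * c * (ln (real N ^ 2) + 2 * ln y) ^ n / y)) =
        (LINT y:{1 / real N..}|lborel. complex_of_real (f y))"
      by (intro set_lebesgue_integral_cong) (auto simp: theta f_def)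
    also have "\<dots> = complex_of_real (LINT y:{1 / real N..}|lborel. f y)"
      unfolding set_lebesgue_integral_def scaleR_conv_of_real of_real_mult[symmetric] integral_complex_of_real
      by simp
    finally show ?thesis by (simp add: F_char_def Let_def \<alpha>_def c_def \<nu>)
  qed
  also have "(LINT y:{1 / real N..}|lborel. f y) = K * (\<integral>t. saddle_kernel \<beta> L n t * w t \<partial>lborel)"
    using set_borel_integral_eq_integral(2)[OF si2] cv(2) by simp
  finally show ?thesis unfolding K_def c_def h_def y0 \<alpha> by simp
qed

section \<open>The saddle point\<close>

lemma is_saddle_iff:
  "\<beta> = 3 / 4 - \<nu> / 2 \<Longrightarrow> is_saddle N \<nu> n x \<longleftrightarrow>
     x > 0 \<and> real n = 1 / 2 * (pi * exp ((x - ln (real N ^ 2)) / 2) + \<beta>) * x"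
proof -
  assume "\<beta> = 3 / 4 - \<nu> / 2"
  then have "e + 3 / 4 - \<nu> / 2 = e + \<beta>" for e by simp
  then show ?thesis by (simp only: is_saddle_def)
qed

lemma saddle_equation_strict_mono:
  fixes \<beta> c x y :: real
  assumes "\<beta> > 0" "0 \<le> x" "x < y"
  shows "1 / 2 * (pi * exp ((x - c) / 2) + \<beta>) * x < 1 / 2 * (pi * exp ((y - c) / 2) + \<beta>) * y"
proof (rule mult_le_less_imp_less)
  show "1 / 2 * (pi * exp ((x - c) / 2) + \<beta>) \<le> 1 / 2 * (pi * exp ((y - c) / 2) + \<beta>)"
    using assms by simp
  show "0 < 1 / 2 * (pi * exp ((x - c) / 2) + \<beta>)"
    using assms by (intro mult_pos_pos add_pos_pos) auto
qed (use assms in auto)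

lemma ex1_saddle:
  assumes "\<nu> \<le> 1" "n \<ge> 1"
  shows "\<exists>!x. is_saddle N \<nu> n x"
proof -
  define \<beta> where "\<beta> = 3 / 4 - \<nu> / 2"
  define c where "c = ln (real N ^ 2)"
  define G where "G = (\<lambda>x. 1 / 2 * (pi * exp ((x - c) / 2) + \<beta>) * x)"
  have \<beta>: "\<beta> > 0" using assms by (simp add: \<beta>_def)
  have iff: "is_saddle N \<nu> n x \<longleftrightarrow> x > 0 \<and> real n = G x" for x
    by (simp add: is_saddle_iff[OF \<beta>_def] G_def c_def)
  have mono: "G x < G y" if "0 \<le> x" "x < y" for x y
    unfolding G_def using saddle_equation_strict_mono[OF \<beta> that] .
  \<comment> \<open>Chosen so that \<open>\<beta> * b / 2 = n\<close>: the linear part of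
    \<open>G\<close> alone already reaches \<open>n\<close> at \<open>b\<close>.\<close>
  define b where "b = 2 * real n / \<beta>"
  have "1 / 2 * \<beta> * b \<le> G b" unfolding G_def b_def using \<beta>
    by (intro mult_right_mono mult_left_mono) auto
  then have "real n \<le> G b" using \<beta> by (simp add: b_def)
  moreover have "G 0 \<le> real n" by (simp add: G_def)
  moreover have "0 \<le> b" using \<beta> by (simp add: b_def)
  moreover have "continuous_on {0..b} G" unfolding G_def by (intro continuous_intros) auto
  ultimately obtain x where x: "0 \<le> x" "x \<le> b" "G x = real n" using IVT'[of G 0 "real n" b] by blast
  have "x \<noteq> 0" using x assms by (auto simp: G_def)
  show ?thesis
  proof (rule ex1I[of _ x])
    show "is_saddle N \<nu> n x" using x \<open>x \<noteq> 0\<close> by (simp add: iff)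
    fix y assume "is_saddle N \<nu> n y"
    then have y: "y > 0" "G y = G x" using x by (auto simp: iff)
    then show "y = x" using mono[of x y] mono[of y x] x by (cases x y rule: linorder_cases) auto
  qed
qed

lemma is_saddle_saddle: "\<nu> \<le> 1 \<Longrightarrow> n \<ge> 1 \<Longrightarrow> is_saddle N \<nu> n (saddle N \<nu> n)"
  unfolding saddle_def by (rule theI'[OF ex1_saddle])

lemma filterlim_saddle:
  assumes "\<nu> \<le> 1"
  shows "filterlim (saddle N \<nu>) at_top at_top"
  unfolding filterlim_at_top_gt[of _ _ 0]
proof safe
  fix B :: real assume B: "B > 0"
  define \<beta> where "\<beta> = 3 / 4 - \<nu> / 2"
  define G where "G = (\<lambda>x. 1 / 2 * (pi * exp ((x - ln (real N ^ 2)) / 2) + \<beta>) * x)"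
  have \<beta>: "\<beta> > 0" using assms by (simp add: \<beta>_def)
  have "eventually (\<lambda>n. real n > G B) at_top" by real_asymp
  then show "eventually (\<lambda>n. saddle N \<nu> n \<ge> B) at_top"
    using eventually_ge_at_top[of 1]
  proof eventually_elim
    case (elim n)
    have s: "saddle N \<nu> n > 0" "real n = G (saddle N \<nu> n)"
      using is_saddle_saddle[OF assms elim(2), of N] by (auto simp: is_saddle_iff[OF \<beta>_def] G_def)
    show ?case
    proof (rule ccontr)
      assume "\<not> B \<le> saddle N \<nu> n"
      then have "G (saddle N \<nu> n) < G B"
        unfolding G_def using s by (intro saddle_equation_strict_mono \<beta>) auto
      then show False using elim s by simp
    qed
  qed
qed

text \<open>Proved with \<open>L\<close> as the free variable: by the saddle equation
  \<open>n\<close> is an explicit function \<open>G\<close> of it, the claim becomes one about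
  elementary functions at infinity, and composition with \<open>saddle\<close> returns to
  \<open>n\<close>. Nothing has to be inverted.\<close>

lemma saddle_asymp_equiv:
  assumes "\<nu> \<le> 1" "N > 1"
  shows "asymp_equiv (saddle N \<nu>) at_top (\<lambda>n. 2 * ln (real n * real N / ln (real n * real N)))"
proof -
  define \<beta> where "\<beta> = 3 / 4 - \<nu> / 2"
  define M where "M = real N"
  have M: "M > 0" using assms by (simp add: M_def)
  have \<beta>: "\<beta> > 0" using assms by (simp add: \<beta>_def)
  define G where "G = (\<lambda>x. 1 / 2 * (pi * exp ((x - ln (M ^ 2)) / 2) + \<beta>) * x)"
  have "(\<lambda>x. x) \<sim>[at_top] (\<lambda>x. 2 * ln (G x * M / ln (G x * M)))"
    unfolding G_def using M \<beta> by real_asymp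
  then have "(\<lambda>n. saddle N \<nu> n) \<sim>[at_top] (\<lambda>n. 2 * ln (G (saddle N \<nu> n) * M / ln (G (saddle N \<nu> n) * M)))"
    by (rule asymp_equiv_compose'[OF _ filterlim_saddle[OF assms(1)]])
  also have "eventually (\<lambda>n. 2 * ln (G (saddle N \<nu> n) * M / ln (G (saddle N \<nu> n) * M)) =
      2 * ln (real n * real N / ln (real n * real N))) at_top"
    using eventually_ge_at_top[of 1]
  proof eventually_elim
    case (elim n)
    have "real n = G (saddle N \<nu> n)"
      using is_saddle_saddle[OF assms(1) elim, of N] by (auto simp: is_saddle_iff[OF \<beta>_def] G_def M_def)
    then show ?case by (simp add: M_def)
  qed
  finally show ?thesis .
qed

text \<open>\<open>n\<close> is at least a positive constant times \<open>exp (L / 2) * L\<close>,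
  so every power of \<open>L\<close> is negligible against \<open>n\<close>. All polynomial losses
  in \<open>L\<close> are repaid here.\<close>

lemma saddle_power_bound:
  assumes "\<nu> \<le> 1" "N > 1"
  shows "(\<lambda>n. saddle N \<nu> n ^ A / real n) \<longlonglongrightarrow> 0"
proof -
  define M where "M = real N"
  have M: "M > 0" using assms by (simp add: M_def)
  have "((\<lambda>x :: real. x ^ A / (1 / 2 * (pi * exp ((x - ln (M ^ 2)) / 2)) * x)) \<longlongrightarrow> 0) at_top"
    using M by real_asymp
  then have lim: "(\<lambda>n. saddle N \<nu> n ^ A / (1 / 2 * (pi * exp ((saddle N \<nu> n - ln (M ^ 2)) / 2)) * saddle N \<nu> n)) \<longlonglongrightarrow> 0"
    by (rule filterlim_compose[OF _ filterlim_saddle[OF assms(1)]])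
  show ?thesis
  proof (rule Lim_null_comparison[OF _ lim])
    show "eventually (\<lambda>n. norm (saddle N \<nu> n ^ A / real n) \<le>
      saddle N \<nu> n ^ A / (1 / 2 * (pi * exp ((saddle N \<nu> n - ln (M ^ 2)) / 2)) * saddle N \<nu> n)) at_top"
      using eventually_ge_at_top[of 1]
    proof eventually_elim
      case (elim n)
      define L where "L = saddle N \<nu> n"
      define E where "E = exp ((L - ln (M ^ 2)) / 2)"
      have s: "L > 0" "real n = 1 / 2 * (pi * E + (3 / 4 - \<nu> / 2)) * L"
        using is_saddle_saddle[OF assms(1) elim, of N]
        by (auto simp: is_saddle_iff[OF refl] L_def E_def M_def)
      have "1 / 2 * (pi * E) * L \<le> real n" unfolding s(2) using s(1) assms by (intro mult_right_mono) auto
      moreover have "0 < 1 / 2 * (pi * E) * L" using s(1) by (simp add: E_def)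
      ultimately have "L ^ A / real n \<le> L ^ A / (1 / 2 * (pi * E) * L)"
        using s(1) by (intro divide_left_mono) auto
      then show ?case using s(1) by (simp add: L_def E_def)
    qed
  qed
qed

section \<open>Expansions up to powers of \<open>L\<close>\<close>

text \<open>With the exponent of \<open>L\<close> existentially quantified, sums and products of
  errors need no record of the powers of \<open>L\<close>; only the power of \<open>1 / n\<close> is
  tracked.\<close>

definition polylog_O :: "(nat \<Rightarrow> real) \<Rightarrow> nat \<Rightarrow> (nat \<Rightarrow> real) set" where
  "polylog_O L m = {f. \<exists>C A. \<forall>\<^sub>F n in at_top. \<bar>f n\<bar> \<le> C * L n ^ A / real n ^ m}"

lemma polylog_OI:
  "\<forall>\<^sub>F n in at_top. \<bar>f n\<bar> \<le> C * L n ^ A / real n ^ m \<Longrightarrow> f \<in> polylog_O L m"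
  unfolding polylog_O_def by blast

lemma polylog_OE:
  assumes "f \<in> polylog_O L m" "filterlim L at_top at_top"
  obtains C A where "C \<ge> 0" "\<forall>\<^sub>F n in at_top. \<bar>f n\<bar> \<le> C * L n ^ A / real n ^ m"
proof -
  from assms(1) obtain C A where CA: "\<forall>\<^sub>F n in at_top. \<bar>f n\<bar> \<le> C * L n ^ A / real n ^ m"
    unfolding polylog_O_def by blast
  have "\<forall>\<^sub>F n in at_top. L n \<ge> 1" using assms(2) by (simp add: filterlim_at_top)
  with CA have "\<forall>\<^sub>F n in at_top. \<bar>f n\<bar> \<le> \<bar>C\<bar> * L n ^ A / real n ^ m"
  proof eventually_elim
    case (elim n)
    have "C * L n ^ A / real n ^ m \<le> \<bar>C\<bar> * L n ^ A / real n ^ m"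
      using elim by (intro divide_right_mono mult_right_mono) auto
    then show ?case using elim by linarith
  qed
  then show thesis using that[of "\<bar>C\<bar>" A] by auto
qed

lemma polylog_O_add:
  assumes "f \<in> polylog_O L m" "g \<in> polylog_O L m" and L: "filterlim L at_top at_top"
  shows "(\<lambda>n. f n + g n) \<in> polylog_O L m"
proof -
  obtain C A where C: "C \<ge> 0" "\<forall>\<^sub>F n in at_top. \<bar>f n\<bar> \<le> C * L n ^ A / real n ^ m"
    using polylog_OE[OF assms(1) L] by blast
  obtain D B where D: "D \<ge> 0" "\<forall>\<^sub>F n in at_top. \<bar>g n\<bar> \<le> D * L n ^ B / real n ^ m"
    using polylog_OE[OF assms(2) L] by blast
  have L1: "\<forall>\<^sub>F n in at_top. L n \<ge> 1" using L by (simp add: filterlim_at_top)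
  show ?thesis
  proof (rule polylog_OI[of _ "C + D" _ "max A B"])
    show "\<forall>\<^sub>F n in at_top. \<bar>f n + g n\<bar> \<le> (C + D) * L n ^ max A B / real n ^ m"
      using C(2) D(2) L1
    proof eventually_elim
      case (elim n)
      have "C * L n ^ A / real n ^ m \<le> C * L n ^ max A B / real n ^ m"
        using elim C(1) by (intro divide_right_mono mult_left_mono power_increasing) auto
      moreover have "D * L n ^ B / real n ^ m \<le> D * L n ^ max A B / real n ^ m"
        using elim D(1) by (intro divide_right_mono mult_left_mono power_increasing) auto
      ultimately show ?case using elim by (simp add: distrib_right add_divide_distrib)
    qed
  qed
qed

lemma polylog_O_mult:
  assumes "f \<in> polylog_O L m" "g \<in> polylog_O L k" and L: "filterlim L at_top at_top"
  shows "(\<lambda>n. f n * g n) \<in> polylog_O L (m + k)"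
proof -
  obtain C A where C: "C \<ge> 0" "\<forall>\<^sub>F n in at_top. \<bar>f n\<bar> \<le> C * L n ^ A / real n ^ m"
    using polylog_OE[OF assms(1) L] by blast
  obtain D B where D: "D \<ge> 0" "\<forall>\<^sub>F n in at_top. \<bar>g n\<bar> \<le> D * L n ^ B / real n ^ k"
    using polylog_OE[OF assms(2) L] by blast
  show ?thesis
  proof (rule polylog_OI[of _ "C * D" _ "A + B"])
    show "\<forall>\<^sub>F n in at_top. \<bar>f n * g n\<bar> \<le> C * D * L n ^ (A + B) / real n ^ (m + k)"
      using C(2) D(2)
    proof eventually_elim
      case (elim n)
      have "\<bar>f n * g n\<bar> \<le> (C * L n ^ A / real n ^ m) * (D * L n ^ B / real n ^ k)"
        unfolding abs_mult using elim by (intro mult_mono) auto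
      then show ?case by (simp add: power_add mult_ac)
    qed
  qed
qed

lemma polylog_O_mono:
  assumes "f \<in> polylog_O L m" "k \<le> m" and L: "filterlim L at_top at_top"
  shows "f \<in> polylog_O L k"
proof -
  obtain C A where C: "C \<ge> 0" "\<forall>\<^sub>F n in at_top. \<bar>f n\<bar> \<le> C * L n ^ A / real n ^ m"
    using polylog_OE[OF assms(1) L] by blast
  have L1: "\<forall>\<^sub>F n in at_top. L n \<ge> 1" using L by (simp add: filterlim_at_top)
  show ?thesis
  proof (rule polylog_OI[of _ C _ A])
    show "\<forall>\<^sub>F n in at_top. \<bar>f n\<bar> \<le> C * L n ^ A / real n ^ k"
      using C(2) L1 eventually_ge_at_top[of 1]
    proof eventually_elim
      case (elim n)
      have "C * L n ^ A / real n ^ m \<le> C * L n ^ A / real n ^ k"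
        using elim C(1) assms(2) by (intro divide_left_mono power_increasing) auto
      then show ?case using elim by linarith
    qed
  qed
qed

lemma polylog_O_const: "(\<lambda>n. c) \<in> polylog_O L 0"
  by (rule polylog_OI[of _ "\<bar>c\<bar>" _ 0]) simp

lemma polylog_O_divide_power:
  assumes "f \<in> polylog_O L 0" and L: "filterlim L at_top at_top"
  shows "(\<lambda>n. f n / real n ^ k) \<in> polylog_O L k"
proof -
  have "(\<lambda>n. 1 / real n ^ k) \<in> polylog_O L k" by (rule polylog_OI[of _ 1 _ 0]) simp
  from polylog_O_mult[OF assms(1) this L] show ?thesis by simp
qed

lemma polylog_O_sum:
  assumes "\<And>i. i \<in> I \<Longrightarrow> f i \<in> polylog_O L m" and L: "filterlim L at_top at_top"
  shows "(\<lambda>n. \<Sum>i\<in>I. f i n) \<in> polylog_O L m"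
proof -
  have zero: "(\<lambda>n. 0) \<in> polylog_O L m" by (rule polylog_OI[where C = 0 and A = 0]) simp
  from assms(1) show ?thesis
  proof (induction I rule: infinite_finite_induct)
    case (insert i I)
    then show ?case using polylog_O_add[OF _ _ L] by simp
  qed (use zero in auto)
qed

text \<open>With the truncations \<open>A\<close> and \<open>B\<close>, the product splits by
  \<open>u v - A B = (u - A) v + A (v - B)\<close>. In \<open>A B\<close> the pairs with
  \<open>i + j \<le> K\<close> form the Cauchy product, and all other pairs are of order
  \<open>K + 1\<close> or higher.\<close>

lemma polylog_expansion_mult:
  fixes u v :: "nat \<Rightarrow> real" and a b :: "nat \<Rightarrow> nat \<Rightarrow> real"
  assumes L: "filterlim L at_top at_top"
    and a: "\<And>j. a j \<in> polylog_O L 0" and b: "\<And>j. b j \<in> polylog_O L 0"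
    and u: "(\<lambda>n. u n - (\<Sum>j\<le>K. a j n / real n ^ j)) \<in> polylog_O L (Suc K)"
    and v: "(\<lambda>n. v n - (\<Sum>j\<le>K. b j n / real n ^ j)) \<in> polylog_O L (Suc K)"
  shows "(\<lambda>n. u n * v n - (\<Sum>k\<le>K. (\<Sum>i\<le>k. a i n * b (k - i) n) / real n ^ k)) \<in> polylog_O L (Suc K)"
proof -
  define A where "A = (\<lambda>n. \<Sum>j\<le>K. a j n / real n ^ j)"
  define B where "B = (\<lambda>n. \<Sum>j\<le>K. b j n / real n ^ j)"
  let ?T = "{(i, j). i + j \<le> K}"
  have sub: "?T \<subseteq> {..K} \<times> {..K}" by auto
  have A0: "A \<in> polylog_O L 0" unfolding A_def
    by (intro polylog_O_sum L polylog_O_mono[OF polylog_O_divide_power[OF a L] _ L]) auto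
  have B0: "B \<in> polylog_O L 0" unfolding B_def
    by (intro polylog_O_sum L polylog_O_mono[OF polylog_O_divide_power[OF b L] _ L]) auto
  have v0: "v \<in> polylog_O L 0"
    using polylog_O_add[OF polylog_O_mono[OF v _ L] B0 L] by (simp add: B_def)
  have 1: "(\<lambda>n. (u n - A n) * v n) \<in> polylog_O L (Suc K)"
    using polylog_O_mult[OF u v0 L] by (simp add: A_def)
  have 2: "(\<lambda>n. A n * (v n - B n)) \<in> polylog_O L (Suc K)"
    using polylog_O_mult[OF A0 v L] by (simp add: B_def)
  have 3: "(\<lambda>n. \<Sum>p\<in>{..K} \<times> {..K} - ?T. a (fst p) n * b (snd p) n / real n ^ (fst p + snd p))
      \<in> polylog_O L (Suc K)"
  proof (intro polylog_O_sum L)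
    fix p assume p: "p \<in> {..K} \<times> {..K} - ?T"
    have "(\<lambda>n. a (fst p) n * b (snd p) n) \<in> polylog_O L 0"
      using polylog_O_mult[OF a b L] by simp
    from polylog_O_mono[OF polylog_O_divide_power[OF this L, of "fst p + snd p"] _ L, of "Suc K"]
    show "(\<lambda>n. a (fst p) n * b (snd p) n / real n ^ (fst p + snd p)) \<in> polylog_O L (Suc K)"
      using p by auto
  qed
  have AB: "A n * B n = (\<Sum>k\<le>K. (\<Sum>i\<le>k. a i n * b (k - i) n) / real n ^ k) +
      (\<Sum>p\<in>{..K} \<times> {..K} - ?T. a (fst p) n * b (snd p) n / real n ^ (fst p + snd p))" for n
  proof -
    let ?g = "\<lambda>p. a (fst p) n * b (snd p) n / real n ^ (fst p + snd p)"
    have "A n * B n = (\<Sum>p\<in>{..K} \<times> {..K}. ?g p)"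
      by (simp add: A_def B_def sum_product sum.cartesian_product power_add case_prod_unfold)
    also have "\<dots> = sum ?g ({..K} \<times> {..K} - ?T) + sum ?g ?T"
      by (rule sum.subset_diff[OF sub]) auto
    also have "sum ?g ?T = (\<Sum>(i, j)\<in>?T. a i n * b j n / real n ^ (i + j))"
      by (simp add: case_prod_unfold)
    also have "\<dots> = (\<Sum>k\<le>K. \<Sum>i\<le>k. a i n * b (k - i) n / real n ^ (i + (k - i)))"
      by (rule sum.triangle_reindex_eq)
    also have "\<dots> = (\<Sum>k\<le>K. (\<Sum>i\<le>k. a i n * b (k - i) n) / real n ^ k)"
      unfolding sum_divide_distrib by (intro sum.cong) auto
    finally show ?thesis by simp
  qed
  have "(\<lambda>n. ((u n - A n) * v n + A n * (v n - B n)) +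
      (\<Sum>p\<in>{..K} \<times> {..K} - ?T. a (fst p) n * b (snd p) n / real n ^ (fst p + snd p))) \<in> polylog_O L (Suc K)"
    by (intro polylog_O_add 1 2 3 L)
  also have "(\<lambda>n. ((u n - A n) * v n + A n * (v n - B n)) +
      (\<Sum>p\<in>{..K} \<times> {..K} - ?T. a (fst p) n * b (snd p) n / real n ^ (fst p + snd p))) =
      (\<lambda>n. u n * v n - (\<Sum>k\<le>K. (\<Sum>i\<le>k. a i n * b (k - i) n) / real n ^ k))"
    using AB by (simp add: fun_eq_iff algebra_simps)
  finally show ?thesis .
qed

lemma polylog_O_rat_poly_fun:
  assumes "rat_poly_fun f" and L: "filterlim L at_top at_top"
  shows "(\<lambda>n. f (L n)) \<in> polylog_O L 0"
proof -
  obtain C A where "\<And>x. x \<ge> 1 \<Longrightarrow> \<bar>f x\<bar> \<le> C * x ^ A" using rat_poly_fun_bound[OF assms(1)] by blast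
  moreover have "\<forall>\<^sub>F n in at_top. L n \<ge> 1" using L by (simp add: filterlim_at_top)
  ultimately show ?thesis by (intro polylog_OI[of _ C _ A]) (auto elim: eventually_mono)
qed

lemma polylog_O_inverse:
  assumes L: "filterlim L at_top at_top"
  shows "(\<lambda>n. 1 / (1 + L n / 2) ^ m) \<in> polylog_O L 0"
proof (rule polylog_OI[of _ 1 _ 0])
  have "\<forall>\<^sub>F n in at_top. L n \<ge> 1" using L by (simp add: filterlim_at_top)
  then show "\<forall>\<^sub>F n in at_top. \<bar>1 / (1 + L n / 2) ^ m\<bar> \<le> 1 * L n ^ 0 / real n ^ 0"
  proof eventually_elim
    case (elim n)
    have "1 \<le> (1 + L n / 2) ^ m" using elim by (intro one_le_power) auto
    then show ?case using elim by simp
  qed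
qed

lemma polylog_O_laplace_coeff:
  assumes "\<beta> \<in> \<rat>" and L: "filterlim L at_top at_top"
  shows "(\<lambda>n. laplace_coeff \<beta> j (L n)) \<in> polylog_O L 0"
  unfolding laplace_coeff_def
proof (intro polylog_O_sum L)
  fix m
  have "(\<lambda>n. coeff (exp_poly \<beta> (L n) (2 * j)) (2 * m) * (fact (2 * m) / (2 ^ m * fact m)) *
      (1 / (1 + L n / 2) ^ m)) \<in> polylog_O L (0 + 0 + 0)"
    by (intro polylog_O_mult polylog_O_const polylog_O_inverse L
        polylog_O_rat_poly_fun[OF rat_poly_fun_coeff_exp_poly] assms)
  then show "(\<lambda>n. coeff (exp_poly \<beta> (L n) (2 * j)) (2 * m) * (fact (2 * m) / (2 ^ m * fact m)) /
      (1 + L n / 2) ^ m) \<in> polylog_O L 0" by simp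
qed

lemma sqrt_ratio_bound:
  fixes L \<beta> :: real
  assumes "L \<ge> 1" "0 \<le> \<beta>" "\<beta> \<le> 1"
  shows "0 \<le> \<beta> * L\<^sup>2 / (4 * (1 + L / 2))" "\<beta> * L\<^sup>2 / (4 * (1 + L / 2)) \<le> L\<^sup>2"
proof -
  show "0 \<le> \<beta> * L\<^sup>2 / (4 * (1 + L / 2))" using assms by simp
  have "\<beta> * L\<^sup>2 / (4 * (1 + L / 2)) \<le> 1 * L\<^sup>2 / 1"
    using assms by (intro frac_le mult_mono) auto
  then show "\<beta> * L\<^sup>2 / (4 * (1 + L / 2)) \<le> L\<^sup>2" by simp
qed

lemma polylog_O_sqrt_coeff:
  assumes "0 \<le> \<beta>" "\<beta> \<le> 1" and L: "filterlim L at_top at_top"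
  shows "(\<lambda>n. sqrt_coeff \<beta> j (L n)) \<in> polylog_O L 0"
proof (rule polylog_OI[of _ 1 _ "2 * j"])
  have "\<forall>\<^sub>F n in at_top. L n \<ge> 1" using L by (simp add: filterlim_at_top)
  then show "\<forall>\<^sub>F n in at_top. \<bar>sqrt_coeff \<beta> j (L n)\<bar> \<le> 1 * L n ^ (2 * j) / real n ^ 0"
  proof eventually_elim
    case (elim n)
    define X where "X = \<beta> * (L n)\<^sup>2 / (4 * (1 + L n / 2))"
    have X: "0 \<le> X" "X \<le> (L n)\<^sup>2" unfolding X_def using sqrt_ratio_bound[OF elim assms(1,2)] by auto
    have "\<bar>sqrt_coeff \<beta> j (L n)\<bar> = \<bar>(1 / 2 :: real) gchoose j\<bar> * X ^ j"
      unfolding sqrt_coeff_def X_def[symmetric] using X by (simp add: abs_mult power_abs)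
    also have "\<dots> \<le> 1 * ((L n)\<^sup>2) ^ j"
      using X abs_gbinomial_half_le by (intro mult_mono power_mono) auto
    finally show ?case by (simp add: power_mult)
  qed
qed

section \<open>Quotient by the main term, and size of the coefficients\<close>

lemma poly_abs_bounded_below:
  fixes p :: "real poly"
  assumes "p \<noteq> 0"
  obtains c where "c > 0" "\<forall>\<^sub>F x in at_top. \<bar>poly p x\<bar> \<ge> c"
proof -
  have *: "\<forall>\<^sub>F x in at_top. poly q x \<ge> lead_coeff q" if "lead_coeff q > 0" for q :: "real poly"
    using poly_pinfty_gt_lc[OF that] by (auto simp: eventually_at_top_linorder)
  show thesis
  proof (cases "lead_coeff p > 0")
    case True
    then show ?thesis using *[OF True] by (intro that[of "lead_coeff p"]) (auto elim: eventually_mono)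
  next
    case False
    then have "lead_coeff (- p) > 0" using assms by (simp add: lead_coeff_minus less_le)
    then show ?thesis using *[of "- p"]
      by (intro that[of "lead_coeff (- p)"]) (auto elim!: eventually_mono)
  qed
qed

text \<open>An exact identity: the square root in the main term splits as
  \<open>2 * sqrt n * sqrt (1 + L / 2) * sqrt (1 - X)\<close>, and the last two roots are
  compensated by the factors inserted next to \<open>J\<close>, which are what gets expanded. The
  bound \<open>n \<ge> 8 * L^2\<close> keeps \<open>X\<close> below 1, so the root does not
  vanish.\<close>

lemma F_char_eq_main_term:
  fixes L \<beta> J :: real
  assumes N: "N > 1" and \<beta>: "\<beta> = 3 / 4 - \<nu> / 2" "0 \<le> \<beta>" "\<beta> \<le> 1"
    and L: "L = saddle N \<nu> n" "L \<ge> 2" and n: "real n \<ge> 8 * L\<^sup>2"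
  shows "(1 + (- 1) ^ n) / 2 ^ (2 * n + 1) * (L ^ (n + 1) / sqrt (real n)) *
      exp ((1 - \<beta>) * L / 2 - (2 * real n / L - \<beta>)) * J =
    main_term N \<nu> n * (sqrt (1 - \<beta> * L\<^sup>2 / (4 * (1 + L / 2)) / real n) *
      (sqrt ((1 + L / 2) / (2 * pi)) * J))"
proof -
  define a where "a = 1 + L / 2"
  define X where "X = \<beta> * L\<^sup>2 / (4 * a) / real n"
  define \<alpha> where "\<alpha> = 1 / 4 + \<nu> / 2"
  have a: "a > 0" using L by (simp add: a_def)
  have "8 * L\<^sup>2 > 0" using L by simp
  then have n0: "real n > 0" using n by linarith
  have N0: "real N > 0" using N by simp
  have X: "X < 1"
  proof -
    have "\<beta> * L\<^sup>2 / (4 * a) \<le> L\<^sup>2" unfolding a_def using L \<beta> by (intro sqrt_ratio_bound) auto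
    also have "\<dots> < real n" using n L n0 by (smt (verit) zero_less_power)
    finally show ?thesis unfolding X_def divide_less_eq_1_pos[OF n0] .
  qed
  have den: "4 * real n * (1 + L / 2) - (3 / 4 - \<nu> / 2) * L\<^sup>2 = 4 * real n * a * (1 - X)"
    unfolding \<beta>(1)[symmetric] a_def[symmetric] using a n0 by (simp add: X_def field_simps)
  have "sqrt (4 * real n * a * (1 - X)) = 2 * sqrt (real n) * sqrt a * sqrt (1 - X)"
    by (simp add: real_sqrt_mult)
  then have s: "sqrt (2 * pi) * (1 / sqrt (4 * real n * a * (1 - X))) * (sqrt (1 - X) * sqrt (a / (2 * pi))) =
      1 / (2 * sqrt (real n))"
    using a X n0 by (simp add: real_sqrt_divide)
  \<comment> \<open>Since \<open>1/8 + \<nu>/4 = \<alpha> / 2\<close>, the power of \<open>N\<close>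
    cancels against \<open>exp (- \<alpha> * ln N)\<close>, and no explicit \<open>N\<close>
    remains.\<close>
  have e: "real N powr \<alpha> * exp ((1 / 8 + \<nu> / 4) * (L - ln (real N ^ 2)) - 2 * real n / L + 3 / 4 - \<nu> / 2) =
      exp ((1 - \<beta>) * L / 2 - (2 * real n / L - \<beta>))"
    using N0 by (simp add: powr_def \<alpha>_def \<beta>(1) ln_realpow algebra_simps flip: exp_add)
  have "main_term N \<nu> n * (sqrt (1 - X) * (sqrt (a / (2 * pi)) * J)) =
      (sqrt (2 * pi) * (1 / sqrt (4 * real n * a * (1 - X))) * (sqrt (1 - X) * sqrt (a / (2 * pi)))) *
      (real N powr \<alpha> * exp ((1 / 8 + \<nu> / 4) * (L - ln (real N ^ 2)) - 2 * real n / L + 3 / 4 - \<nu> / 2)) *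
      ((1 + (- 1) ^ n) / 2 ^ (2 * n) * L ^ (n + 1) * J)"
    unfolding main_term_def Let_def L(1)[symmetric] den \<alpha>_def[symmetric] by (simp add: mult_ac)
  also have "\<dots> = (1 + (- 1) ^ n) / 2 ^ (2 * n + 1) * (L ^ (n + 1) / sqrt (real n)) *
      exp ((1 - \<beta>) * L / 2 - (2 * real n / L - \<beta>)) * J"
    unfolding s e by (simp add: mult_ac)
  finally show ?thesis by (simp add: X_def a_def)
qed

text \<open>\<open>Q\<close> takes the place of the quotient of \<open>F_char\<close> by
  \<open>main_term\<close>, which is meaningless for odd \<open>n\<close>, where both vanish. As the
  product of the square root factor and the normalised Laplace integral it can be expanded along all
  \<open>n\<close>, of either parity.\<close>

lemma F_char_ratio_expansion:
  fixes chi :: "int \<Rightarrow> complex"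
  assumes N: "N > 1" and chi: "primitive_dirichlet_character N chi" "real_character chi"
  defines "\<nu> \<equiv> real (parity_exponent chi)"
  defines "\<beta> \<equiv> 3 / 4 - \<nu> / 2" and "L \<equiv> saddle N \<nu>"
  obtains Q :: "nat \<Rightarrow> real" where
    "\<forall>\<^sub>F n in at_top. F_char N chi n = complex_of_real (main_term N \<nu> n * Q n)"
    "\<And>K. (\<lambda>n. Q n - (\<Sum>k\<le>K. expansion_coeff \<beta> k (L n) / real n ^ k)) \<in> polylog_O L (Suc K)"
proof -
  have \<nu>: "\<nu> \<le> 1" "\<nu> \<in> \<rat>" by (simp_all add: \<nu>_def parity_exponent_def)
  have \<beta>: "0 \<le> \<beta>" "\<beta> \<le> 1" "\<beta> \<in> \<rat>"
    using \<nu> by (auto simp: \<beta>_def \<nu>_def)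
  have N0: "real N > 0" using N by simp
  have L_top: "filterlim L at_top at_top" unfolding L_def by (rule filterlim_saddle[OF \<nu>(1)])
  obtain \<Theta> C0 where \<Theta>: "\<Theta> \<in> borel_measurable borel" "C0 \<ge> 0"
      "\<And>y. y \<ge> 1 / real N \<Longrightarrow> theta_char chi (\<i> * complex_of_real y) = complex_of_real (2 * \<Theta> y)"
      "\<And>y. y \<ge> 1 / real N \<Longrightarrow> \<bar>\<Theta> y * exp (pi * y) - 1\<bar> \<le> C0 * exp (- pi * y)"
    using theta_char_leading_term[OF N chi] by metis
  note [measurable] = \<Theta>(1)
  define g where "g = (\<lambda>n t. exp (L n * (1 + t / sqrt (real n)) / 2) / real N)"
  define w where "w = (\<lambda>n t. \<Theta> (g n t) * exp (pi * g n t))"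
  define J where "J = (\<lambda>n. \<integral>t. saddle_kernel \<beta> (L n) n t * w n t \<partial>lborel)"
  define u where "u = (\<lambda>n. sqrt ((1 + L n / 2) / (2 * pi)) * J n)"
  define v where "v = (\<lambda>n. sqrt (1 - \<beta> * (L n)\<^sup>2 / (4 * (1 + L n / 2)) / real n))"
  have wm: "w n \<in> borel_measurable borel" for n unfolding w_def g_def by measurable
  have "\<forall>\<^sub>F n in at_top. L n ^ 2 / real n < 1 / 8"
    using saddle_power_bound[OF \<nu>(1) N, of 2] unfolding L_def by (rule order_tendstoD) simp
  moreover have "\<forall>\<^sub>F n in at_top. L n \<ge> 2" using L_top by (simp add: filterlim_at_top)
  ultimately have ev: "\<forall>\<^sub>F n in at_top. n \<ge> 1 \<and> L n \<ge> 2 \<and> real n \<ge> 8 * (L n)\<^sup>2"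
    using eventually_ge_at_top[of 1] by eventually_elim (auto simp: field_simps)
  have sad: "is_saddle N \<nu> n (L n)" if "n \<ge> 1" for n
    unfolding L_def by (rule is_saddle_saddle[OF \<nu>(1) that])
  have w1: "\<bar>w n t - 1\<bar> \<le> C0 * exp (- (2 * real n / L n - \<beta>) * exp (L n * (t / sqrt (real n)) / 2))"
    if n: "n \<ge> 1" "L n \<ge> 2" and t: "t \<ge> - sqrt (real n)" for n t
  proof -
    have "t / sqrt (real n) \<ge> - 1" using t n by (simp add: field_simps)
    then have "L n * (1 + t / sqrt (real n)) / 2 \<ge> 0" using n by simp
    then have "g n t \<ge> 1 / real N" using N0 by (simp add: g_def divide_right_mono)
    from \<Theta>(4)[OF this] have "\<bar>w n t - 1\<bar> \<le> C0 * exp (- pi * g n t)" by (simp add: w_def)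
    moreover have "pi * g n t = (2 * real n / L n - \<beta>) * exp (L n * (t / sqrt (real n)) / 2)"
    proof -
      have "2 * real n / L n - \<beta> = pi * exp ((L n - ln (real N ^ 2)) / 2)"
        using sad[OF n(1)] n(2) by (simp add: is_saddle_iff[OF \<beta>_def[THEN meta_eq_to_obj_eq]] field_simps)
      also have "exp ((L n - ln (real N ^ 2)) / 2) = exp (L n / 2) / real N"
        using N0 by (simp add: diff_divide_distrib exp_diff ln_realpow)
      finally show ?thesis
        by (simp add: g_def distrib_left add_divide_distrib exp_add)
    qed
    then have "- pi * g n t = - (2 * real n / L n - \<beta>) * exp (L n * (t / sqrt (real n)) / 2)"
      by (simp only: mult_minus_left)
    ultimately show ?thesis by (simp only:)
  qed
  show thesis
  proof (rule that[of "\<lambda>n. v n * u n"])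
    \<comment> \<open>Only integrability is taken from this instance, so order 0 is enough.\<close>
    obtain C A where "C \<ge> 0" and CA: "\<And>L n w. L \<ge> 2 \<Longrightarrow> real n \<ge> 8 * L\<^sup>2 \<Longrightarrow> w \<in> borel_measurable borel \<Longrightarrow>
      (\<And>t. t \<ge> - sqrt (real n) \<Longrightarrow> \<bar>w t - 1\<bar> \<le>
         C0 * exp (- (2 * real n / L - \<beta>) * exp (L * (t / sqrt (real n)) / 2))) \<Longrightarrow>
      integrable lborel (\<lambda>t. saddle_kernel \<beta> L n t * w t) \<and>
      \<bar>sqrt ((1 + L / 2) / (2 * pi)) * (\<integral>t. saddle_kernel \<beta> L n t * w t \<partial>lborel) -
         (\<Sum>j\<le>0. laplace_coeff \<beta> j L / real n ^ j)\<bar> \<le> C * L ^ A / real n ^ Suc 0"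
      by (rule laplace_expansion[OF \<beta> \<Theta>(2), of 0]) (rule that, assumption, blast)
    show "\<forall>\<^sub>F n in at_top. F_char N chi n = complex_of_real (main_term N \<nu> n * (v n * u n))"
      using ev
    proof eventually_elim
      case (elim n)
      have n1: "n \<ge> 1" using elim by blast
      have int: "integrable lborel (\<lambda>t. saddle_kernel \<beta> (L n) n t * w n t)"
        by (rule CA[OF _ _ wm w1, THEN conjunct1]) (use elim in auto)
      have "F_char N chi n = complex_of_real ((1 + (- 1) ^ n) / 2 ^ (2 * n + 1) * (L n ^ (n + 1) / sqrt (real n)) *
          exp ((1 - \<beta>) * L n / 2 - (2 * real n / L n - \<beta>)) * J n)"
        unfolding J_def w_def g_def
        by (rule F_char_eq[OF N _ _ _ _ \<Theta>(1) \<Theta>(3)])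
          (use n1 sad[OF n1] int in \<open>simp_all add: \<nu>_def \<beta>_def w_def g_def\<close>)
      also have "(1 + (- 1) ^ n) / 2 ^ (2 * n + 1) * (L n ^ (n + 1) / sqrt (real n)) *
          exp ((1 - \<beta>) * L n / 2 - (2 * real n / L n - \<beta>)) * J n = main_term N \<nu> n * (v n * u n)"
        unfolding v_def u_def
        by (rule F_char_eq_main_term[OF N]) (use elim \<beta> in \<open>simp_all add: \<beta>_def L_def\<close>)
      finally show ?case .
    qed
  next
    fix K
    have v_exp: "(\<lambda>n. v n - (\<Sum>j\<le>K. sqrt_coeff \<beta> j (L n) / real n ^ j)) \<in> polylog_O L (Suc K)"
    proof (rule polylog_OI[of _ 2 _ "2 * Suc K"])
      show "\<forall>\<^sub>F n in at_top. \<bar>v n - (\<Sum>j\<le>K. sqrt_coeff \<beta> j (L n) / real n ^ j)\<bar> \<le>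
          2 * L n ^ (2 * Suc K) / real n ^ Suc K"
        using ev
      proof eventually_elim
        case (elim n)
        define X where "X = \<beta> * (L n)\<^sup>2 / (4 * (1 + L n / 2))"
        have X: "0 \<le> X" "X \<le> (L n)\<^sup>2"
          unfolding X_def using sqrt_ratio_bound[of "L n" \<beta>] elim \<beta> by auto
        have n0: "real n > 0" using elim by auto
        have Xn: "\<bar>X / real n\<bar> \<le> 1 / 2" using X elim n0 by (simp add: field_simps)
        have "(\<Sum>j\<le>K. sqrt_coeff \<beta> j (L n) / real n ^ j) = (\<Sum>k<Suc K. ((1 / 2) gchoose k) * (- (X / real n)) ^ k)"
          unfolding lessThan_Suc_atMost
        proof (intro sum.cong refl)
          fix j
          have "(- (X / real n)) ^ j = (- X) ^ j / real n ^ j" by (simp flip: power_divide)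
          then show "sqrt_coeff \<beta> j (L n) / real n ^ j = ((1 / 2) gchoose j) * (- (X / real n)) ^ j"
            by (simp add: sqrt_coeff_def X_def)
        qed
        then have "\<bar>v n - (\<Sum>j\<le>K. sqrt_coeff \<beta> j (L n) / real n ^ j)\<bar> \<le> 2 * \<bar>X / real n\<bar> ^ Suc K"
          using sqrt_1_minus_tail_bound[OF Xn, of "Suc K"] by (simp only: v_def X_def)
        also have "\<dots> \<le> 2 * ((L n)\<^sup>2 / real n) ^ Suc K"
          using X n0 by (intro mult_left_mono power_mono) (auto simp: divide_right_mono)
        also have "\<dots> = 2 * L n ^ (2 * Suc K) / real n ^ Suc K"
          unfolding power_divide power_mult by simp
        finally show ?case .
      qed
    qed
    obtain C A where "C \<ge> 0" and CA: "\<And>L n w. L \<ge> 2 \<Longrightarrow> real n \<ge> 8 * L\<^sup>2 \<Longrightarrow> w \<in> borel_measurable borel \<Longrightarrow>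
      (\<And>t. t \<ge> - sqrt (real n) \<Longrightarrow> \<bar>w t - 1\<bar> \<le>
         C0 * exp (- (2 * real n / L - \<beta>) * exp (L * (t / sqrt (real n)) / 2))) \<Longrightarrow>
      integrable lborel (\<lambda>t. saddle_kernel \<beta> L n t * w t) \<and>
      \<bar>sqrt ((1 + L / 2) / (2 * pi)) * (\<integral>t. saddle_kernel \<beta> L n t * w t \<partial>lborel) -
         (\<Sum>j\<le>K. laplace_coeff \<beta> j L / real n ^ j)\<bar> \<le> C * L ^ A / real n ^ Suc K"
      by (rule laplace_expansion[OF \<beta> \<Theta>(2), of K]) (rule that, assumption, blast)
    have u_exp: "(\<lambda>n. u n - (\<Sum>j\<le>K. laplace_coeff \<beta> j (L n) / real n ^ j)) \<in> polylog_O L (Suc K)"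
    proof (rule polylog_OI[of _ C _ A])
      show "\<forall>\<^sub>F n in at_top. \<bar>u n - (\<Sum>j\<le>K. laplace_coeff \<beta> j (L n) / real n ^ j)\<bar> \<le>
          C * L n ^ A / real n ^ Suc K"
        using ev
      proof eventually_elim
        case (elim n)
        show ?case unfolding u_def J_def
          by (rule CA[OF _ _ wm w1, THEN conjunct2]) (use elim in auto)
      qed
    qed
    show "(\<lambda>n. v n * u n - (\<Sum>k\<le>K. expansion_coeff \<beta> k (L n) / real n ^ k)) \<in> polylog_O L (Suc K)"
      unfolding expansion_coeff_def
      by (rule polylog_expansion_mult[OF L_top polylog_O_sqrt_coeff[OF \<beta>(1,2) L_top]
            polylog_O_laplace_coeff[OF \<beta>(3) L_top] v_exp u_exp])
  qed
qed

lemma map_poly_of_rat_power: "map_poly of_rat (p ^ k) = (map_poly of_rat p :: real poly) ^ k"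
  by (induction k) (simp_all add: map_poly_of_rat_mult)

lemma expansion_coeff_rational_function:
  assumes "\<beta> \<in> \<rat>"
  obtains p q :: "rat poly" where "q \<noteq> 0"
    "\<And>x. x \<noteq> - 2 \<Longrightarrow> expansion_coeff \<beta> j x = poly (map_poly of_rat p) x / poly (map_poly of_rat q) x"
proof -
  obtain p :: "rat poly" where p: "\<And>x. expansion_num \<beta> j x = poly (map_poly of_rat p) x"
    using rat_poly_fun_expansion_num[OF assms, of j] by (auto simp: rat_poly_fun_def)
  define q :: "rat poly" where "q = [:1, 1 / 2:] ^ (3 * j)"
  have "map_poly of_rat [:1, 1 / 2:] = ([:1, 1 / 2:] :: real poly)"
    by (simp add: map_poly_pCons of_rat_divide)
  then have "poly (map_poly of_rat q) x = (1 + x / 2) ^ (3 * j)" for x :: real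
    unfolding q_def map_poly_of_rat_power by (simp add: poly_power)
  then show thesis using that[of q p] p expansion_coeff_eq[of _ \<beta> j] by (simp add: q_def)
qed

text \<open>The numerator is a nonzero polynomial, hence bounded away from 0 near infinity, and
  \<open>1 + x / 2 \<le> x\<close> for \<open>x \<ge> 2\<close> controls the denominator.\<close>

lemma expansion_coeff_bounded_below:
  assumes "\<beta> \<in> \<rat>"
  obtains c where "c > 0" "\<forall>\<^sub>F x in at_top. \<bar>expansion_coeff \<beta> j x\<bar> \<ge> c / x ^ (3 * j)"
proof -
  obtain p :: "rat poly" where p: "\<And>x. expansion_num \<beta> j x = poly (map_poly of_rat p) x"
    using rat_poly_fun_expansion_num[OF assms, of j] by (auto simp: rat_poly_fun_def)
  have nz: "map_poly of_rat p \<noteq> (0 :: real poly)"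
    using expansion_num_nonzero[of \<beta> j] unfolding p by auto
  obtain c where c: "c > 0" "\<forall>\<^sub>F x in at_top. \<bar>poly (map_poly of_rat p) (x :: real)\<bar> \<ge> c"
    by (rule poly_abs_bounded_below[OF nz]) (rule that)
  have "\<forall>\<^sub>F x in at_top. \<bar>expansion_coeff \<beta> j x\<bar> \<ge> c / x ^ (3 * j)"
    using c(2) eventually_ge_at_top[of 2]
  proof eventually_elim
    case (elim x)
    have "c / x ^ (3 * j) \<le> \<bar>expansion_num \<beta> j x\<bar> / (1 + x / 2) ^ (3 * j)"
      using elim c(1) unfolding p by (intro frac_le power_mono) auto
    then show ?case using expansion_coeff_eq[of x \<beta> j] elim by (simp add: abs_divide power_abs)
  qed
  with c(1) show thesis by (rule that)
qed

theorem theorem4p1: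
  fixes N :: nat and chi :: "int \<Rightarrow> complex" and \<nu> :: real and L :: "nat \<Rightarrow> real"
  assumes "N > 1"
    and "primitive_dirichlet_character N chi"
    and "real_character chi"
    and "self_dual_character chi"
  defines "\<nu> \<equiv> real (parity_exponent chi)"
  defines "L \<equiv> saddle N \<nu>"
  shows "(\<forall>n\<ge>1. \<exists>!x. is_saddle N \<nu> n x) \<and>
    asymp_equiv L at_top (\<lambda>n. 2 * ln (real n * real N / ln (real n * real N))) \<and>
    (\<exists>b :: nat \<Rightarrow> real \<Rightarrow> real.
       b 0 = (\<lambda>x. 1) \<and>
       (\<forall>j\<ge>1. b j \<in> rational_functions_over_Q) \<and>
       (\<forall>x>0. b 1 x =
          (x ^ 4 + 9 * x ^ 3 + 32 * x ^ 2 + 24 * x + 16) / (24 * (x + 2) ^ 3)) \<and>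
       asymptotic_expansion (F_char N chi)
         (\<lambda>n. complex_of_real (main_term N \<nu> n))
         (\<lambda>j n. complex_of_real (b j (L n) / real n ^ j)))"
proof (intro conjI)
  define \<beta> where "\<beta> = 3 / 4 - \<nu> / 2"
  have \<nu>: "\<nu> \<le> 1" "\<nu> \<in> \<rat>" by (simp_all add: \<nu>_def parity_exponent_def)
  then have \<beta>: "\<beta> \<in> \<rat>" by (auto simp: \<beta>_def)
  show "\<forall>n\<ge>1. \<exists>!x. is_saddle N \<nu> n x" using ex1_saddle[OF \<nu>(1)] by blast
  show "asymp_equiv L at_top (\<lambda>n. 2 * ln (real n * real N / ln (real n * real N)))"
    unfolding L_def by (rule saddle_asymp_equiv[OF \<nu>(1) assms(1)])
  have L_top: "filterlim L at_top at_top" unfolding L_def by (rule filterlim_saddle[OF \<nu>(1)])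
  have L2: "\<forall>\<^sub>F n in at_top. L n \<ge> 2" using L_top by (simp add: filterlim_at_top)
  obtain Q where Q: "\<forall>\<^sub>F n in at_top. F_char N chi n = complex_of_real (main_term N \<nu> n * Q n)"
    "\<And>K. (\<lambda>n. Q n - (\<Sum>k\<le>K. expansion_coeff \<beta> k (L n) / real n ^ k)) \<in> polylog_O L (Suc K)"
    by (rule F_char_ratio_expansion[OF assms(1-3), folded \<nu>_def, folded \<beta>_def L_def]) (rule that)
  have "\<forall>j. \<exists>p q :: rat poly. q \<noteq> 0 \<and> (\<forall>x. x \<noteq> - 2 \<longrightarrow>
      expansion_coeff \<beta> j x = poly (map_poly of_rat p) x / poly (map_poly of_rat q) x)"
    using expansion_coeff_rational_function[OF \<beta>] by metis
  then obtain p q :: "nat \<Rightarrow> rat poly" where pq: "\<And>j. q j \<noteq> 0"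
    "\<And>j x. x \<noteq> - 2 \<Longrightarrow> expansion_coeff \<beta> j x = poly (map_poly of_rat (p j)) x / poly (map_poly of_rat (q j)) x"
    by metis
  \<comment> \<open>The quotients of polynomials are used in place of
    \<open>expansion_coeff\<close>, because membership in \<open>rational_functions_over_Q\<close>
    is an equality of functions at every real, including \<open>- 2\<close>. The case
    \<open>j = 0\<close> is separate since \<open>b 0\<close> has to be 1 everywhere.\<close>
  define b where "b = (\<lambda>j x. if j = 0 then 1 else
      poly (map_poly of_rat (p j)) x / poly (map_poly of_rat (q j)) x :: real)"
  have b_eq: "b j x = expansion_coeff \<beta> j x" if "x > 0" for j x
    using pq(2)[of x j] that by (cases "j = 0") (simp_all add: b_def expansion_coeff_0)
  have small: "(\<lambda>n. Q n - (\<Sum>j\<le>K. b j (L n) / real n ^ j)) \<in> o(\<lambda>n. b K (L n) / real n ^ K)" for K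
  proof (rule landau_o.smallI)
    fix \<epsilon> :: real assume \<epsilon>: "\<epsilon> > 0"
    obtain C A where CA: "C \<ge> 0" "\<forall>\<^sub>F n in at_top.
        \<bar>Q n - (\<Sum>k\<le>K. expansion_coeff \<beta> k (L n) / real n ^ k)\<bar> \<le> C * L n ^ A / real n ^ Suc K"
      by (rule polylog_OE[OF Q(2) L_top]) (rule that)
    obtain c where c: "c > 0" "\<forall>\<^sub>F x in at_top. \<bar>expansion_coeff \<beta> K x\<bar> \<ge> c / x ^ (3 * K)"
      by (rule expansion_coeff_bounded_below[OF \<beta>]) (rule that)
    have c': "\<forall>\<^sub>F n in at_top. \<bar>expansion_coeff \<beta> K (L n)\<bar> \<ge> c / L n ^ (3 * K)"
      using c(2) L_top by (rule eventually_compose_filterlim)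
    \<comment> \<open>Up to constants this is the ratio of the error bound to the lower bound for
      the last retained term.\<close>
    have "(\<lambda>n. C * (L n ^ (A + 3 * K) / real n)) \<longlonglongrightarrow> C * 0"
      unfolding L_def by (intro tendsto_mult_left saddle_power_bound \<nu> assms(1))
    then have "\<forall>\<^sub>F n in at_top. C * (L n ^ (A + 3 * K) / real n) < \<epsilon> * c"
      using \<epsilon> c(1) by (intro order_tendstoD) auto
    then show "\<forall>\<^sub>F n in at_top. norm (Q n - (\<Sum>j\<le>K. b j (L n) / real n ^ j)) \<le>
        \<epsilon> * norm (b K (L n) / real n ^ K)"
      using CA(2) c' L2 eventually_ge_at_top[of 1]
    proof eventually_elim
      case (elim n)
      have L0: "L n > 0" using elim by simp
      have n0: "real n > 0" using elim by simp
      have "C * L n ^ A / real n ^ Suc K =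
          C * (L n ^ (A + 3 * K) / real n) / (L n ^ (3 * K) * real n ^ K)"
        using L0 by (simp add: power_add)
      also have "\<dots> \<le> \<epsilon> * c / (L n ^ (3 * K) * real n ^ K)"
        using elim(1) L0 n0 by (intro divide_right_mono) auto
      also have "\<dots> = \<epsilon> * (c / L n ^ (3 * K) / real n ^ K)" by simp
      also have "\<dots> \<le> \<epsilon> * (\<bar>expansion_coeff \<beta> K (L n)\<bar> / real n ^ K)"
        using elim(3) \<epsilon> by (intro mult_left_mono divide_right_mono) auto
      finally show ?case using elim(2) by (simp add: b_eq[OF L0] abs_divide)
    qed
  qed
  show "\<exists>b :: nat \<Rightarrow> real \<Rightarrow> real.
       b 0 = (\<lambda>x. 1) \<and>
       (\<forall>j\<ge>1. b j \<in> rational_functions_over_Q) \<and>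
       (\<forall>x>0. b 1 x =
          (x ^ 4 + 9 * x ^ 3 + 32 * x ^ 2 + 24 * x + 16) / (24 * (x + 2) ^ 3)) \<and>
       asymptotic_expansion (F_char N chi)
         (\<lambda>n. complex_of_real (main_term N \<nu> n))
         (\<lambda>j n. complex_of_real (b j (L n) / real n ^ j))"
  proof (intro exI[of _ b] conjI allI impI)
    show "b 0 = (\<lambda>x. 1)" by (simp add: b_def)
  next
    fix j :: nat assume "j \<ge> 1"
    then show "b j \<in> rational_functions_over_Q"
      unfolding rational_functions_over_Q_def using pq(1)[of j] by (auto simp: b_def)
  next
    fix x :: real assume "x > 0"
    then show "b 1 x = (x ^ 4 + 9 * x ^ 3 + 32 * x ^ 2 + 24 * x + 16) / (24 * (x + 2) ^ 3)"
      using b_eq[of x 1] expansion_coeff_1[of x \<beta>] by simp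
  next
    show "asymptotic_expansion (F_char N chi) (\<lambda>n. complex_of_real (main_term N \<nu> n))
        (\<lambda>j n. complex_of_real (b j (L n) / real n ^ j))"
      unfolding asymptotic_expansion_def
    proof (intro allI landau_o.smallI)
      fix K and \<epsilon> :: real assume "\<epsilon> > 0"
      from landau_o.smallD[OF small[of K] this] Q(1)
      show "\<forall>\<^sub>F n in at_top. norm (F_char N chi n - complex_of_real (main_term N \<nu> n) *
          (\<Sum>j\<le>K. complex_of_real (b j (L n) / real n ^ j)))
        \<le> \<epsilon> * norm (complex_of_real (main_term N \<nu> n) * complex_of_real (b K (L n) / real n ^ K))"
      proof eventually_elim
        case (elim n)
        have "F_char N chi n - complex_of_real (main_term N \<nu> n) * (\<Sum>j\<le>K. complex_of_real (b j (L n) / real n ^ j))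
            = complex_of_real (main_term N \<nu> n * (Q n - (\<Sum>j\<le>K. b j (L n) / real n ^ j)))"
          unfolding elim(2) by (simp add: algebra_simps)
        then have "norm (F_char N chi n - complex_of_real (main_term N \<nu> n) *
            (\<Sum>j\<le>K. complex_of_real (b j (L n) / real n ^ j))) =
            \<bar>main_term N \<nu> n\<bar> * norm (Q n - (\<Sum>j\<le>K. b j (L n) / real n ^ j))"
          by (simp only: norm_of_real abs_mult real_norm_def)
        \<comment> \<open>The estimate for \<open>Q\<close> is multiplied by the main term, never
          divided by it, which covers the odd \<open>n\<close>, where the main term is 0.\<close>
        also have "\<dots> \<le> \<bar>main_term N \<nu> n\<bar> * (\<epsilon> * norm (b K (L n) / real n ^ K))"
          using elim(1) by (intro mult_left_mono) auto
        also have "\<dots> = \<epsilon> * norm (complex_of_real (main_term N \<nu> n) * complex_of_real (b K (L n) / real n ^ K))"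
          unfolding norm_mult norm_of_real by simp
        finally show ?case .
      qed
    qed
  qed
qed

end
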